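(* The Fuchsian equation $$\frac{d^2y}{dz^2}+P(z)\frac{dy}{dz}+Q(z)y=0$$ with the coefficients $P$, $Q$ given in the context is `finite-gap' if and only if the function $I_0$ given in the context satisfies, for some integer $g\ge0$, Novikov's equation of order $g$ for the Fuchsian equation.
   Context: **The Fuchsian equation.** Fix $a\in\mathbb{C}\setminus\{0,1\}$, an integer $M\ge 0$, nonnegative integers $m_0,m_1,m_2,m_3,n_1,\dots,n_M$, and pairwise distinct $b_1,\dots,b_M\in\mathbb{C}\setminus\{0,1,a\}$; $\lambda\in\mathbb{C}$ is a parameter (spectral parameter). Put $N=\sum_{j=0}^3 m_j+2\sum_{k=1}^M n_k$, $$P(z)=\frac12\left(\frac{1-2m_1}{z}+\frac{1-2m_2}{z-1}+\frac{1-2m_3}{z-a}\right)-2\sum_{k=1}^M\frac{n_k}{z-b_k},$$ $$Q(z)=\frac{N(N-2m_0-1)z+\lambda+R_M(z)}{4z(z-1)(z-a)},\qquad R_M(z)=2\sum_{k=1}^M\frac{n_k\rho_k}{z-b_k},$$ $$\rho_k=2(b_k-1)(b_k-a)m_1+2b_k(b_k-a)m_2+2b_k(b_k-1)m_3+(3b_k^2-2(a+1)b_k+a)n_k+4\sum_{j\ne k}\frac{b_k(b_k-1)(b_k-a)}{b_k-b_j}n_j .$$ **The associated Schrödinger equation.** Let $\wp$ be a Weierstrass function with half-periods $\omega_1,\omega_2=\omega_1+\omega_3,\omega_3$, $e_i=\wp(\omega_i)$, whose lattice satisfies $(e_3-e_1)/(e_2-e_1)=a$ (the lattice is determined by $a$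 up to scaling, which is immaterial). Choose $\delta_k$ with $\wp(\delta_k)=e_1+(e_2-e_1)b_k$ and put $$u(x)=m_0(m_0+1)\wp(x)+\sum_{i=1}^3 m_i(m_i+1)\wp(x-\omega_i)+\sum_{k=1}^M n_k(n_k+1)\{\wp(x-\delta_k)+\wp(x+\delta_k)\}.$$ The change of variables $$\psi(x)=y(z)\,z^{-m_1/2}(z-1)^{-m_2/2}(z-a)^{-m_3/2}\prod_{k=1}^M(z-b_k)^{-n_k},\quad \wp(x)=e_1+(e_2-e_1)z,\quad E=(e_1-e_2)\lambda+\mathrm{const}$$ (with a suitable constant independent of $\lambda$) transforms $\psi_{xx}-u(x)\psi=E\psi$ into the Fuchsian equation $\frac{d^2y}{dz^2}+P(z)\frac{dy}{dz}+Q(z)y=0$. **Finite-gap.** Let $J_0=u$, and let $J_{n+1}$ be determined by $\partial_xJ_{n+1}=\partial_x^3J_n-4u\,\partial_xJ_n-2u_xJ_n$ (differential polynomials in $u$; e.g. $J_1=u_{xx}-3u^2$). The elliptic potential $u$ is finite-gap if for some $g\ge0$ there are constants $c_m,d$ with $J_g+\sum_{m=1}^g c_mJ_{g-m}=d$. The Fuchsian equation is called `finite-gap' if it is obtained, via the change of variables $\psi(x)=y(z)\,z^{-m_1/2}(z-1)^{-m_2/2}(z-a)^{-m_3/2}\prod_{k=1}^M(z-b_k)^{-n_k}$, $\wp(x)=e_1+(e_2-e_1)z$, $E=(e_1-e_2)\lambda+\mathrm{const}$, from the Schrödinger equation $\psi_{xx}-u\psi=E\psi$ with finite-gap potential $u$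 of the form $u(x)=m_0(m_0+1)\wp(x)+\sum_{i=1}^3 m_i(m_i+1)\wp(x-\omega_i)+\sum_{k=1}^M n_k(n_k+1)\{\wp(x-\delta_k)+\wp(x+\delta_k)\}$. **Novikov's equation for the Fuchsian equation.** Let $$I_0(z)=\frac{m_0(m_0+1)}4z+\frac{m_1(m_1+1)}4\cdot\frac az+\frac{m_2(m_2+1)}4\cdot\frac{z-a}{z-1}+\frac{m_3(m_3+1)}4\cdot\frac{a(z-1)}{z-a}+\sum_{k=1}^M n_k(n_k+1)\left(\frac{b_k(b_k-1)(b_k-a)}{(z-b_k)^2}+\frac{3b_k^2-2(a+1)b_k+a}{2(z-b_k)}\right)$$ and $I_{j+1}=\mathcal{L}(I_j)$, where $$\mathcal{L}(f)=z(z-1)(z-a)\frac{d^2f}{dz^2}+\frac{3z^2-2(a+1)z+a}{2}\cdot\frac{df}{dz}-\int\left(4I_0\frac{df}{dz}+2f\frac{dI_0}{dz}\right)dz .$$ The integration constants are arbitrary; thus $I_n$ is defined modulo a linear combination of lower-order functions (and constants), and this choice does not affect whether $I_0$ satisfies Novikov's equation of order $g$ for the Fuchsian equation. $I_0$ satisfies Novikov's equation of order $g$ for the Fuchsian equation if there are constants $\widetilde c_j,\widetilde d$ such that $I_g+\sum_{j=1}^g\widetilde c_jI_{g-j}=\widetilde d$. *)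

theory Defs
  imports "HOL-Complex_Analysis.Complex_Analysis"
begin

section \<open>Weierstrass functions\<close>

text \<open>The parameters \<open>w1\<close>, \<open>w3\<close> are half-periods; the third half-period is \<open>w1 + w3\<close>.\<close>

definition period_lattice :: "complex \<Rightarrow> complex \<Rightarrow> complex set" where
  "period_lattice w1 w3 = {2 * of_int i * w1 + 2 * of_int j * w3 | i j :: int. True}"

definition wp :: "complex \<Rightarrow> complex \<Rightarrow> complex \<Rightarrow> complex" where
  "wp w1 w3 x = 1 / x\<^sup>2 + (\<Sum>\<^sub>\<infinity>w\<in>period_lattice w1 w3 - {0}. 1 / (x - w)\<^sup>2 - 1 / w\<^sup>2)"

definition e1 :: "complex \<Rightarrow> complex \<Rightarrow> complex" where
  "e1 w1 w3 = wp w1 w3 w1"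

definition e2 :: "complex \<Rightarrow> complex \<Rightarrow> complex" where
  "e2 w1 w3 = wp w1 w3 (w1 + w3)"

definition e3 :: "complex \<Rightarrow> complex \<Rightarrow> complex" where
  "e3 w1 w3 = wp w1 w3 w3"

text \<open>The coordinate \<open>z\<close> with \<open>wp x = e1 + (e2 - e1) z\<close>.\<close>

definition zcoord :: "complex \<Rightarrow> complex \<Rightarrow> complex \<Rightarrow> complex" where
  "zcoord w1 w3 x = (wp w1 w3 x - e1 w1 w3) / (e2 w1 w3 - e1 w1 w3)"


section \<open>The Fuchsian equation\<close>

text \<open>Only the values \<open>m 0, \<dots>, m 3\<close> and \<open>n k\<close>, \<open>b k\<close> with \<open>k \<in> {1..M}\<close> are used.\<close>

definition fuchs_N :: "(nat \<Rightarrow> nat) \<Rightarrow> nat \<Rightarrow> (nat \<Rightarrow> nat) \<Rightarrow> nat" where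
  "fuchs_N m M n = (\<Sum>j=0..3. m j) + 2 * (\<Sum>k=1..M. n k)"

definition fuchs_P ::
  "complex \<Rightarrow> (nat \<Rightarrow> nat) \<Rightarrow> nat \<Rightarrow> (nat \<Rightarrow> nat) \<Rightarrow> (nat \<Rightarrow> complex) \<Rightarrow> complex \<Rightarrow> complex" where
  "fuchs_P a m M n b z =
     1 / 2 * ((1 - 2 * of_nat (m 1)) / z + (1 - 2 * of_nat (m 2)) / (z - 1)
              + (1 - 2 * of_nat (m 3)) / (z - a))
     - 2 * (\<Sum>k=1..M. of_nat (n k) / (z - b k))"

definition fuchs_rho ::
  "complex \<Rightarrow> (nat \<Rightarrow> nat) \<Rightarrow> nat \<Rightarrow> (nat \<Rightarrow> nat) \<Rightarrow> (nat \<Rightarrow> complex) \<Rightarrow> nat \<Rightarrow> complex" where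
  "fuchs_rho a m M n b k =
     2 * (b k - 1) * (b k - a) * of_nat (m 1) + 2 * b k * (b k - a) * of_nat (m 2)
     + 2 * b k * (b k - 1) * of_nat (m 3)
     + (3 * (b k)\<^sup>2 - 2 * (a + 1) * b k + a) * of_nat (n k)
     + 4 * (\<Sum>j\<in>{1..M} - {k}. b k * (b k - 1) * (b k - a) / (b k - b j) * of_nat (n j))"

definition fuchs_R ::
  "complex \<Rightarrow> (nat \<Rightarrow> nat) \<Rightarrow> nat \<Rightarrow> (nat \<Rightarrow> nat) \<Rightarrow> (nat \<Rightarrow> complex) \<Rightarrow> complex \<Rightarrow> complex" where
  "fuchs_R a m M n b z = 2 * (\<Sum>k=1..M. of_nat (n k) * fuchs_rho a m M n b k / (z - b k))"

definition fuchs_Q ::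
  "complex \<Rightarrow> (nat \<Rightarrow> nat) \<Rightarrow> nat \<Rightarrow> (nat \<Rightarrow> nat) \<Rightarrow> (nat \<Rightarrow> complex) \<Rightarrow> complex
     \<Rightarrow> complex \<Rightarrow> complex" where
  "fuchs_Q a m M n b lam z =
     (of_nat (fuchs_N m M n) * (of_nat (fuchs_N m M n) - 2 * of_nat (m 0) - 1) * z
        + lam + fuchs_R a m M n b z) / (4 * z * (z - 1) * (z - a))"

definition solves_fuchsian ::
  "complex \<Rightarrow> (nat \<Rightarrow> nat) \<Rightarrow> nat \<Rightarrow> (nat \<Rightarrow> nat) \<Rightarrow> (nat \<Rightarrow> complex) \<Rightarrow> complex
     \<Rightarrow> (complex \<Rightarrow> complex) \<Rightarrow> complex set \<Rightarrow> bool" where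
  "solves_fuchsian a m M n b lam y U \<longleftrightarrow>
     (\<forall>z\<in>U. deriv (deriv y) z + fuchs_P a m M n b z * deriv y z
             + fuchs_Q a m M n b lam z * y z = 0)"


section \<open>The elliptic potential and the Schroedinger equation\<close>

definition potential ::
  "complex \<Rightarrow> complex \<Rightarrow> (nat \<Rightarrow> nat) \<Rightarrow> nat \<Rightarrow> (nat \<Rightarrow> nat) \<Rightarrow> (nat \<Rightarrow> complex)
     \<Rightarrow> complex \<Rightarrow> complex" where
  "potential w1 w3 m M n \<delta> x =
     of_nat (m 0 * (m 0 + 1)) * wp w1 w3 x
     + of_nat (m 1 * (m 1 + 1)) * wp w1 w3 (x - w1)
     + of_nat (m 2 * (m 2 + 1)) * wp w1 w3 (x - (w1 + w3))
     + of_nat (m 3 * (m 3 + 1)) * wp w1 w3 (x - w3)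
     + (\<Sum>k=1..M. of_nat (n k * (n k + 1)) * (wp w1 w3 (x - \<delta> k) + wp w1 w3 (x + \<delta> k)))"

text \<open>
  The complement of all points at which one of the terms of the potential may have a pole.
  Since \<open>wp\<close> has an arbitrary value at lattice points, all identities below are stated on
  this set only.
\<close>

definition potential_domain ::
  "complex \<Rightarrow> complex \<Rightarrow> nat \<Rightarrow> (nat \<Rightarrow> complex) \<Rightarrow> complex set" where
  "potential_domain w1 w3 M \<delta> =
     {x. (\<forall>p\<in>{0, w1, w1 + w3, w3} \<union> \<delta> ` {1..M} \<union> (\<lambda>k. - \<delta> k) ` {1..M}.
            x - p \<notin> period_lattice w1 w3)}"

definition solves_schroedinger ::
  "(complex \<Rightarrow> complex) \<Rightarrow> complex \<Rightarrow> (complex \<Rightarrow> complex) \<Rightarrow> complex set \<Rightarrow> bool" where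
  "solves_schroedinger u E \<psi> X \<longleftrightarrow>
     (\<forall>x\<in>X. deriv (deriv \<psi>) x - u x * \<psi> x = E * \<psi> x)"

text \<open>
  The change of variables
  \<open>\<psi>(x) = y(z) z^(-m1/2) (z-1)^(-m2/2) (z-a)^(-m3/2) \<Prod>k (z-bk)^(-nk)\<close>,
  \<open>E = (e1 - e2) lam + C\<close>, takes the Schroedinger equation to the Fuchsian one.
  It is read locally on open sets \<open>X\<close> of the \<open>x\<close>-plane; \<open>s1\<close>, \<open>s2\<close>, \<open>s3\<close> are arbitrary
  holomorphic branches over \<open>X\<close> of the square roots of \<open>z\<close>, \<open>z - 1\<close>, \<open>z - a\<close>.
  The constant \<open>C\<close> does not depend on \<open>lam\<close>.
\<close>

definition schroedinger_transforms_to_fuchsian ::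
  "complex \<Rightarrow> complex \<Rightarrow> (nat \<Rightarrow> complex)
     \<Rightarrow> complex \<Rightarrow> (nat \<Rightarrow> nat) \<Rightarrow> nat \<Rightarrow> (nat \<Rightarrow> nat) \<Rightarrow> (nat \<Rightarrow> complex) \<Rightarrow> bool" where
  "schroedinger_transforms_to_fuchsian w1 w3 \<delta> a m M n b \<longleftrightarrow>
     (\<exists>C. \<forall>lam X s1 s2 s3 y.
        open X \<and> X \<subseteq> potential_domain w1 w3 M \<delta> \<and>
        s1 holomorphic_on X \<and> (\<forall>x\<in>X. (s1 x)\<^sup>2 = zcoord w1 w3 x) \<and>
        s2 holomorphic_on X \<and> (\<forall>x\<in>X. (s2 x)\<^sup>2 = zcoord w1 w3 x - 1) \<and>
        s3 holomorphic_on X \<and> (\<forall>x\<in>X. (s3 x)\<^sup>2 = zcoord w1 w3 x - a) \<and>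
        y holomorphic_on (zcoord w1 w3 ` X)
        \<longrightarrow> (solves_schroedinger (potential w1 w3 m M n \<delta>) ((e1 w1 w3 - e2 w1 w3) * lam + C)
               (\<lambda>x. y (zcoord w1 w3 x) * inverse (s1 x) ^ m 1 * inverse (s2 x) ^ m 2
                    * inverse (s3 x) ^ m 3
                    * (\<Prod>k=1..M. inverse (zcoord w1 w3 x - b k) ^ n k)) X
             \<longleftrightarrow> solves_fuchsian a m M n b lam y (zcoord w1 w3 ` X)))"


section \<open>Finite-gap potentials and finite-gap Fuchsian equations\<close>

text \<open>
  Differential polynomials in \<open>u\<close> without constant term, as functions. As \<open>u\<close> satisfies
  algebraic differential equations, some constant functions may nevertheless belong to this
  set, so the functions \<open>J\<close> below are determined up to the choice of integration constants
  only; this choice does not affect the property \<open>finite_gap\<close>.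
\<close>

inductive_set diff_polys :: "(complex \<Rightarrow> complex) \<Rightarrow> (complex \<Rightarrow> complex) set"
  for u :: "complex \<Rightarrow> complex" where
  derivative: "(deriv ^^ i) u \<in> diff_polys u"
| add: "f \<in> diff_polys u \<Longrightarrow> g \<in> diff_polys u \<Longrightarrow> (\<lambda>x. f x + g x) \<in> diff_polys u"
| mult: "f \<in> diff_polys u \<Longrightarrow> g \<in> diff_polys u \<Longrightarrow> (\<lambda>x. f x * g x) \<in> diff_polys u"
| scale: "f \<in> diff_polys u \<Longrightarrow> (\<lambda>x. c * f x) \<in> diff_polys u"

definition kdv_hierarchy ::
  "(complex \<Rightarrow> complex) \<Rightarrow> complex set \<Rightarrow> (nat \<Rightarrow> complex \<Rightarrow> complex) \<Rightarrow> bool" where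
  "kdv_hierarchy u D J \<longleftrightarrow>
     J 0 = u \<and> (\<forall>j. J j \<in> diff_polys u) \<and>
     (\<forall>j. \<forall>x\<in>D. (J (Suc j) has_field_derivative
        ((deriv ^^ 3) (J j) x - 4 * u x * deriv (J j) x - 2 * deriv u x * J j x)) (at x))"

definition finite_gap :: "(complex \<Rightarrow> complex) \<Rightarrow> complex set \<Rightarrow> bool" where
  "finite_gap u D \<longleftrightarrow>
     (\<exists>J. kdv_hierarchy u D J \<and>
        (\<exists>(g::nat) (c :: nat \<Rightarrow> complex) d.
           \<forall>x\<in>D. J g x + (\<Sum>i=1..g. c i * J (g - i) x) = d))"

definition fuchsian_finite_gap ::
  "complex \<Rightarrow> (nat \<Rightarrow> nat) \<Rightarrow> nat \<Rightarrow> (nat \<Rightarrow> nat) \<Rightarrow> (nat \<Rightarrow> complex) \<Rightarrow> bool" where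
  "fuchsian_finite_gap a m M n b \<longleftrightarrow>
     (\<exists>w1 w3 \<delta>.
        Im (w3 / w1) \<noteq> 0 \<and>
        (e3 w1 w3 - e1 w1 w3) / (e2 w1 w3 - e1 w1 w3) = a \<and>
        (\<forall>k\<in>{1..M}. wp w1 w3 (\<delta> k) = e1 w1 w3 + (e2 w1 w3 - e1 w1 w3) * b k
                     \<and> \<delta> k \<notin> period_lattice w1 w3) \<and>
        schroedinger_transforms_to_fuchsian w1 w3 \<delta> a m M n b \<and>
        finite_gap (potential w1 w3 m M n \<delta>) (potential_domain w1 w3 M \<delta>))"


section \<open>Novikov's equation for the Fuchsian equation\<close>

definition fuchs_domain :: "complex \<Rightarrow> nat \<Rightarrow> (nat \<Rightarrow> complex) \<Rightarrow> complex set" where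
  "fuchs_domain a M b = - ({0, 1, a} \<union> b ` {1..M})"

definition fuchs_I0 ::
  "complex \<Rightarrow> (nat \<Rightarrow> nat) \<Rightarrow> nat \<Rightarrow> (nat \<Rightarrow> nat) \<Rightarrow> (nat \<Rightarrow> complex) \<Rightarrow> complex \<Rightarrow> complex" where
  "fuchs_I0 a m M n b z =
     of_nat (m 0 * (m 0 + 1)) / 4 * z
     + of_nat (m 1 * (m 1 + 1)) / 4 * (a / z)
     + of_nat (m 2 * (m 2 + 1)) / 4 * ((z - a) / (z - 1))
     + of_nat (m 3 * (m 3 + 1)) / 4 * (a * (z - 1) / (z - a))
     + (\<Sum>k=1..M. of_nat (n k * (n k + 1)) *
          (b k * (b k - 1) * (b k - a) / (z - b k)\<^sup>2
           + (3 * (b k)\<^sup>2 - 2 * (a + 1) * b k + a) / (2 * (z - b k))))"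

text \<open>
  \<open>novikov_step a I0 S f h\<close>: \<open>h\<close> is one of the values of \<open>\<L>(f)\<close> on \<open>S\<close>, where \<open>G\<close> is the
  chosen antiderivative.
\<close>

definition novikov_step ::
  "complex \<Rightarrow> (complex \<Rightarrow> complex) \<Rightarrow> complex set \<Rightarrow> (complex \<Rightarrow> complex)
     \<Rightarrow> (complex \<Rightarrow> complex) \<Rightarrow> bool" where
  "novikov_step a I0 S f h \<longleftrightarrow>
     (\<exists>G. \<forall>z\<in>S.
        (G has_field_derivative (4 * I0 z * deriv f z + 2 * f z * deriv I0 z)) (at z) \<and>
        h z = z * (z - 1) * (z - a) * deriv (deriv f) z
              + (3 * z\<^sup>2 - 2 * (a + 1) * z + a) / 2 * deriv f z - G z)"

definition novikov_equation ::
  "complex \<Rightarrow> (complex \<Rightarrow> complex) \<Rightarrow> complex set \<Rightarrow> nat \<Rightarrow> bool" where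
  "novikov_equation a I0 S g \<longleftrightarrow>
     (\<exists>I. I 0 = I0 \<and> (\<forall>j. novikov_step a I0 S (I j) (I (Suc j))) \<and>
        (\<exists>(c :: nat \<Rightarrow> complex) d.
           \<forall>z\<in>S. I g z + (\<Sum>j=1..g. c j * I (g - j) z) = d))"

end

theory Submission
  imports Defs
begin

text \<open>
  The theorem compares two recursions that are the same recursion in two coordinates. For a weight
  \<open>p\<close> and a potential \<open>q\<close>, put \<open>\<partial> = sqrt p d/dz\<close>. The recursion that sends \<open>f\<close> to an
  antiderivative of \<open>(\<partial>\<^sup>2 f)' - 4 q f' - 2 q' f\<close> is Lenard's recursion of the KdV hierarchy. On the
  \<open>x\<close>-plane \<open>p = 1\<close> and \<open>q = u\<close>; on the \<open>z\<close>-plane \<open>p = z (z - 1) (z - a)\<close> and \<open>q = I\<^sub>0\<close>. With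
  \<open>\<kappa> = e\<^sub>2 - e\<^sub>1\<close> the coordinate \<open>z = (\<wp> - e\<^sub>1) / \<kappa>\<close> satisfies \<open>z'\<^sup>2 = 4 \<kappa> p(z)\<close>, and the potential is
  \<open>u = 4 \<kappa> I\<^sub>0(z) + const\<close>. Therefore the two sequences, pulled back to the \<open>x\<close>-plane, are related by a
  triangular matrix with nonzero diagonal, up to constants (lemma \<open>hierarchy_comparison\<close>), and a linear
  relation with nonzero top coefficient for one of them is such a relation for the other.

  Two points need care. The recursion asks for antiderivatives on multiply connected domains, and on
  the \<open>x\<close>-side for antiderivatives that are differential polynomials. Both are supplied by the
  Gelfand-Dikii recursion: the diagonal of the resolvent satisfies a quadratic differential
  equation, which gives each member as an explicit polynomial in the derivatives of the earlier ones
  (lemma \<open>gelfand_dikii_recursion\<close>). Passing from the image of the \<open>x\<close>-domain to the whole \<open>z\<close>-domain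
  is the identity theorem.

  The identity \<open>u = 4 \<kappa> I\<^sub>0(z) + const\<close> is a sum of instances of one addition formula,
  \<open>(\<wp> x - \<wp> d)\<^sup>2 (\<wp> (x + d) + \<wp> (x - d)) = 2 \<wp> d (\<wp> x - \<wp> d)\<^sup>2 + \<wp>'' d (\<wp> x - \<wp> d) + (\<wp>' d)\<^sup>2\<close>, which
  Liouville's theorem yields for every \<open>d\<close> outside the lattice, half-periods included
  (theorem \<open>wp_addition\<close>). The same formula shows that \<open>\<wp>\<close> is injective modulo the lattice and sign, so
  that the three half-period values are distinct and \<open>z\<close> avoids the singular points of the Fuchsian
  equation.

  For the direction from Novikov's equation to the finite-gap property a lattice has to be produced
  for which \<open>(e\<^sub>3 - e\<^sub>1) / (e\<^sub>2 - e\<^sub>1)\<close> has the prescribed value \<open>a\<close>. The function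
  \<open>j = (\<lambda>\<^sup>2 - \<lambda> + 1)\<^sup>3 / (\<lambda>\<^sup>2 (\<lambda> - 1)\<^sup>2)\<close> of \<open>\<lambda> = (e\<^sub>3 - e\<^sub>1) / (e\<^sub>2 - e\<^sub>1)\<close> depends only on the lattice up to
  scaling. As a function of the period ratio it is holomorphic and not constant, so that its image is
  open; every lattice has a reduced basis and \<open>j\<close> tends to infinity at the end of the reduced region,
  so that its image is closed. Hence \<open>j\<close> takes every value (lemma \<open>j_tau_surjective\<close>), and the six values
  of \<open>\<lambda>\<close> with the same \<open>j\<close> are obtained by permuting the half-periods
  (theorem \<open>every_modulus_occurs\<close>). The points \<open>\<delta>\<^sub>k\<close> exist because \<open>\<wp>\<close> is onto, and the change of
  variables between the two linear equations is a partial fraction computation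
  (lemma \<open>conjugated_operator_partial_fractions\<close>).
\<close>

section \<open>The Gelfand-Dikii recursion\<close>

text \<open>
  With \<open>L f = p f'' + p' f' / 2\<close>, which is the square of the derivation \<open>sqrt p d/dz\<close>, this is
  \<open>(L f)' - 4 q f' - 2 q' f\<close>. For \<open>p = 1\<close> it is the right-hand side of the KdV recursion.
\<close>

definition kdv_rhs :: "(complex \<Rightarrow> complex) \<Rightarrow> (complex \<Rightarrow> complex) \<Rightarrow> (complex \<Rightarrow> complex)
    \<Rightarrow> complex \<Rightarrow> complex" where
  "kdv_rhs p q f z =
     p z * (deriv ^^ 3) f z + 3 / 2 * deriv p z * deriv (deriv f) z
     + deriv (deriv p) z / 2 * deriv f z - 4 * q z * deriv f z - 2 * deriv q z * f z"

text \<open>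
  The coefficients of a formal solution \<open>G = \<Sum>n. G n * \<xi> ^ n\<close> of
  \<open>G\<^sup>2 / \<xi> = 2 G L G - p G'\<^sup>2 - 4 q G\<^sup>2 + 1 / (4 \<xi>)\<close>, where \<open>L\<close> is as above. Comparison of coefficients
  determines \<open>G (Suc n)\<close>, because the constant \<open>G 0 = -1/2\<close> makes it occur linearly in the square.
\<close>

fun gelfand_dikii :: "(complex \<Rightarrow> complex) \<Rightarrow> (complex \<Rightarrow> complex) \<Rightarrow> nat \<Rightarrow> complex \<Rightarrow> complex" where
  "gelfand_dikii p q 0 = (\<lambda>z. - 1 / 2)"
| "gelfand_dikii p q (Suc n) = (\<lambda>z.
     (\<Sum>i=1..n. gelfand_dikii p q i z * gelfand_dikii p q (Suc n - i) z)
     - (\<Sum>i\<le>n. 2 * gelfand_dikii p q i z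
            * (p z * deriv (deriv (gelfand_dikii p q (n - i))) z
               + deriv p z / 2 * deriv (gelfand_dikii p q (n - i)) z)
          - p z * deriv (gelfand_dikii p q i) z * deriv (gelfand_dikii p q (n - i)) z
          - 4 * q z * gelfand_dikii p q i z * gelfand_dikii p q (n - i) z))"

lemma gelfand_dikii_1: "gelfand_dikii p q (Suc 0) = q"
  by (rule ext) simp

lemma holomorphic_gelfand_dikii:
  assumes "open S" "p holomorphic_on S" "q holomorphic_on S"
  shows "gelfand_dikii p q n holomorphic_on S"
proof (induction n rule: less_induct)
  case (less n)
  show ?case
  proof (cases n)
    case 0
    then show ?thesis by simp
  next
    case (Suc k)
    show ?thesis
      unfolding Suc gelfand_dikii.simps
      by (intro holomorphic_intros assms less) (auto simp: Suc)
  qed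
qed

text \<open>
  Used with \<open>h\<close> collecting all terms by which the derivative of the quadratic equation differs from
  \<open>2 G\<close> times the linear recursion.
\<close>

lemma sum_antisymmetric_eq_0:
  fixes h :: "nat \<Rightarrow> nat \<Rightarrow> complex"
  assumes "\<And>i j. h i j = - h j i"
  shows "(\<Sum>i\<le>n. h i (n - i)) = 0"
proof -
  have "(\<Sum>i\<le>n. h i (n - i)) = (\<Sum>i\<le>n. h (n - i) i)"
    by (rule sum.reindex_bij_witness[where i="\<lambda>i. n - i" and j="\<lambda>i. n - i"]) auto
  also have "\<dots> = - (\<Sum>i\<le>n. h i (n - i))"
    by (subst assms) (simp add: sum_negf)
  finally show ?thesis by simp
qed

lemma DERIV_deriv_holomorphic:
  assumes "open S" "f holomorphic_on S" "z \<in> S"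
  shows "(f has_field_derivative deriv f z) (at z)"
  using assms holomorphic_derivI by blast

text \<open>
  Multiplied by \<open>2 G\<close>, the linear recursion \<open>G' / \<xi> = (L G)' - 4 q G' - 2 q' G\<close> becomes the derivative of
  the quadratic equation that defines \<open>G\<close>. Conversely, the derivative of the quadratic equation gives
  the linear recursion in degree \<open>n\<close> once it is known in all lower degrees, since the one remaining
  term is \<open>2 G 0 = -1\<close> times the claim.
\<close>

lemma gelfand_dikii_recursion:
  assumes S: "open S" "p holomorphic_on S" "q holomorphic_on S" and z: "z \<in> S"
  shows "(gelfand_dikii p q (Suc n) has_field_derivative kdv_rhs p q (gelfand_dikii p q n) z) (at z)"
proof (induction n rule: less_induct)
  case (less n)
  define G where "G = gelfand_dikii p q"
  define A where "A = (\<lambda>j. kdv_rhs p q (G j) z)"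
  note hol = holomorphic_gelfand_dikii[OF S, folded G_def]
  have d1: "(G i has_field_derivative deriv (G i) z) (at z)" for i
    by (rule DERIV_deriv_holomorphic[OF S(1) hol z])
  have d2: "(deriv (G i) has_field_derivative deriv (deriv (G i)) z) (at z)" for i
    by (rule DERIV_deriv_holomorphic[OF S(1) _ z]) (intro holomorphic_deriv hol S)
  have d3: "(deriv (deriv (G i)) has_field_derivative (deriv ^^ 3) (G i) z) (at z)" for i
    using DERIV_deriv_holomorphic[OF S(1) _ z, of "deriv (deriv (G i))"]
    by (simp add: holomorphic_deriv hol S numeral_3_eq_3)
  have dp: "(p has_field_derivative deriv p z) (at z)"
    "(deriv p has_field_derivative deriv (deriv p) z) (at z)"
    "(q has_field_derivative deriv q z) (at z)"
    by (auto intro!: DERIV_deriv_holomorphic[OF S(1) _ z] holomorphic_deriv S)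
  have IH: "deriv (G (Suc j)) z = A j" if "j < n" for j
    using less[OF that] by (simp add: A_def G_def DERIV_imp_deriv del: gelfand_dikii.simps)
  define g0 g1 g2 g3 where "g0 = (\<lambda>i. G i z)" and "g1 = (\<lambda>i. deriv (G i) z)"
    and "g2 = (\<lambda>i. deriv (deriv (G i)) z)" and "g3 = (\<lambda>i. (deriv ^^ 3) (G i) z)"
  define P0 P1 P2 Q0 Q1 where "P0 = p z" and "P1 = deriv p z" and "P2 = deriv (deriv p) z"
    and "Q0 = q z" and "Q1 = deriv q z"
  have A: "A j = P0 * g3 j + 3 / 2 * P1 * g2 j + P2 / 2 * g1 j - 4 * Q0 * g1 j - 2 * Q1 * g0 j" for j
    by (simp add: A_def kdv_rhs_def g0_def g1_def g2_def g3_def P0_def P1_def P2_def Q0_def Q1_def)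
  \<comment> \<open>The derivative of the summand with indices \<open>i\<close> and \<open>j\<close> in the quadratic recursion.\<close>
  define T where "T = (\<lambda>i j. 2 * g1 i * (P0 * g2 j + P1 / 2 * g1 j)
       + 2 * g0 i * (P1 * g2 j + P0 * g3 j + P2 / 2 * g1 j + P1 / 2 * g2 j)
       - (P1 * g1 i * g1 j + P0 * g2 i * g1 j + P0 * g1 i * g2 j)
       - 4 * (Q1 * g0 i * g0 j + Q0 * g1 i * g0 j + Q0 * g0 i * g1 j))"
  have t1: "((\<lambda>z. G i z * G j z) has_field_derivative g1 i * g0 j + g0 i * g1 j) (at z)" for i j
    unfolding g0_def g1_def by (rule derivative_eq_intros d1 refl)+ (simp add: algebra_simps)
  have t2: "((\<lambda>z. 2 * G i z * (p z * deriv (deriv (G j)) z + deriv p z / 2 * deriv (G j) z)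
          - p z * deriv (G i) z * deriv (G j) z - 4 * q z * G i z * G j z)
        has_field_derivative T i j) (at z)" for i j
  proof -
    have "((\<lambda>z. deriv p z / 2) has_field_derivative P2 / 2) (at z)"
      unfolding P2_def by (intro DERIV_cdivide dp)
    note d = d1 d2 d3 dp(1,3) this
    show ?thesis
      by (rule derivative_eq_intros d refl)+
         (simp add: T_def g0_def g1_def g2_def g3_def P0_def P1_def P2_def Q0_def Q1_def, algebra)
  qed
  have der: "(G (Suc n) has_field_derivative
      (\<Sum>i=1..n. g1 i * g0 (Suc n - i) + g0 i * g1 (Suc n - i)) - (\<Sum>i\<le>n. T i (n - i))) (at z)"
    unfolding G_def gelfand_dikii.simps(2) unfolding G_def[symmetric]
    by (intro derivative_intros t1 t2)
  have T: "(\<Sum>i\<le>n. T i (n - i)) = 2 * (\<Sum>i\<le>n. g0 i * A (n - i))"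
  proof -
    define h where "h = (\<lambda>i j. P0 * (g1 i * g2 j - g2 i * g1 j) + 4 * Q0 * (g0 i * g1 j - g1 i * g0 j))"
    have "T i j = 2 * (g0 i * A j) + h i j" for i j
      by (simp add: T_def A h_def field_simps)
    moreover have "(\<Sum>i\<le>n. h i (n - i)) = 0"
      by (rule sum_antisymmetric_eq_0) (simp add: h_def algebra_simps)
    ultimately show ?thesis
      by (simp add: sum.distrib sum_distrib_left)
  qed
  have r: "(\<Sum>i\<le>n. g0 i * A (n - i)) = (\<Sum>j\<le>n. A j * g0 (n - j))"
    by (rule sum.reindex_bij_witness[where i="\<lambda>i. n - i" and j="\<lambda>i. n - i"]) auto
  have s1: "(\<Sum>i=1..n. g1 i * g0 (Suc n - i)) = (\<Sum>j<n. A j * g0 (n - j))"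
    by (rule sum.reindex_bij_witness[where i="Suc" and j="\<lambda>i. i - 1"])
       (auto simp: g1_def IH[symmetric])
  have s2: "(\<Sum>i=1..n. g0 i * g1 (Suc n - i)) = (\<Sum>i=1..n. g1 i * g0 (Suc n - i))"
    by (rule sum.reindex_bij_witness[where i="\<lambda>i. Suc n - i" and j="\<lambda>i. Suc n - i"]) auto
  have g00: "g0 0 = - 1 / 2"
    by (simp add: g0_def G_def)
  have "(\<Sum>i=1..n. g1 i * g0 (Suc n - i) + g0 i * g1 (Suc n - i)) - (\<Sum>i\<le>n. T i (n - i)) = A n"
    unfolding sum.distrib s2 s1 T r by (simp add: lessThan_Suc_atMost[symmetric] g00)
  with der show ?case
    by (simp add: A_def G_def del: gelfand_dikii.simps)
qed

section \<open>Sequences related by a triangular matrix\<close>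

text \<open>
  The span includes the constant functions, because every recursion here leaves an additive constant
  free and Novikov's equation has an arbitrary constant on its right-hand side.
\<close>

definition in_span_below :: "complex set \<Rightarrow> (nat \<Rightarrow> complex \<Rightarrow> complex) \<Rightarrow> nat
    \<Rightarrow> (complex \<Rightarrow> complex) \<Rightarrow> bool" where
  "in_span_below D F n f \<longleftrightarrow> (\<exists>\<alpha> \<beta>. \<forall>x\<in>D. f x = (\<Sum>i<n. \<alpha> i * F i x) + \<beta>)"

lemma in_span_below_const: "in_span_below D F n (\<lambda>x. c)"
  unfolding in_span_below_def by (rule exI[of _ "\<lambda>i. 0"]) auto

lemma in_span_below_add:
  assumes "in_span_below D F n f" "in_span_below D F n g"
  shows "in_span_below D F n (\<lambda>x. f x + g x)"
proof -
  from assms obtain \<alpha> \<beta> \<alpha>' \<beta>' where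
    "\<forall>x\<in>D. f x = (\<Sum>i<n. \<alpha> i * F i x) + \<beta>" "\<forall>x\<in>D. g x = (\<Sum>i<n. \<alpha>' i * F i x) + \<beta>'"
    unfolding in_span_below_def by blast
  then have "\<forall>x\<in>D. f x + g x = (\<Sum>i<n. (\<alpha> i + \<alpha>' i) * F i x) + (\<beta> + \<beta>')"
    by (auto simp: distrib_right sum.distrib)
  then show ?thesis
    unfolding in_span_below_def
    by (intro exI[of _ "\<lambda>i. \<alpha> i + \<alpha>' i"] exI[of _ "\<beta> + \<beta>'"])
qed

lemma in_span_below_cmult:
  assumes "in_span_below D F n f"
  shows "in_span_below D F n (\<lambda>x. c * f x)"
proof -
  from assms obtain \<alpha> \<beta> where "\<forall>x\<in>D. f x = (\<Sum>i<n. \<alpha> i * F i x) + \<beta>"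
    unfolding in_span_below_def by blast
  then have "\<forall>x\<in>D. c * f x = (\<Sum>i<n. (c * \<alpha> i) * F i x) + c * \<beta>"
    by (auto simp: distrib_left sum_distrib_left mult.assoc)
  then show ?thesis
    unfolding in_span_below_def by (intro exI[of _ "\<lambda>i. c * \<alpha> i"] exI[of _ "c * \<beta>"])
qed

lemma in_span_below_sum:
  assumes "\<And>i. i \<in> A \<Longrightarrow> in_span_below D F n (f i)"
  shows "in_span_below D F n (\<lambda>x. \<Sum>i\<in>A. f i x)"
  using assms
  by (induction A rule: infinite_finite_induct)
     (auto intro: in_span_below_const in_span_below_add)

lemma in_span_below_member:
  assumes "i < n"
  shows "in_span_below D F n (F i)"
proof -
  have "F i x = (\<Sum>j<n. (if j = i then 1 else 0) * F j x) + 0" for x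
    using assms by (simp add: if_distrib[of "\<lambda>c. c * _"] cong: if_cong)
  then show ?thesis
    unfolding in_span_below_def
    by (intro exI[of _ "\<lambda>j. if j = i then 1 else 0"] exI[of _ 0] ballI)
qed

lemma in_span_below_cong:
  assumes "in_span_below D F n f" "\<And>x. x \<in> D \<Longrightarrow> f x = g x"
  shows "in_span_below D F n g"
  using assms unfolding in_span_below_def by simp

lemma in_span_below_trans:
  assumes "in_span_below D H m f" "\<And>k. k < m \<Longrightarrow> in_span_below D F n (H k)"
  shows "in_span_below D F n f"
proof -
  from assms(1) obtain \<alpha> \<beta> where ab: "\<forall>x\<in>D. f x = (\<Sum>i<m. \<alpha> i * H i x) + \<beta>"
    unfolding in_span_below_def by blast
  have "in_span_below D F n (\<lambda>x. (\<Sum>i<m. \<alpha> i * H i x) + \<beta>)"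
    by (intro in_span_below_add in_span_below_sum in_span_below_cmult in_span_below_const assms(2)) auto
  then show ?thesis
    by (rule in_span_below_cong) (simp add: ab)
qed

lemma in_span_below_mono:
  "in_span_below D F m f \<Longrightarrow> m \<le> n \<Longrightarrow> in_span_below D F n f"
  by (erule in_span_below_trans) (auto intro: in_span_below_member)

text \<open>
  A lower triangular transition matrix, modulo constants, with nonzero diagonal entries \<open>s\<close>.
\<close>

definition triangular :: "complex set \<Rightarrow> (nat \<Rightarrow> complex \<Rightarrow> complex)
    \<Rightarrow> (nat \<Rightarrow> complex \<Rightarrow> complex) \<Rightarrow> bool" where
  "triangular D H F \<longleftrightarrow> (\<forall>n. \<exists>s. s \<noteq> 0 \<and> in_span_below D F n (\<lambda>x. H n x - s * F n x))"

lemma triangular_in_span: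
  assumes "triangular D H F"
  shows "in_span_below D F (Suc n) (H n)"
proof -
  from assms obtain s where "in_span_below D F n (\<lambda>x. H n x - s * F n x)"
    unfolding triangular_def by blast
  then have "in_span_below D F (Suc n) (\<lambda>x. H n x - s * F n x)"
    by (rule in_span_below_mono) simp
  from in_span_below_add[OF this in_span_below_cmult[OF in_span_below_member, of n "Suc n" D F s]]
  show ?thesis by simp
qed

text \<open>
  A triangular matrix with nonzero diagonal is inverted by forward substitution.
\<close>

lemma triangular_sym:
  assumes "triangular D H F"
  shows "triangular D F H"
proof -
  have "\<exists>s. s \<noteq> 0 \<and> in_span_below D H n (\<lambda>x. F n x - s * H n x)" for n
  proof (induction n rule: less_induct)
    case (less n)
    have F: "in_span_below D H n (F k)" if k: "k < n" for k
    proof -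
      from less[OF k] obtain s where "in_span_below D H k (\<lambda>x. F k x - s * H k x)"
        by blast
      then have "in_span_below D H n (\<lambda>x. F k x - s * H k x)"
        by (rule in_span_below_mono) (use k in simp)
      from in_span_below_add[OF this in_span_below_cmult[OF in_span_below_member, of k n D H s]] k
      show ?thesis by simp
    qed
    from assms obtain s where s: "s \<noteq> 0" "in_span_below D F n (\<lambda>x. H n x - s * F n x)"
      unfolding triangular_def by blast
    have "in_span_below D H n (\<lambda>x. H n x - s * F n x)"
      using in_span_below_trans[OF s(2) F] .
    from in_span_below_cmult[OF this, of "- 1 / s"]
    have "in_span_below D H n (\<lambda>x. F n x - (1 / s) * H n x)"
      by (rule in_span_below_cong) (use s(1) in \<open>simp add: field_simps\<close>)
    with s(1) show ?case
      by (intro exI[of _ "1 / s"]) auto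
  qed
  then show ?thesis
    unfolding triangular_def by blast
qed

text \<open>
  Novikov's equation of order \<open>g\<close> says that the \<open>g\<close>-th member is a combination of the earlier ones and
  a constant. The lower members span the same space for both sequences, and the diagonal entry can
  be divided out.
\<close>

lemma triangular_transfer_relation:
  assumes "triangular D F H" "in_span_below D F g (F g)"
  shows "in_span_below D H g (H g)"
proof -
  from assms(1) obtain s where s: "s \<noteq> 0" "in_span_below D H g (\<lambda>x. F g x - s * H g x)"
    unfolding triangular_def by blast
  have "in_span_below D H g (F k)" if "k < g" for k
    using in_span_below_mono[OF triangular_in_span[OF assms(1)], of k g] that by simp
  then have "in_span_below D H g (F g)"
    by (rule in_span_below_trans[OF assms(2)])
  from in_span_below_add[OF in_span_below_cmult[OF this, of "1 / s"]
      in_span_below_cmult[OF s(2), of "- 1 / s"]]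
  show ?thesis
    by (rule in_span_below_cong) (use s(1) in \<open>simp add: field_simps\<close>)
qed

lemma in_span_below_iff_relation:
  "in_span_below D F g (F g) \<longleftrightarrow> (\<exists>c d. \<forall>x\<in>D. F g x + (\<Sum>j=1..g. c j * F (g - j) x) = d)"
proof
  have r: "(\<Sum>j=1..g. c j * F (g - j) x) = (\<Sum>i<g. c (g - i) * F i x)" for c x
    by (rule sum.reindex_bij_witness[where i="\<lambda>i. g - i" and j="\<lambda>i. g - i"]) auto
  show "\<exists>c d. \<forall>x\<in>D. F g x + (\<Sum>j=1..g. c j * F (g - j) x) = d" if "in_span_below D F g (F g)"
  proof -
    from that obtain \<alpha> \<beta> where "\<forall>x\<in>D. F g x = (\<Sum>i<g. \<alpha> i * F i x) + \<beta>"
      unfolding in_span_below_def by blast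
    then have "\<forall>x\<in>D. F g x + (\<Sum>j=1..g. - \<alpha> (g - j) * F (g - j) x) = \<beta>"
      unfolding r[of "\<lambda>j. - \<alpha> (g - j)"] by (simp add: sum_negf)
    then show ?thesis
      by (intro exI[of _ "\<lambda>j. - \<alpha> (g - j)"] exI[of _ \<beta>])
  qed
  show "in_span_below D F g (F g)" if "\<exists>c d. \<forall>x\<in>D. F g x + (\<Sum>j=1..g. c j * F (g - j) x) = d"
  proof -
    from that obtain c d where "\<forall>x\<in>D. F g x + (\<Sum>i<g. c (g - i) * F i x) = d"
      unfolding r by blast
    then have "\<forall>x\<in>D. F g x = (\<Sum>i<g. - c (g - i) * F i x) + d"
      by (auto simp: sum_negf algebra_simps)
    then show ?thesis
      unfolding in_span_below_def by (intro exI[of _ "\<lambda>i. - c (g - i)"] exI[of _ d])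
  qed
qed

section \<open>The recursion under a change of coordinate\<close>

lemma higher_deriv_cong_open:
  assumes "open D" "\<And>x. x \<in> D \<Longrightarrow> f x = g x" "x \<in> D"
  shows "(deriv ^^ k) f x = (deriv ^^ k) g x"
  using assms(3)
proof (induction k arbitrary: x)
  case (Suc k)
  have "eventually (\<lambda>y. y \<in> D) (nhds x)"
    using assms(1) Suc.prems by (rule eventually_nhds_in_open)
  then have "eventually (\<lambda>y. (deriv ^^ k) f y = (deriv ^^ k) g y) (nhds x)"
    by eventually_elim (rule Suc.IH)
  then show ?case
    by (simp add: deriv_cong_ev)
qed (simp add: assms)

lemma kdv_rhs_cong:
  assumes "open D" "\<And>x. x \<in> D \<Longrightarrow> f x = g x" "x \<in> D"
  shows "kdv_rhs p q f x = kdv_rhs p q g x"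
proof -
  have "(deriv ^^ k) f x = (deriv ^^ k) g x" for k
    by (rule higher_deriv_cong_open[OF assms])
  from this[of 1] this[of 2] this[of 3] assms show ?thesis
    by (simp add: kdv_rhs_def numeral_2_eq_2)
qed

lemma kdv_rhs_add:
  assumes "open D" "f holomorphic_on D" "g holomorphic_on D" "x \<in> D"
  shows "kdv_rhs p q (\<lambda>x. f x + g x) x = kdv_rhs p q f x + kdv_rhs p q g x"
proof -
  note a = higher_deriv_add[OF assms(2,3,1,4)]
  show ?thesis
    using a[of 1] a[of 2] a[of 3] by (simp add: kdv_rhs_def numeral_2_eq_2 field_simps)
qed

lemma kdv_rhs_cmult:
  assumes "open D" "f holomorphic_on D" "x \<in> D"
  shows "kdv_rhs p q (\<lambda>x. c * f x) x = c * kdv_rhs p q f x"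
proof -
  note a = higher_deriv_cmult[OF assms(2,3,1)]
  show ?thesis
    using a[of 1 c] a[of 2 c] a[of 3 c] by (simp add: kdv_rhs_def numeral_2_eq_2 field_simps)
qed

lemma kdv_rhs_const: "kdv_rhs p q (\<lambda>x. c) x = - 2 * deriv q x * c"
  by (simp add: kdv_rhs_def numeral_3_eq_3)

lemma kdv_rhs_sum:
  assumes "open D" "\<And>i. i \<in> A \<Longrightarrow> f i holomorphic_on D" "x \<in> D" "finite A"
  shows "kdv_rhs p q (\<lambda>x. \<Sum>i\<in>A. f i x) x = (\<Sum>i\<in>A. kdv_rhs p q (f i) x)"
  using assms(4,2)
proof (induction A rule: finite_induct)
  case empty
  then show ?case using kdv_rhs_const[of p q 0 x] by simp
next
  case (insert i A)
  have "kdv_rhs p q (\<lambda>x. f i x + (\<Sum>i\<in>A. f i x)) x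
      = kdv_rhs p q (f i) x + kdv_rhs p q (\<lambda>x. \<Sum>i\<in>A. f i x) x"
    by (rule kdv_rhs_add[OF assms(1) _ _ assms(3)]) (auto intro!: holomorphic_intros insert.prems)
  then show ?case
    using insert by simp
qed

text \<open>
  The change of coordinate turns \<open>d\<^sup>2/dx\<^sup>2\<close> into \<open>s L\<close>, by \<open>\<phi>'\<^sup>2 = s p(\<phi>)\<close> and its derivative
  \<open>\<phi>'' = s p'(\<phi>) / 2\<close>. The additive constant \<open>C\<close> of the potential produces the extra multiple of \<open>f'\<close>.
\<close>

lemma kdv_rhs_compose:
  assumes D: "open D" "\<phi> holomorphic_on D" "\<phi> ` D \<subseteq> S" and S: "open S"
    and hol: "p holomorphic_on S" "q holomorphic_on S" "f holomorphic_on S"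
    and d1: "\<And>x. x \<in> D \<Longrightarrow> (deriv \<phi> x)\<^sup>2 = s * p (\<phi> x)"
    and d2: "\<And>x. x \<in> D \<Longrightarrow> deriv (deriv \<phi>) x = s / 2 * deriv p (\<phi> x)"
    and u: "\<And>x. x \<in> D \<Longrightarrow> u x = s * q (\<phi> x) + C"
    and x: "x \<in> D"
  shows "kdv_rhs (\<lambda>_. 1) u (\<lambda>x. f (\<phi> x)) x
       = deriv \<phi> x * (s * kdv_rhs p q f (\<phi> x) - 4 * C * deriv f (\<phi> x))"
proof -
  have in_S: "\<phi> x \<in> S" if "x \<in> D" for x
    using D(3) that by blast
  have dphi: "(\<phi> has_field_derivative deriv \<phi> x) (at x)" if "x \<in> D" for x
    using D that by (intro DERIV_deriv_holomorphic)
  have chain: "((\<lambda>x. h (\<phi> x)) has_field_derivative deriv h (\<phi> x) * deriv \<phi> x) (at x)"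
    if "h holomorphic_on S" "x \<in> D" for h x
    by (rule DERIV_chain2[OF DERIV_deriv_holomorphic[OF S that(1) in_S[OF that(2)]] dphi[OF that(2)]])
  have hd: "deriv f holomorphic_on S" "deriv (deriv f) holomorphic_on S" "deriv p holomorphic_on S"
    using hol S by (auto intro!: holomorphic_deriv)
  have f1: "deriv (\<lambda>x. f (\<phi> x)) x = deriv f (\<phi> x) * deriv \<phi> x" if "x \<in> D" for x
    by (rule DERIV_imp_deriv[OF chain[OF hol(3) that]])
  have f2: "deriv (deriv (\<lambda>x. f (\<phi> x))) x
      = s * (p (\<phi> x) * deriv (deriv f) (\<phi> x) + 1 / 2 * deriv p (\<phi> x) * deriv f (\<phi> x))"
    if "x \<in> D" for x
  proof -
    have "(deriv ^^ 1) (deriv (\<lambda>x. f (\<phi> x))) x = (deriv ^^ 1) (\<lambda>x. deriv f (\<phi> x) * deriv \<phi> x) x"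
      by (rule higher_deriv_cong_open[OF D(1) f1 that])
    also have "\<dots> = deriv (deriv f) (\<phi> x) * deriv \<phi> x * deriv \<phi> x
          + deriv f (\<phi> x) * deriv (deriv \<phi>) x"
    proof -
      have "(deriv \<phi> has_field_derivative deriv (deriv \<phi>) x) (at x)"
        using D that by (intro DERIV_deriv_holomorphic holomorphic_deriv) auto
      from DERIV_mult'[OF chain[OF hd(1) that] this] show ?thesis
        by (simp add: DERIV_imp_deriv algebra_simps)
    qed
    also have "\<dots> = deriv (deriv f) (\<phi> x) * (deriv \<phi> x)\<^sup>2 + deriv f (\<phi> x) * deriv (deriv \<phi>) x"
      by (simp add: power2_eq_square)
    finally show ?thesis
      unfolding d1[OF that] d2[OF that] by (simp add: algebra_simps)
  qed
  have f3: "(deriv ^^ 3) (\<lambda>x. f (\<phi> x)) x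
      = s * deriv \<phi> x * (p (\<phi> x) * (deriv ^^ 3) f (\<phi> x)
           + 3 / 2 * deriv p (\<phi> x) * deriv (deriv f) (\<phi> x)
           + 1 / 2 * deriv (deriv p) (\<phi> x) * deriv f (\<phi> x))"
  proof -
    have "(deriv ^^ 3) (\<lambda>x. f (\<phi> x)) x = (deriv ^^ 1) (deriv (deriv (\<lambda>x. f (\<phi> x)))) x"
      by (simp add: numeral_3_eq_3)
    also have "\<dots> = (deriv ^^ 1) (\<lambda>x. s * (p (\<phi> x) * deriv (deriv f) (\<phi> x)
        + 1 / 2 * deriv p (\<phi> x) * deriv f (\<phi> x))) x"
      by (rule higher_deriv_cong_open[OF D(1) f2 x])
    also have "\<dots> = deriv (\<lambda>x. s * (p (\<phi> x) * deriv (deriv f) (\<phi> x)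
        + 1 / 2 * deriv p (\<phi> x) * deriv f (\<phi> x))) x"
      by simp
    also have "\<dots> = s * deriv \<phi> x * (p (\<phi> x) * (deriv ^^ 3) f (\<phi> x)
           + 3 / 2 * deriv p (\<phi> x) * deriv (deriv f) (\<phi> x)
           + 1 / 2 * deriv (deriv p) (\<phi> x) * deriv f (\<phi> x))"
      by (rule DERIV_imp_deriv)
         (rule derivative_eq_intros chain[OF hol(1) x] chain[OF hd(1) x] chain[OF hd(2) x]
            chain[OF hd(3) x] refl
          | simp add: numeral_3_eq_3 field_simps)+
    finally show ?thesis .
  qed
  have u1: "deriv u x = s * deriv q (\<phi> x) * deriv \<phi> x"
  proof -
    have "(deriv ^^ 1) u x = (deriv ^^ 1) (\<lambda>x. s * q (\<phi> x) + C) x"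
      by (rule higher_deriv_cong_open[OF D(1) u x])
    also have "\<dots> = s * deriv q (\<phi> x) * deriv \<phi> x"
      using DERIV_imp_deriv[OF DERIV_add[OF DERIV_cmult[OF chain[OF hol(2) x], of s] DERIV_const[of C]]]
      by (simp add: mult.assoc)
    finally show ?thesis by simp
  qed
  show ?thesis
    unfolding kdv_rhs_def f1[OF x] f2[OF x] f3 u1 u[OF x] by (simp add: algebra_simps)
qed

text \<open>
  By induction on \<open>n\<close>: the right-hand side of the recursion is linear, so the derivative of \<open>H (Suc n)\<close>
  is known from the expansion of \<open>H n\<close>, and an antiderivative of it in terms of the sequence \<open>F\<close> can be
  written down. On a connected domain two antiderivatives differ by a constant only.
\<close>

lemma hierarchy_comparison:
  assumes D: "open D" "connected D" "\<phi> holomorphic_on D" "\<phi> ` D \<subseteq> S" and S: "open S"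
    and hol: "p holomorphic_on S" "q holomorphic_on S"
    and d1: "\<And>x. x \<in> D \<Longrightarrow> (deriv \<phi> x)\<^sup>2 = s * p (\<phi> x)"
    and d2: "\<And>x. x \<in> D \<Longrightarrow> deriv (deriv \<phi>) x = s / 2 * deriv p (\<phi> x)"
    and u: "\<And>x. x \<in> D \<Longrightarrow> u x = s * q (\<phi> x) + C" and s: "s \<noteq> 0"
    and F: "F 0 = q" "\<And>n. F n holomorphic_on S"
      "\<And>n z. z \<in> S \<Longrightarrow> (F (Suc n) has_field_derivative kdv_rhs p q (F n) z) (at z)"
    and H: "H 0 = u"
      "\<And>n x. x \<in> D \<Longrightarrow> (H (Suc n) has_field_derivative kdv_rhs (\<lambda>_. 1) u (H n) x) (at x)"
  shows "triangular D H (\<lambda>n x. F n (\<phi> x))"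
proof -
  define K where "K = (\<lambda>n x. F n (\<phi> x))"
  have holK: "K n holomorphic_on D" for n
    unfolding K_def using holomorphic_on_compose_gen[OF D(3) F(2) D(4)] by (simp add: o_def)
  have dK: "(K (Suc i) has_field_derivative kdv_rhs p q (F i) (\<phi> x) * deriv \<phi> x) (at x)"
    "(K i has_field_derivative deriv (F i) (\<phi> x) * deriv \<phi> x) (at x)" if "x \<in> D" for i x
  proof -
    have "\<phi> x \<in> S" using D(4) that by blast
    moreover have "(\<phi> has_field_derivative deriv \<phi> x) (at x)"
      using D that by (intro DERIV_deriv_holomorphic)
    ultimately show "(K (Suc i) has_field_derivative kdv_rhs p q (F i) (\<phi> x) * deriv \<phi> x) (at x)"
      "(K i has_field_derivative deriv (F i) (\<phi> x) * deriv \<phi> x) (at x)"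
      unfolding K_def
      by (auto intro: DERIV_chain2[OF F(3)] DERIV_chain2[OF DERIV_deriv_holomorphic[OF S F(2)]])
  qed
  have "\<exists>t. t \<noteq> 0 \<and> in_span_below D K n (\<lambda>x. H n x - t * K n x)" for n
  proof (induction n)
    case 0
    have "in_span_below D K 0 (\<lambda>x. H 0 x - s * K 0 x)"
      by (rule in_span_below_cong[OF in_span_below_const[of _ _ _ C]]) (simp add: H F K_def u)
    with s show ?case by blast
  next
    case (Suc n)
    then obtain t \<alpha>' \<beta> where t: "t \<noteq> 0"
      and ab: "\<And>x. x \<in> D \<Longrightarrow> H n x - t * K n x = (\<Sum>i<n. \<alpha>' i * K i x) + \<beta>"
      unfolding in_span_below_def by blast
    define \<alpha> where "\<alpha> = \<alpha>'(n := t)"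
    have Hn: "H n x = (\<Sum>i\<le>n. \<alpha> i * K i x) + \<beta>" if "x \<in> D" for x
      using ab[OF that] by (simp add: \<alpha>_def lessThan_Suc_atMost[symmetric] algebra_simps)
    \<comment> \<open>The constant \<open>\<beta>\<close> contributes \<open>- 2 \<beta> u'\<close>, the derivative of a multiple of \<open>K 0\<close>.\<close>
    define T where "T = (\<lambda>x. (\<Sum>i\<le>n. \<alpha> i * (s * K (Suc i) x - 4 * C * K i x)) - 2 * \<beta> * s * K 0 x)"
    have dT: "(T has_field_derivative kdv_rhs (\<lambda>_. 1) u (H n) x) (at x)" if x: "x \<in> D" for x
    proof -
      have u1: "deriv u x = s * (deriv (F 0) (\<phi> x) * deriv \<phi> x)"
      proof -
        have "(deriv ^^ 1) u x = (deriv ^^ 1) (\<lambda>x. s * K 0 x + C) x"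
          by (rule higher_deriv_cong_open[OF D(1) _ x]) (simp add: u K_def F)
        with DERIV_imp_deriv[OF DERIV_add[OF DERIV_cmult[OF dK(2)[OF x, of 0], of s] DERIV_const[of C]]]
        show ?thesis by simp
      qed
      have comp: "kdv_rhs (\<lambda>_. 1) u (K i) x
          = deriv \<phi> x * (s * kdv_rhs p q (F i) (\<phi> x) - 4 * C * deriv (F i) (\<phi> x))" for i
        unfolding K_def by (rule kdv_rhs_compose[where S = S and D = D])
          (use D S hol F(2) d1 d2 u x in auto)
      have "kdv_rhs (\<lambda>_. 1) u (H n) x = kdv_rhs (\<lambda>_. 1) u (\<lambda>x. (\<Sum>i\<le>n. \<alpha> i * K i x) + \<beta>) x"
        by (rule kdv_rhs_cong[OF D(1) Hn x])
      also have "\<dots> = (\<Sum>i\<le>n. \<alpha> i * kdv_rhs (\<lambda>_. 1) u (K i) x) - 2 * deriv u x * \<beta>"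
      proof (subst kdv_rhs_add[OF D(1) _ _ x])
        show "(\<lambda>x. \<Sum>i\<le>n. \<alpha> i * K i x) holomorphic_on D"
          by (intro holomorphic_intros holK)
        have "kdv_rhs (\<lambda>_. 1) u (\<lambda>x. \<Sum>i\<le>n. \<alpha> i * K i x) x
            = (\<Sum>i\<le>n. kdv_rhs (\<lambda>_. 1) u (\<lambda>x. \<alpha> i * K i x) x)"
          by (rule kdv_rhs_sum[OF D(1) _ x]) (auto intro!: holomorphic_intros holK)
        also have "\<dots> = (\<Sum>i\<le>n. \<alpha> i * kdv_rhs (\<lambda>_. 1) u (K i) x)"
          by (simp add: kdv_rhs_cmult[OF D(1) holK x])
        finally show "kdv_rhs (\<lambda>_. 1) u (\<lambda>x. \<Sum>i\<le>n. \<alpha> i * K i x) x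
            + kdv_rhs (\<lambda>_. 1) u (\<lambda>x. \<beta>) x
            = (\<Sum>i\<le>n. \<alpha> i * kdv_rhs (\<lambda>_. 1) u (K i) x) - 2 * deriv u x * \<beta>"
          by (simp add: kdv_rhs_const)
      qed auto
      also have "\<dots> = (\<Sum>i\<le>n. \<alpha> i * (s * (kdv_rhs p q (F i) (\<phi> x) * deriv \<phi> x)
            - 4 * C * (deriv (F i) (\<phi> x) * deriv \<phi> x)))
          - 2 * \<beta> * s * (deriv (F 0) (\<phi> x) * deriv \<phi> x)"
        unfolding comp u1 by (simp add: algebra_simps)
      finally have *: "kdv_rhs (\<lambda>_. 1) u (H n) x = \<dots>" .
      show ?thesis
        unfolding * T_def by (intro DERIV_diff DERIV_sum DERIV_cmult dK x)
    qed
    have "(\<lambda>x. H (Suc n) x - T x) constant_on D"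
    proof (rule has_field_derivative_0_imp_constant_on[OF _ D(2,1)])
      show "((\<lambda>x. H (Suc n) x - T x) has_field_derivative 0) (at x)" if "x \<in> D" for x
        using DERIV_diff[OF H(2)[OF that, of n] dT[OF that]] by simp
    qed
    then obtain c where c: "\<And>x. x \<in> D \<Longrightarrow> H (Suc n) x - T x = c"
      unfolding constant_on_def by blast
    have "in_span_below D K (Suc n) (\<lambda>x. ((\<Sum>i<n. \<alpha> i * s * K (Suc i) x)
        + (\<Sum>i\<le>n. (- 4 * C * \<alpha> i) * K i x)) + ((- 2 * \<beta> * s) * K 0 x + c))"
      by (intro in_span_below_add in_span_below_sum in_span_below_cmult in_span_below_const
            in_span_below_member) auto
    then have "in_span_below D K (Suc n) (\<lambda>x. H (Suc n) x - t * s * K (Suc n) x)"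
    proof (rule in_span_below_cong)
      fix x assume "x \<in> D"
      from c[OF this] have "H (Suc n) x = T x + c" by (simp add: algebra_simps)
      then show "((\<Sum>i<n. \<alpha> i * s * K (Suc i) x) + (\<Sum>i\<le>n. (- 4 * C * \<alpha> i) * K i x))
          + ((- 2 * \<beta> * s) * K 0 x + c) = H (Suc n) x - t * s * K (Suc n) x"
        unfolding T_def
        by (simp add: \<alpha>_def lessThan_Suc_atMost[symmetric] sum.distrib sum_subtractf sum_negf
             right_diff_distrib mult.assoc mult.left_commute sum_distrib_left)
    qed
    with t s show ?case by (intro exI[of _ "t * s"]) auto
  qed
  then show ?thesis
    unfolding triangular_def K_def by blast
qed

section \<open>Differential polynomials\<close>

lemma diff_polys_holomorphic:
  assumes "f \<in> diff_polys u" "open D" "u holomorphic_on D"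
  shows "f holomorphic_on D"
  using assms(1)
  by induction (auto intro!: holomorphic_intros holomorphic_higher_deriv assms)

text \<open>
  Agreement is required on \<open>D\<close> only: at a pole the value of a function and that of its derivative are
  unrelated conventions, so that the class of differential polynomials is closed under
  differentiation only up to the values outside \<open>D\<close>.
\<close>

definition agrees_with_diff_poly :: "(complex \<Rightarrow> complex) \<Rightarrow> complex set \<Rightarrow> (complex \<Rightarrow> complex) \<Rightarrow> bool" where
  "agrees_with_diff_poly u D f \<longleftrightarrow> (\<exists>g\<in>diff_polys u. \<forall>x\<in>D. f x = g x)"

context
  fixes u :: "complex \<Rightarrow> complex" and D :: "complex set"
  assumes D: "open D" and u: "u holomorphic_on D"
begin

lemma agrees_self: "agrees_with_diff_poly u D u"
  unfolding agrees_with_diff_poly_def using diff_polys.derivative[of 0 u] by auto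

lemma agrees_cong:
  "agrees_with_diff_poly u D f \<Longrightarrow> (\<And>x. x \<in> D \<Longrightarrow> f x = g x) \<Longrightarrow> agrees_with_diff_poly u D g"
  unfolding agrees_with_diff_poly_def by (metis (no_types, lifting))

lemma agrees_add:
  assumes "agrees_with_diff_poly u D f" "agrees_with_diff_poly u D g"
  shows "agrees_with_diff_poly u D (\<lambda>x. f x + g x)"
proof -
  from assms obtain f' g' where "f' \<in> diff_polys u" "\<forall>x\<in>D. f x = f' x"
    "g' \<in> diff_polys u" "\<forall>x\<in>D. g x = g' x"
    unfolding agrees_with_diff_poly_def by blast
  then show ?thesis
    unfolding agrees_with_diff_poly_def by (intro bexI[OF _ diff_polys.add[of f' u g']]) auto
qed

lemma agrees_mult:
  assumes "agrees_with_diff_poly u D f" "agrees_with_diff_poly u D g"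
  shows "agrees_with_diff_poly u D (\<lambda>x. f x * g x)"
proof -
  from assms obtain f' g' where "f' \<in> diff_polys u" "\<forall>x\<in>D. f x = f' x"
    "g' \<in> diff_polys u" "\<forall>x\<in>D. g x = g' x"
    unfolding agrees_with_diff_poly_def by blast
  then show ?thesis
    unfolding agrees_with_diff_poly_def by (intro bexI[OF _ diff_polys.mult[of f' u g']]) auto
qed

lemma agrees_cmult:
  assumes "agrees_with_diff_poly u D f"
  shows "agrees_with_diff_poly u D (\<lambda>x. c * f x)"
proof -
  from assms obtain f' where "f' \<in> diff_polys u" "\<forall>x\<in>D. f x = f' x"
    unfolding agrees_with_diff_poly_def by blast
  then show ?thesis
    unfolding agrees_with_diff_poly_def by (intro bexI[OF _ diff_polys.scale[of f' u c]]) auto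
qed

lemma agrees_diff:
  assumes "agrees_with_diff_poly u D f" "agrees_with_diff_poly u D g"
  shows "agrees_with_diff_poly u D (\<lambda>x. f x - g x)"
  using agrees_add[OF assms(1) agrees_cmult[OF assms(2), of "-1"]] by simp

lemma agrees_sum:
  "(\<And>i. i \<in> A \<Longrightarrow> agrees_with_diff_poly u D (f i)) \<Longrightarrow> agrees_with_diff_poly u D (\<lambda>x. \<Sum>i\<in>A. f i x)"
proof (induction A rule: infinite_finite_induct)
  case (insert i A)
  then show ?case using agrees_add[of "f i" "\<lambda>x. \<Sum>i\<in>A. f i x"] by simp
qed (use agrees_cmult[OF agrees_self, of 0] in auto)

lemma diff_poly_deriv:
  assumes "f \<in> diff_polys u"
  shows "agrees_with_diff_poly u D (deriv f)"
  using assms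
proof induction
  case (derivative i)
  have "(deriv ^^ Suc i) u \<in> diff_polys u" by (rule diff_polys.derivative)
  then show ?case unfolding agrees_with_diff_poly_def by (intro bexI) auto
next
  case (add f g)
  have f: "f holomorphic_on D" "g holomorphic_on D"
    by (auto intro: diff_polys_holomorphic add D u)
  show ?case
    by (rule agrees_cong[OF agrees_add[OF add.IH]])
       (auto intro!: DERIV_imp_deriv[symmetric] DERIV_add DERIV_deriv_holomorphic[OF D] f)
next
  case (mult f g)
  have f: "f holomorphic_on D" "g holomorphic_on D"
    by (auto intro: diff_polys_holomorphic mult D u)
  have fg: "agrees_with_diff_poly u D f" "agrees_with_diff_poly u D g"
    using mult.hyps unfolding agrees_with_diff_poly_def by blast+
  show ?case
    by (rule agrees_cong[OF agrees_add[OF agrees_mult[OF fg(1) mult.IH(2)] agrees_mult[OF mult.IH(1) fg(2)]]])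
       (auto intro!: DERIV_imp_deriv[symmetric] DERIV_mult' DERIV_deriv_holomorphic[OF D] f)
next
  case (scale f c)
  have f: "f holomorphic_on D"
    by (auto intro: diff_polys_holomorphic scale D u)
  show ?case
    by (rule agrees_cong[OF agrees_cmult[OF scale.IH, of c]])
       (auto intro!: DERIV_imp_deriv[symmetric] DERIV_cmult DERIV_deriv_holomorphic[OF D] f)
qed

lemma agrees_deriv:
  assumes "agrees_with_diff_poly u D f"
  shows "agrees_with_diff_poly u D (deriv f)"
proof -
  from assms obtain g where g: "g \<in> diff_polys u" "\<And>x. x \<in> D \<Longrightarrow> f x = g x"
    unfolding agrees_with_diff_poly_def by blast
  have "deriv g x = deriv f x" if "x \<in> D" for x
    using higher_deriv_cong_open[OF D g(2) that, where k = 1] by simp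
  then show ?thesis
    by (rule agrees_cong[OF diff_poly_deriv[OF g(1)]])
qed

text \<open>
  For \<open>p = 1\<close> the recursion uses products and derivatives only. The index \<open>0\<close> needs attention, since the
  constant \<open>G 0\<close> itself is not a differential polynomial without constant term; it occurs only as a
  factor of a differential polynomial.
\<close>

lemma gelfand_dikii_diff_poly:
  "agrees_with_diff_poly u D (gelfand_dikii (\<lambda>_. 1) u (Suc n))"
proof (induction n rule: less_induct)
  case (less n)
  define G where "G = gelfand_dikii (\<lambda>_. 1) u"
  have IH: "agrees_with_diff_poly u D (G i)" if "1 \<le> i" "i \<le> n" for i
    using less[of "i - 1"] that by (simp add: G_def del: gelfand_dikii.simps)
  have zero: "agrees_with_diff_poly u D (\<lambda>x. 0)"
    using agrees_cmult[OF agrees_self, of 0] by simp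
  have G0: "G 0 = (\<lambda>x. - 1 / 2)"
    by (simp add: G_def)
  have mulG: "agrees_with_diff_poly u D (\<lambda>x. G i x * f x)"
    if "i \<le> n" "agrees_with_diff_poly u D f" for i f
  proof (cases "i = 0")
    case True
    then show ?thesis using agrees_cmult[OF that(2), of "- 1 / 2"] by (simp add: G0)
  next
    case False
    then show ?thesis using agrees_mult[OF IH that(2), of i] that(1) by simp
  qed
  have dG: "agrees_with_diff_poly u D (deriv (G i))" if "i \<le> n" for i
  proof (cases "i = 0")
    case True
    then show ?thesis using zero by (simp add: G0)
  next
    case False
    then show ?thesis using agrees_deriv[OF IH, of i] that by simp
  qed
  have 1: "agrees_with_diff_poly u D (\<lambda>x. \<Sum>i=1..n. G i x * G (Suc n - i) x)"
    by (intro agrees_sum agrees_mult IH) auto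
  have 2: "agrees_with_diff_poly u D (\<lambda>x. \<Sum>i\<le>n. 2 * (G i x * deriv (deriv (G (n - i))) x)
      - deriv (G i) x * deriv (G (n - i)) x - 4 * (G i x * (G (n - i) x * u x)))"
    by (intro agrees_sum agrees_diff agrees_cmult mulG agrees_mult agrees_deriv[OF dG] dG agrees_self)
       auto
  show ?case
    by (rule agrees_cong[OF agrees_diff[OF 1 2]])
       (simp only: G_def gelfand_dikii.simps(2), simp add: algebra_simps del: gelfand_dikii.simps)
qed

lemma kdv_hierarchy_exists: "\<exists>J. kdv_hierarchy u D J"
proof -
  have "\<forall>n. \<exists>f\<in>diff_polys u. \<forall>x\<in>D. gelfand_dikii (\<lambda>_. 1) u (Suc n) x = f x"
    using gelfand_dikii_diff_poly unfolding agrees_with_diff_poly_def by blast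
  then obtain f where f: "\<And>n. f n \<in> diff_polys u"
    "\<And>n x. x \<in> D \<Longrightarrow> gelfand_dikii (\<lambda>_. 1) u (Suc n) x = f n x"
    by metis
  define J where "J = (\<lambda>n. if n = 0 then u else f n)"
  have J: "J n x = gelfand_dikii (\<lambda>_. 1) u (Suc n) x" if "x \<in> D" for n x
    using f(2)[OF that, of n] by (cases n) (simp_all add: J_def gelfand_dikii_1 del: gelfand_dikii.simps(2))
  have "(J (Suc n) has_field_derivative kdv_rhs (\<lambda>_. 1) u (J n) x) (at x)" if x: "x \<in> D" for n x
  proof -
    have "kdv_rhs (\<lambda>_. 1) u (J n) x = kdv_rhs (\<lambda>_. 1) u (gelfand_dikii (\<lambda>_. 1) u (Suc n)) x"
      by (rule kdv_rhs_cong[OF D J x])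
    with gelfand_dikii_recursion[OF D holomorphic_on_const u x, of 1 "Suc n"]
    have "(gelfand_dikii (\<lambda>_. 1) u (Suc (Suc n)) has_field_derivative kdv_rhs (\<lambda>_. 1) u (J n) x) (at x)"
      by (simp del: gelfand_dikii.simps)
    then show ?thesis
      by (rule has_field_derivative_transform_within_open[OF _ D x]) (simp add: J del: gelfand_dikii.simps)
  qed
  moreover have "J n \<in> diff_polys u" for n
    using f(1) diff_polys.derivative[of 0 u] by (simp add: J_def)
  ultimately have "kdv_hierarchy u D J"
    unfolding kdv_hierarchy_def kdv_rhs_def by (simp add: J_def)
  then show ?thesis by blast
qed

end

lemma kdv_hierarchy_recursion:
  assumes "kdv_hierarchy u D J" "x \<in> D"
  shows "(J (Suc n) has_field_derivative kdv_rhs (\<lambda>_. 1) u (J n) x) (at x)"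
  using assms unfolding kdv_hierarchy_def kdv_rhs_def by simp

section \<open>Finite-gap potentials and Novikov equations\<close>

definition cubic :: "complex \<Rightarrow> complex \<Rightarrow> complex" where
  "cubic a z = z * (z - 1) * (z - a)"

lemma DERIV_cubic: "(cubic a has_field_derivative 3 * z\<^sup>2 - 2 * (a + 1) * z + a) (at z)"
  unfolding cubic_def[abs_def]
  by (rule derivative_eq_intros refl)+ (simp add: power2_eq_square algebra_simps)

lemma deriv_cubic: "deriv (cubic a) z = 3 * z\<^sup>2 - 2 * (a + 1) * z + a"
  by (rule DERIV_imp_deriv[OF DERIV_cubic])

lemma deriv2_cubic: "deriv (deriv (cubic a)) z = 6 * z - 2 * (a + 1)"
proof -
  have "deriv (cubic a) = (\<lambda>z. 3 * z\<^sup>2 - 2 * (a + 1) * z + a)"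
    by (rule ext) (rule deriv_cubic)
  moreover have "((\<lambda>z. 3 * z\<^sup>2 - 2 * (a + 1) * z + a) has_field_derivative 6 * z - 2 * (a + 1)) (at z)"
    by (rule derivative_eq_intros refl)+ simp
  ultimately show ?thesis by (simp add: DERIV_imp_deriv)
qed

lemma holomorphic_cubic [holomorphic_intros]: "cubic a holomorphic_on S"
  unfolding cubic_def[abs_def] by (intro holomorphic_intros)

lemma DERIV_weighted_second_order:
  assumes S: "open S" "z \<in> S" and f: "f holomorphic_on S"
  shows "((\<lambda>z. z * (z - 1) * (z - a) * deriv (deriv f) z
            + (3 * z\<^sup>2 - 2 * (a + 1) * z + a) / 2 * deriv f z)
          has_field_derivative kdv_rhs (cubic a) q f z + (4 * q z * deriv f z + 2 * f z * deriv q z)) (at z)"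
proof -
  have hd: "deriv f holomorphic_on S" "deriv (deriv f) holomorphic_on S"
    using f S by (auto intro!: holomorphic_deriv)
  have d: "(deriv f has_field_derivative deriv (deriv f) z) (at z)"
    "(deriv (deriv f) has_field_derivative (deriv ^^ 3) f z) (at z)"
    using DERIV_deriv_holomorphic[OF S(1) hd(1) S(2)] DERIV_deriv_holomorphic[OF S(1) hd(2) S(2)]
    by (simp_all add: numeral_3_eq_3)
  have e: "z * (z - 1) * (z - a) = cubic a z" for z
    by (simp add: cubic_def)
  have c: "((\<lambda>z. (3 * z\<^sup>2 - 2 * (a + 1) * z + a) / 2) has_field_derivative 3 * z - (a + 1)) (at z)"
    by (rule derivative_eq_intros refl)+ (simp, simp add: field_simps)
  show ?thesis
    unfolding e kdv_rhs_def deriv_cubic deriv2_cubic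
    by (rule derivative_eq_intros d c DERIV_cubic refl)+ (simp add: field_simps)
qed

lemma novikov_step_recursion:
  assumes S: "open S" "z \<in> S" and f: "f holomorphic_on S" and st: "novikov_step a q S f h"
  shows "(h has_field_derivative kdv_rhs (cubic a) q f z) (at z)"
proof -
  from st obtain G where G:
    "\<And>z. z \<in> S \<Longrightarrow> (G has_field_derivative (4 * q z * deriv f z + 2 * f z * deriv q z)) (at z)"
    "\<And>z. z \<in> S \<Longrightarrow> h z = z * (z - 1) * (z - a) * deriv (deriv f) z
              + (3 * z\<^sup>2 - 2 * (a + 1) * z + a) / 2 * deriv f z - G z"
    unfolding novikov_step_def by blast
  from DERIV_diff[OF DERIV_weighted_second_order[OF S f, of a q] G(1)[OF S(2)]]
  have "((\<lambda>z. z * (z - 1) * (z - a) * deriv (deriv f) z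
              + (3 * z\<^sup>2 - 2 * (a + 1) * z + a) / 2 * deriv f z - G z)
      has_field_derivative kdv_rhs (cubic a) q f z) (at z)"
    by simp
  then show ?thesis
    by (rule has_field_derivative_transform_within_open[OF _ S]) (simp add: G)
qed

text \<open>
  Any \<open>h\<close> with the right derivative is a value of the integro-differential operator: the difference
  between its differential part and \<open>h\<close> serves as the antiderivative.
\<close>

lemma novikov_stepI:
  assumes S: "open S" and f: "f holomorphic_on S"
    and h: "\<And>z. z \<in> S \<Longrightarrow> (h has_field_derivative kdv_rhs (cubic a) q f z) (at z)"
  shows "novikov_step a q S f h"
  unfolding novikov_step_def
proof (intro exI ballI conjI)
  fix z assume z: "z \<in> S"
  define L where "L = (\<lambda>z. z * (z - 1) * (z - a) * deriv (deriv f) z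
            + (3 * z\<^sup>2 - 2 * (a + 1) * z + a) / 2 * deriv f z)"
  show "((\<lambda>z. L z - h z) has_field_derivative 4 * q z * deriv f z + 2 * f z * deriv q z) (at z)"
    using DERIV_diff[OF DERIV_weighted_second_order[OF S z f, of a q] h[OF z]] by (simp add: L_def)
  show "h z = z * (z - 1) * (z - a) * deriv (deriv f) z
            + (3 * z\<^sup>2 - 2 * (a + 1) * z + a) / 2 * deriv f z - (L z - h z)"
    by (simp add: L_def)
qed

text \<open>
  From finite-gap to Novikov, the Gelfand-Dikii functions on the \<open>z\<close>-side supply antiderivatives on all
  of the multiply connected set \<open>S\<close>; the relation holds on the open image of \<open>D\<close> and hence, by the identity
  theorem, on \<open>S\<close>. In the other direction the Gelfand-Dikii functions on the \<open>x\<close>-side supply a hierarchy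
  of differential polynomials.
\<close>

theorem finite_gap_iff_novikov:
  assumes D: "open D" "connected D" "D \<noteq> {}" "\<phi> holomorphic_on D" "\<phi> ` D \<subseteq> S"
    and S: "open S" "connected S" "S \<inter> {0, 1, a} = {}" and I0: "I0 holomorphic_on S"
    and d1: "\<And>x. x \<in> D \<Longrightarrow> (deriv \<phi> x)\<^sup>2 = s * cubic a (\<phi> x)"
    and d2: "\<And>x. x \<in> D \<Longrightarrow> deriv (deriv \<phi>) x = s / 2 * deriv (cubic a) (\<phi> x)"
    and u: "\<And>x. x \<in> D \<Longrightarrow> u x = s * I0 (\<phi> x) + C" and s: "s \<noteq> 0"
  shows "finite_gap u D \<longleftrightarrow> (\<exists>g. novikov_equation a I0 S g)"
proof
  have uD: "u holomorphic_on D"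
  proof (rule holomorphic_transform)
    show "(\<lambda>x. s * I0 (\<phi> x) + C) holomorphic_on D"
      using holomorphic_on_compose_gen[OF D(4) I0 D(5)]
      by (intro holomorphic_intros) (simp add: o_def)
  qed (simp add: u)
  have cub: "cubic a holomorphic_on S"
    by (rule holomorphic_cubic)
  show "\<exists>g. novikov_equation a I0 S g" if fg: "finite_gap u D"
  proof -
    from fg obtain J g where J: "kdv_hierarchy u D J" "in_span_below D J g (J g)"
      unfolding finite_gap_def in_span_below_iff_relation[symmetric] by blast
    define F where "F = (\<lambda>n. gelfand_dikii (cubic a) I0 (Suc n))"
    have F0: "F 0 = I0"
      by (simp add: F_def gelfand_dikii_1 del: gelfand_dikii.simps)
    have Fh: "F n holomorphic_on S" for n
      unfolding F_def by (rule holomorphic_gelfand_dikii[OF S(1) cub I0])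
    have Fd: "(F (Suc n) has_field_derivative kdv_rhs (cubic a) I0 (F n) z) (at z)" if "z \<in> S" for n z
      unfolding F_def by (rule gelfand_dikii_recursion[OF S(1) cub I0 that])
    have J0: "J 0 = u"
      using J(1) by (simp add: kdv_hierarchy_def)
    have "triangular D J (\<lambda>n x. F n (\<phi> x))"
      by (rule hierarchy_comparison[OF D(1,2,4,5) S(1) cub I0 d1 d2 u s F0 Fh Fd J0
            kdv_hierarchy_recursion[OF J(1)]])
    from triangular_transfer_relation[OF this J(2)] obtain \<alpha> \<beta> where
      ab: "\<And>x. x \<in> D \<Longrightarrow> F g (\<phi> x) = (\<Sum>i<g. \<alpha> i * F i (\<phi> x)) + \<beta>"
      unfolding in_span_below_def by blast
    have ne: "deriv \<phi> x \<noteq> 0" if "x \<in> D" for x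
    proof -
      have "\<phi> x \<notin> {0, 1, a}" using that D(5) S(3) by blast
      then have "cubic a (\<phi> x) \<noteq> 0" by (simp add: cubic_def)
      with d1[OF that] s show ?thesis by auto
    qed
    obtain x0 where x0: "x0 \<in> D" using D(3) by blast
    have "\<not> \<phi> constant_on D"
    proof
      assume "\<phi> constant_on D"
      then obtain c where "\<And>x. x \<in> D \<Longrightarrow> \<phi> x = c" unfolding constant_on_def by blast
      then have "(deriv ^^ 1) \<phi> x0 = (deriv ^^ 1) (\<lambda>x. c) x0"
        by (rule higher_deriv_cong_open[OF D(1) _ x0])
      with ne[OF x0] show False by simp
    qed
    then have op: "open (\<phi> ` D)"
      by (intro open_mapping_thm[OF D(4,1,2,1)]) auto
    have "F g z = (\<Sum>i<g. \<alpha> i * F i z) + \<beta>" if "z \<in> S" for z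
    proof (rule analytic_continuation_open[OF op S(1) _ S(2) D(5) Fh _ _ that])
      show "\<phi> ` D \<noteq> {}" using D(3) by blast
      show "(\<lambda>z. (\<Sum>i<g. \<alpha> i * F i z) + \<beta>) holomorphic_on S"
        by (intro holomorphic_intros Fh)
    qed (use ab in auto)
    then have rel: "in_span_below S F g (F g)"
      unfolding in_span_below_def by blast
    have "novikov_step a I0 S (F j) (F (Suc j))" for j
      by (rule novikov_stepI[OF S(1) Fh Fd])
    with rel F0 have "novikov_equation a I0 S g"
      unfolding novikov_equation_def in_span_below_iff_relation by blast
    then show ?thesis by blast
  qed
  show "finite_gap u D" if "\<exists>g. novikov_equation a I0 S g"
  proof -
    from that obtain g I where I: "I 0 = I0" "\<And>j. novikov_step a I0 S (I j) (I (Suc j))"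
      "in_span_below S I g (I g)"
      unfolding novikov_equation_def in_span_below_iff_relation[symmetric] by blast
    have Ih: "I n holomorphic_on S" for n
    proof (induction n)
      case 0
      then show ?case by (simp add: I I0)
    next
      case (Suc n)
      then show ?case
        using novikov_step_recursion[OF S(1) _ Suc I(2)] S(1) by (auto simp: holomorphic_on_open)
    qed
    have Id: "(I (Suc n) has_field_derivative kdv_rhs (cubic a) I0 (I n) z) (at z)" if "z \<in> S" for n z
      by (rule novikov_step_recursion[OF S(1) that Ih I(2)])
    obtain J where J: "kdv_hierarchy u D J"
      using kdv_hierarchy_exists[OF D(1) uD] by blast
    have J0: "J 0 = u"
      using J(1) by (simp add: kdv_hierarchy_def)
    have "triangular D J (\<lambda>n x. I n (\<phi> x))"
      by (rule hierarchy_comparison[OF D(1,2,4,5) S(1) cub I0 d1 d2 u s I(1) Ih Id J0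
            kdv_hierarchy_recursion[OF J]])
    then have tr: "triangular D (\<lambda>n x. I n (\<phi> x)) J"
      by (rule triangular_sym)
    from I(3) obtain \<alpha> \<beta> where "\<And>z. z \<in> S \<Longrightarrow> I g z = (\<Sum>i<g. \<alpha> i * I i z) + \<beta>"
      unfolding in_span_below_def by blast
    then have "in_span_below D (\<lambda>n x. I n (\<phi> x)) g (\<lambda>x. I g (\<phi> x))"
      unfolding in_span_below_def using D(5) by blast
    from triangular_transfer_relation[OF tr this] J show ?thesis
      unfolding finite_gap_def in_span_below_iff_relation[symmetric] by blast
  qed
qed

section \<open>Lattice sums\<close>

lemma summable_on_int_powr:
  "(\<lambda>i::int. (1 + \<bar>real_of_int i\<bar>) powr (- 3 / 2)) summable_on UNIV"
proof -
  have "summable (\<lambda>n. real n powr (- 3 / 2))"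
    by (simp add: summable_real_powr_iff)
  then have "summable (\<lambda>n. real (Suc n) powr (- 3 / 2))"
    by (subst summable_Suc_iff)
  then have *: "(\<lambda>n::nat. (1 + real n) powr (- 3 / 2)) summable_on UNIV"
    by (intro norm_summable_imp_summable_on) (simp add: add.commute)
  have "(\<lambda>i::int. (1 + \<bar>real_of_int i\<bar>) powr (- 3 / 2)) summable_on (range int)"
    by (subst summable_on_reindex) (use * in \<open>auto simp: o_def\<close>)
  moreover have "(\<lambda>i::int. (1 + \<bar>real_of_int i\<bar>) powr (- 3 / 2)) summable_on (range (\<lambda>n. - int n))"
    by (subst summable_on_reindex) (use * in \<open>auto simp: o_def inj_on_def\<close>)
  ultimately have "(\<lambda>i::int. (1 + \<bar>real_of_int i\<bar>) powr (- 3 / 2)) summable_on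
      (range int \<union> range (\<lambda>n. - int n))"
    by (rule summable_on_union)
  moreover have "range int \<union> range (\<lambda>n. - int n) = UNIV"
  proof -
    have "i \<in> range int \<union> range (\<lambda>n. - int n)" for i
      by (cases i rule: int_cases2) auto
    then show ?thesis by blast
  qed
  ultimately show ?thesis by simp
qed

text \<open>
  At the origin the value is \<open>0\<close> by the convention for division, so that sums may run over all pairs.
\<close>

definition lattice_weight :: "int \<times> int \<Rightarrow> real" where
  "lattice_weight = (\<lambda>(i, j). 1 / real_of_int (max \<bar>i\<bar> \<bar>j\<bar>) ^ 3)"

text \<open>
  With \<open>m = max \<bar>i\<bar> \<bar>j\<bar> \<ge> 1\<close> one has \<open>(1 + \<bar>i\<bar>) (1 + \<bar>j\<bar>) \<le> 4 m\<^sup>2\<close>, so that \<open>m\<^sup>-\<^sup>3\<close> is bounded by a multiple of the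
  product of the summable sequences \<open>(1 + \<bar>i\<bar>) powr (-3/2)\<close> and \<open>(1 + \<bar>j\<bar>) powr (-3/2)\<close>.
\<close>

lemma lattice_weight_summable: "lattice_weight summable_on UNIV"
proof -
  define g where "g = (\<lambda>i::int. (1 + \<bar>real_of_int i\<bar>) powr (- 3 / 2))"
  have g: "g summable_on UNIV" "\<And>i. g i \<ge> 0"
    using summable_on_int_powr by (auto simp: g_def)
  have "(\<lambda>(i, j). 8 * g i * g j) summable_on (UNIV \<times> UNIV)"
    by (rule summable_on_SigmaI[where g = "\<lambda>i. 8 * g i * infsum g UNIV"])
       (use g in \<open>auto intro!: has_sum_cmult_right has_sum_infsum summable_on_cmult_right
           summable_on_cmult_left\<close>)
  then have s: "(\<lambda>(i, j). 8 * g i * g j) summable_on UNIV"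
    by simp
  show ?thesis
  proof (rule summable_on_comparison_test[OF s])
    fix p :: "int \<times> int"
    obtain i j where p: "p = (i, j)" by force
    define m where "m = real_of_int (max \<bar>i\<bar> \<bar>j\<bar>)"
    have "1 / m ^ 3 \<le> 8 * g i * g j"
    proof (cases "m = 0")
      case False
      then have "max \<bar>i\<bar> \<bar>j\<bar> \<ge> 1" unfolding m_def by auto
      then have m: "m \<ge> 1" unfolding m_def by linarith
      define A where "A = 1 + \<bar>real_of_int i\<bar>"
      define B where "B = 1 + \<bar>real_of_int j\<bar>"
      have AB: "1 \<le> A" "A \<le> 2 * m" "1 \<le> B" "B \<le> 2 * m"
        using m by (auto simp: m_def A_def B_def)
      have "A * B \<le> (2 * m) * (2 * m)"
        using AB by (intro mult_mono) auto
      then have "(A * B) powr (3 / 2) \<le> ((2 * m) ^ 2) powr (3 / 2)"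
        using AB by (intro powr_mono2) (auto simp: power2_eq_square)
      also have "\<dots> = 8 * m ^ 3"
      proof -
        have "((2 * m) ^ 2) powr (3 / 2) = ((2 * m) powr 2) powr (3 / 2)"
          using m by (simp add: powr_numeral)
        also have "\<dots> = (2 * m) powr 3"
          unfolding powr_powr by simp
        also have "\<dots> = (2 * m) ^ 3"
          using m by (simp add: powr_numeral)
        finally show ?thesis by (simp add: power_mult_distrib)
      qed
      finally have "1 / m ^ 3 \<le> 8 * (1 / (A * B) powr (3 / 2))"
        using AB m by (simp add: field_simps)
      also have "1 / (A * B) powr (3 / 2) = g i * g j"
        using AB by (simp add: g_def A_def B_def powr_minus_divide powr_mult)
      finally show ?thesis by simp
    qed (use g in simp)
    then show "lattice_weight p \<le> (case p of (i, j) \<Rightarrow> 8 * g i * g j)"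
      by (simp add: p lattice_weight_def m_def)
  qed (auto simp: lattice_weight_def)
qed

text \<open>
  The imaginary part controls \<open>y\<close>, and then the triangle inequality controls \<open>x\<close>. The constant is explicit
  because uniformity in \<open>\<tau>\<close> matters later.
\<close>

lemma max_le_norm_combination:
  fixes x y :: real and \<tau> :: complex
  assumes "Im \<tau> \<noteq> 0"
  shows "max \<bar>x\<bar> \<bar>y\<bar> \<le> (1 + (norm \<tau> + 1) / \<bar>Im \<tau>\<bar>) * norm (of_real x + of_real y * \<tau>)"
proof -
  define N where "N = norm (of_real x + of_real y * \<tau>)"
  have "\<bar>y\<bar> * \<bar>Im \<tau>\<bar> \<le> N"
    using abs_Im_le_cmod[of "of_real x + of_real y * \<tau>"] by (simp add: N_def abs_mult)
  then have y: "\<bar>y\<bar> \<le> N / \<bar>Im \<tau>\<bar>"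
    using assms by (simp add: field_simps)
  have "\<bar>x\<bar> = norm (of_real x + of_real y * \<tau> - of_real y * \<tau>)"
    by simp
  also have "\<dots> \<le> N + norm (of_real y * \<tau>)"
    unfolding N_def by (rule norm_triangle_ineq4)
  also have "norm (of_real y * \<tau>) \<le> N / \<bar>Im \<tau>\<bar> * norm \<tau>"
    using mult_right_mono[OF y, of "norm \<tau>"] by (simp add: norm_mult)
  finally have x: "\<bar>x\<bar> \<le> N + N / \<bar>Im \<tau>\<bar> * norm \<tau>" by simp
  have "N \<ge> 0" by (simp add: N_def)
  then have N: "0 \<le> N / \<bar>Im \<tau>\<bar>" "0 \<le> N / \<bar>Im \<tau>\<bar> * norm \<tau>" by auto
  then have "max \<bar>x\<bar> \<bar>y\<bar> \<le> N + N / \<bar>Im \<tau>\<bar> * norm \<tau> + N / \<bar>Im \<tau>\<bar>"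
    using x y \<open>N \<ge> 0\<close> N by (intro max.boundedI; linarith)
  also have "\<dots> = (1 + (norm \<tau> + 1) / \<bar>Im \<tau>\<bar>) * N"
    by (simp add: field_simps add_divide_distrib)
  finally show ?thesis by (simp add: N_def)
qed

text \<open>
  The Weierstrass convergence theorem for unordered sums, together with termwise differentiation.
\<close>

lemma infsum_holomorphic:
  fixes f :: "'a \<Rightarrow> complex \<Rightarrow> complex"
  assumes S: "open S" and hol: "\<And>w. w \<in> A \<Longrightarrow> f w holomorphic_on S"
    and dom: "\<And>x. x \<in> S \<Longrightarrow> \<exists>r>0. \<exists>M. M summable_on A \<and> cball x r \<subseteq> S \<and>
      (\<forall>w\<in>A. \<forall>y\<in>cball x r. norm (f w y) \<le> M w)"
  shows "(\<lambda>x. \<Sum>\<^sub>\<infinity>w\<in>A. f w x) holomorphic_on S"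
    and "\<And>x. x \<in> S \<Longrightarrow> ((\<lambda>w. deriv (f w) x) has_sum deriv (\<lambda>x. \<Sum>\<^sub>\<infinity>w\<in>A. f w x) x) A"
proof -
  have key: "\<exists>D. ((\<lambda>x. \<Sum>\<^sub>\<infinity>w\<in>A. f w x) has_field_derivative D) (at x)
      \<and> ((\<lambda>w. deriv (f w) x) has_sum D) A" if x: "x \<in> S" for x
  proof -
    from dom[OF x] obtain r M where r: "r > 0" "M summable_on A" "cball x r \<subseteq> S"
      "\<And>w y. w \<in> A \<Longrightarrow> y \<in> cball x r \<Longrightarrow> norm (f w y) \<le> M w"
      by blast
    have ul: "uniform_limit (cball x r) (\<lambda>X y. \<Sum>w\<in>X. f w y) (\<lambda>y. \<Sum>\<^sub>\<infinity>w\<in>A. f w y)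
        (finite_subsets_at_top A)"
      by (rule Weierstrass_m_test_general[OF r(4) r(2)])
    have "\<forall>\<^sub>F X in finite_subsets_at_top A. continuous_on (cball x r) (\<lambda>y. \<Sum>w\<in>X. f w y) \<and>
        (\<forall>y\<in>ball x r. ((\<lambda>y. \<Sum>w\<in>X. f w y) has_field_derivative (\<Sum>w\<in>X. deriv (f w) y)) (at y))"
    proof (rule eventually_finite_subsets_at_top_weakI)
      fix X assume X: "finite X" "X \<subseteq> A"
      have hX: "f w holomorphic_on S" if "w \<in> X" for w
        using hol X that by blast
      have "(\<lambda>y. \<Sum>w\<in>X. f w y) holomorphic_on S"
        by (intro holomorphic_intros hX)
      then have "continuous_on (cball x r) (\<lambda>y. \<Sum>w\<in>X. f w y)"
        by (meson holomorphic_on_imp_continuous_on continuous_on_subset r(3))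
      moreover have "((\<lambda>y. \<Sum>w\<in>X. f w y) has_field_derivative (\<Sum>w\<in>X. deriv (f w) y)) (at y)"
        if "y \<in> ball x r" for y
      proof (rule DERIV_sum)
        fix w assume "w \<in> X"
        show "(f w has_field_derivative deriv (f w) y) (at y)"
          using holomorphic_derivI[OF hX[OF \<open>w \<in> X\<close>] S] that r(3) by force
      qed
      ultimately show "continuous_on (cball x r) (\<lambda>y. \<Sum>w\<in>X. f w y) \<and>
        (\<forall>y\<in>ball x r. ((\<lambda>y. \<Sum>w\<in>X. f w y) has_field_derivative (\<Sum>w\<in>X. deriv (f w) y)) (at y))"
        by blast
    qed
    from has_complex_derivative_uniform_limit[OF this ul finite_subsets_at_top_neq_bot r(1)]
    obtain g' where g': "\<And>w. w \<in> ball x r \<Longrightarrow>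
        ((\<lambda>y. \<Sum>\<^sub>\<infinity>w\<in>A. f w y) has_field_derivative g' w) (at w) \<and>
        ((\<lambda>X. \<Sum>v\<in>X. deriv (f v) w) \<longlongrightarrow> g' w) (finite_subsets_at_top A)"
      by blast
    from g'[of x] r(1) show ?thesis
      unfolding has_sum_def by auto
  qed
  show "(\<lambda>x. \<Sum>\<^sub>\<infinity>w\<in>A. f w x) holomorphic_on S"
    using key S by (auto simp: holomorphic_on_open)
  show "((\<lambda>w. deriv (f w) x) has_sum deriv (\<lambda>x. \<Sum>\<^sub>\<infinity>w\<in>A. f w x) x) A" if "x \<in> S" for x
    using key[OF that] by (auto dest: DERIV_imp_deriv)
qed

lemma wp_term_bound:
  fixes x w :: complex
  assumes "w \<noteq> 0" "norm x \<le> R" "norm x \<le> K * norm w" "c > 0" "c * norm w \<le> norm (x - w)"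
  shows "norm (1 / (x - w)\<^sup>2 - 1 / w\<^sup>2) \<le> R * (2 + K) / c\<^sup>2 / norm w ^ 3"
proof -
  have xw: "x - w \<noteq> 0"
  proof
    assume "x - w = 0"
    then have "c * norm w \<le> 0" using assms(5) by simp
    moreover have "c * norm w > 0" using assms by simp
    ultimately show False by linarith
  qed
  have "K * norm w \<ge> 0" using assms(3) norm_ge_zero[of x] by linarith
  then have K: "K \<ge> 0" using assms(1) by (simp add: zero_le_mult_iff)
  have R: "R \<ge> 0" using assms(2) norm_ge_zero[of x] by linarith
  have "1 / (x - w)\<^sup>2 - 1 / w\<^sup>2 = x * (2 * w - x) / (w\<^sup>2 * (x - w)\<^sup>2)"
    using xw assms(1) by (simp add: divide_simps) (simp add: power2_eq_square algebra_simps)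
  then have "norm (1 / (x - w)\<^sup>2 - 1 / w\<^sup>2) = norm x * norm (2 * w - x) / (norm w ^ 2 * norm (x - w) ^ 2)"
    by (simp add: norm_mult norm_divide norm_power)
  also have "\<dots> \<le> R * ((2 + K) * norm w) / (norm w ^ 2 * (c * norm w) ^ 2)"
  proof (rule frac_le)
    have "norm (2 * w - x) \<le> (2 + K) * norm w"
      using norm_triangle_ineq4[of "2 * w" x] assms(3) by (simp add: norm_mult algebra_simps)
    then show "norm x * norm (2 * w - x) \<le> R * ((2 + K) * norm w)"
      using assms(2) R by (intro mult_mono) auto
    show "0 \<le> R * ((2 + K) * norm w)" using R K by simp
    show "0 < (norm w)\<^sup>2 * (c * norm w)\<^sup>2" using assms by simp
    show "(norm w)\<^sup>2 * (c * norm w)\<^sup>2 \<le> (norm w)\<^sup>2 * (norm (x - w))\<^sup>2"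
      using assms by (intro mult_left_mono power_mono) auto
  qed
  also have "\<dots> = R * (2 + K) / c\<^sup>2 / norm w ^ 3"
    using assms(1,4) by (simp add: field_simps power2_eq_square power3_eq_cube)
  finally show ?thesis .
qed

section \<open>The Weierstrass function of a lattice\<close>

locale wp_lattice =
  fixes w1 w3 :: complex
  assumes nondegenerate: "Im (w3 / w1) \<noteq> 0"
begin

abbreviation \<Lambda> :: "complex set" where "\<Lambda> \<equiv> period_lattice w1 w3"
abbreviation \<P> :: "complex \<Rightarrow> complex" where "\<P> \<equiv> wp w1 w3"

definition lattice_point :: "int \<times> int \<Rightarrow> complex" where
  "lattice_point = (\<lambda>(i, j). 2 * of_int i * w1 + 2 * of_int j * w3)"

lemma lattice_eq: "\<Lambda> = range lattice_point"
  unfolding period_lattice_def lattice_point_def by force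

lemma w1_nz: "w1 \<noteq> 0"
  using nondegenerate by auto

lemma combination_lower_bound:
  "\<exists>c>0. \<forall>x y::real. c * max \<bar>x\<bar> \<bar>y\<bar> \<le> norm (of_real x * w1 + of_real y * w3)"
proof -
  define \<tau> where "\<tau> = w3 / w1"
  define K where "K = 1 + (norm \<tau> + 1) / \<bar>Im \<tau>\<bar>"
  have K: "K > 0"
    unfolding K_def by (rule add_pos_nonneg) auto
  have "(norm w1 / K) * max \<bar>x\<bar> \<bar>y\<bar> \<le> norm (of_real x * w1 + of_real y * w3)" for x y :: real
  proof -
    have "max \<bar>x\<bar> \<bar>y\<bar> \<le> K * norm (of_real x + of_real y * \<tau>)"
      unfolding K_def \<tau>_def using max_le_norm_combination[OF nondegenerate] .
    then have "norm w1 * max \<bar>x\<bar> \<bar>y\<bar> \<le> norm w1 * (K * norm (of_real x + of_real y * \<tau>))"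
      by (rule mult_left_mono) simp
    also have "\<dots> = K * norm (w1 * (of_real x + of_real y * \<tau>))"
      by (simp add: norm_mult mult_ac)
    also have "w1 * (of_real x + of_real y * \<tau>) = of_real x * w1 + of_real y * w3"
      using w1_nz by (simp add: \<tau>_def field_simps)
    finally show ?thesis using K by (simp add: field_simps)
  qed
  moreover have "norm w1 / K > 0" using K w1_nz by simp
  ultimately show ?thesis by blast
qed

lemma combination_eq_0_iff:
  "of_real x * w1 + of_real y * w3 = 0 \<longleftrightarrow> x = 0 \<and> y = 0"
proof
  assume eq: "of_real x * w1 + of_real y * w3 = 0"
  obtain c where "c > 0" "c * max \<bar>x\<bar> \<bar>y\<bar> \<le> norm (of_real x * w1 + of_real y * w3)"
    using combination_lower_bound by blast
  then have "max \<bar>x\<bar> \<bar>y\<bar> \<le> 0" using eq by (simp add: mult_le_0_iff)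
  then show "x = 0 \<and> y = 0" by auto
qed simp

lemma lattice_point_lower_bound:
  "\<exists>c>0. \<forall>p. c * real_of_int (max \<bar>fst p\<bar> \<bar>snd p\<bar>) \<le> norm (lattice_point p)"
proof -
  obtain c where c: "c > 0" "\<And>x y::real. c * max \<bar>x\<bar> \<bar>y\<bar> \<le> norm (of_real x * w1 + of_real y * w3)"
    using combination_lower_bound by blast
  have "c * real_of_int (max \<bar>fst p\<bar> \<bar>snd p\<bar>) \<le> norm (lattice_point p)" for p
  proof -
    obtain i j where p: "p = (i, j)" by force
    have "c * max \<bar>2 * real_of_int i\<bar> \<bar>2 * real_of_int j\<bar> \<le> norm (lattice_point p)"
      using c(2)[of "2 * real_of_int i" "2 * real_of_int j"] by (simp add: p lattice_point_def)
    moreover have "c * real_of_int (max \<bar>i\<bar> \<bar>j\<bar>) \<le> c * max \<bar>2 * real_of_int i\<bar> \<bar>2 * real_of_int j\<bar>"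
      using c(1) by (intro mult_left_mono) auto
    ultimately show ?thesis by (simp add: p)
  qed
  with c(1) show ?thesis by blast
qed

lemma lattice_point_eq_0_iff: "lattice_point p = 0 \<longleftrightarrow> p = (0, 0)"
  using combination_eq_0_iff[of "2 * real_of_int (fst p)" "2 * real_of_int (snd p)"]
  by (cases p) (auto simp: lattice_point_def)

lemma lattice_point_diff: "lattice_point p - lattice_point q = lattice_point (p - q)"
  by (cases p; cases q) (simp add: lattice_point_def algebra_simps)

lemma inj_lattice_point: "inj lattice_point"
proof (rule injI)
  fix p q assume "lattice_point p = lattice_point q"
  then have "lattice_point (p - q) = 0" by (simp flip: lattice_point_diff)
  then show "p = q" by (simp add: lattice_point_eq_0_iff flip: zero_prod_def)
qed

lemma zero_in_lattice [simp, intro]: "0 \<in> \<Lambda>"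
  using lattice_point_eq_0_iff[of "(0, 0)"] unfolding lattice_eq by (metis rangeI)

lemma lattice_diff: "x \<in> \<Lambda> \<Longrightarrow> y \<in> \<Lambda> \<Longrightarrow> x - y \<in> \<Lambda>"
  unfolding lattice_eq by (auto simp: lattice_point_diff)

lemma lattice_uminus [simp]: "- x \<in> \<Lambda> \<longleftrightarrow> x \<in> \<Lambda>"
  using lattice_diff[of 0 x] lattice_diff[of 0 "- x"] by auto

lemma lattice_add: "x \<in> \<Lambda> \<Longrightarrow> y \<in> \<Lambda> \<Longrightarrow> x + y \<in> \<Lambda>"
  using lattice_diff[of x "- y"] by simp

lemma lattice_add_right_iff [simp]: "y \<in> \<Lambda> \<Longrightarrow> x + y \<in> \<Lambda> \<longleftrightarrow> x \<in> \<Lambda>"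
  using lattice_add[of x y] lattice_diff[of "x + y" y] by auto

lemma lattice_diff_right_iff [simp]: "y \<in> \<Lambda> \<Longrightarrow> x - y \<in> \<Lambda> \<longleftrightarrow> x \<in> \<Lambda>"
  using lattice_add_right_iff[of "- y" x] by simp

lemma lattice_minus_commute: "x - y \<in> \<Lambda> \<longleftrightarrow> y - x \<in> \<Lambda>"
  using lattice_uminus[of "x - y"] by (simp del: lattice_uminus)

lemma lattice_separation: "\<exists>c>0. \<forall>x\<in>\<Lambda>. x \<noteq> 0 \<longrightarrow> c \<le> norm x"
proof -
  obtain c where c: "c > 0" "\<And>p. c * real_of_int (max \<bar>fst p\<bar> \<bar>snd p\<bar>) \<le> norm (lattice_point p)"
    using lattice_point_lower_bound by blast
  have "c \<le> norm x" if "x \<in> \<Lambda>" "x \<noteq> 0" for x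
  proof -
    from that obtain p where p: "x = lattice_point p" unfolding lattice_eq by auto
    with that have "p \<noteq> (0, 0)" using lattice_point_eq_0_iff by blast
    then have "max \<bar>fst p\<bar> \<bar>snd p\<bar> \<ge> 1" by (cases p) auto
    then have "c * 1 \<le> c * real_of_int (max \<bar>fst p\<bar> \<bar>snd p\<bar>)"
      using c(1) by (intro mult_left_mono) linarith+
    with c(2)[of p] p show ?thesis by simp
  qed
  with c(1) show ?thesis by blast
qed

lemma closed_sub_lattice: "T \<subseteq> \<Lambda> \<Longrightarrow> closed T"
proof -
  assume T: "T \<subseteq> \<Lambda>"
  obtain c where c: "c > 0" "\<And>x. x \<in> \<Lambda> \<Longrightarrow> x \<noteq> 0 \<Longrightarrow> c \<le> norm x"
    using lattice_separation by blast
  show "closed T"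
  proof (rule discrete_imp_closed[OF c(1)], intro ballI impI)
    fix x y assume "x \<in> T" "y \<in> T" "dist y x < c"
    then have "y - x \<in> \<Lambda>" "norm (y - x) < c"
      using T by (auto simp: dist_norm intro: lattice_diff)
    then show "y = x" using c(2)[of "y - x"] by fastforce
  qed
qed

lemma countable_lattice: "countable \<Lambda>"
  unfolding lattice_eq by simp

lemma inverse_cube_summable: "(\<lambda>w. 1 / norm w ^ 3) summable_on \<Lambda> - {0}"
proof -
  obtain c where c: "c > 0" "\<And>p. c * real_of_int (max \<bar>fst p\<bar> \<bar>snd p\<bar>) \<le> norm (lattice_point p)"
    using lattice_point_lower_bound by blast
  have "(\<lambda>w. 1 / norm w ^ 3) summable_on range lattice_point"
  proof (subst summable_on_reindex[OF inj_lattice_point], rule summable_on_comparison_test)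
    show "(\<lambda>p. 1 / c ^ 3 * lattice_weight p) summable_on UNIV"
      by (intro summable_on_cmult_right lattice_weight_summable)
    fix p :: "int \<times> int"
    show "((\<lambda>w. 1 / norm w ^ 3) \<circ> lattice_point) p \<le> 1 / c ^ 3 * lattice_weight p"
    proof (cases "p = (0, 0)")
      case True
      then have "lattice_point p = 0" by (simp add: lattice_point_eq_0_iff)
      then show ?thesis using c(1) by (simp add: True lattice_weight_def)
    next
      case False
      define m where "m = real_of_int (max \<bar>fst p\<bar> \<bar>snd p\<bar>)"
      have m: "m > 0" using False by (cases p) (auto simp: m_def max_def)
      have cm: "c * m \<le> norm (lattice_point p)" "c * m > 0"
        using c m c(2)[of p, folded m_def] by auto
      then have "norm (lattice_point p) > 0" by linarith
      then have "1 / norm (lattice_point p) ^ 3 \<le> 1 / (c * m) ^ 3"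
        using cm zero_less_power[OF cm(2), of 3]
        by (intro divide_left_mono power_mono mult_pos_pos) auto
      then show ?thesis
        by (cases p) (simp add: lattice_weight_def m_def power_mult_distrib)
    qed
  qed auto
  then show ?thesis
    unfolding lattice_eq by (rule summable_on_subset_banach) auto
qed

text \<open>
  The Weierstrass function without its pole at the origin; it is holomorphic there and vanishes there.
\<close>

definition wp_regular :: "complex \<Rightarrow> complex" where
  "wp_regular x = (\<Sum>\<^sub>\<infinity>w\<in>\<Lambda> - {0}. 1 / (x - w)\<^sup>2 - 1 / w\<^sup>2)"

lemma wp_eq: "\<P> x = 1 / x\<^sup>2 + wp_regular x"
  by (simp add: wp_def wp_regular_def)

lemma wp_regular_domination:
  assumes x: "x \<in> - (\<Lambda> - {0})"
  shows "\<exists>r>0. \<exists>M. M summable_on \<Lambda> - {0} \<and> cball x r \<subseteq> - (\<Lambda> - {0}) \<and>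
      (\<forall>w\<in>\<Lambda> - {0}. \<forall>y\<in>cball x r. norm (1 / (y - w)\<^sup>2 - 1 / w\<^sup>2) \<le> M w)"
proof -
  have "open (- (\<Lambda> - {0}))"
    by (intro open_Compl closed_sub_lattice) auto
  then obtain r' where r': "r' > 0" "cball x r' \<subseteq> - (\<Lambda> - {0})"
    using x open_contains_cball by blast
  obtain s where s: "s > 0" "\<And>x. x \<in> \<Lambda> \<Longrightarrow> x \<noteq> 0 \<Longrightarrow> s \<le> norm x"
    using lattice_separation by blast
  define r where "r = r' / 2"
  have r: "r > 0" "cball x r \<subseteq> - (\<Lambda> - {0})"
    using r' subset_cball[of r r' x] by (auto simp: r_def)
  define R where "R = norm x + r"
  \<comment> \<open>For \<open>norm w \<ge> 2 R\<close> the bound \<open>norm (y - w) \<ge> norm w / 2\<close> holds; the other \<open>w\<close> are at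
      distance at least \<open>r\<close> from \<open>y\<close> and have norm less than \<open>2 R\<close>.\<close>
  define c where "c = min (1 / 2) (r / (2 * R))"
  have R: "R > 0" using r by (simp add: R_def add_nonneg_pos)
  have c: "c > 0" using r R by (simp add: c_def)
  have "norm (1 / (y - w)\<^sup>2 - 1 / w\<^sup>2) \<le> R * (2 + R / s) / c\<^sup>2 * (1 / norm w ^ 3)"
    if w: "w \<in> \<Lambda> - {0}" and y: "y \<in> cball x r" for w y
  proof -
    have yR: "norm y \<le> R"
      using y norm_triangle_ineq4[of x "x - y"] by (simp add: R_def dist_norm)
    have sw: "s \<le> norm w" using s(2) w by auto
    have "norm y \<le> R / s * norm w"
      using yR mult_left_mono[OF sw, of "R / s"] R s by simp
    moreover have "c * norm w \<le> norm (y - w)"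
    proof (cases "norm w \<ge> 2 * R")
      case True
      have "c * norm w \<le> 1 / 2 * norm w" by (intro mult_right_mono) (auto simp: c_def)
      also have "\<dots> \<le> norm w - R" using True by simp
      also have "\<dots> \<le> norm (y - w)"
        using yR norm_triangle_ineq2[of w y] by (simp add: norm_minus_commute)
      finally show ?thesis .
    next
      case False
      have "w \<notin> cball x r'" using r' w by blast
      then have "dist x w > r'" by simp
      moreover have "dist x y \<le> r" using y by simp
      ultimately have "r \<le> dist y w"
        using dist_triangle[of x w y] r'(1) by (simp add: r_def)
      have "c * norm w \<le> r / (2 * R) * (2 * R)"
        using False c R r by (intro mult_mono) (auto simp: c_def)
      also have "\<dots> = r" using R by simp
      also have "\<dots> \<le> norm (y - w)" using \<open>r \<le> dist y w\<close> by (simp add: dist_norm)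
      finally show ?thesis .
    qed
    ultimately show ?thesis
      using wp_term_bound[of w y R "R / s" c] w yR c by simp
  qed
  moreover have "(\<lambda>w. R * (2 + R / s) / c\<^sup>2 * (1 / norm w ^ 3)) summable_on \<Lambda> - {0}"
    by (intro summable_on_cmult_right inverse_cube_summable)
  ultimately show ?thesis using r by blast
qed

lemma wp_regular_holomorphic: "wp_regular holomorphic_on - (\<Lambda> - {0})"
  and wp_regular_deriv: "x \<notin> \<Lambda> - {0} \<Longrightarrow>
    ((\<lambda>w. - 2 / (x - w) ^ 3) has_sum deriv wp_regular x) (\<Lambda> - {0})"
proof -
  have op: "open (- (\<Lambda> - {0}))"
    by (intro open_Compl closed_sub_lattice) auto
  have hol: "(\<lambda>x. 1 / (x - w)\<^sup>2 - 1 / w\<^sup>2) holomorphic_on - (\<Lambda> - {0})" if "w \<in> \<Lambda> - {0}" for w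
    by (intro holomorphic_intros) (use that in auto)
  note H = infsum_holomorphic[OF op hol wp_regular_domination, folded wp_regular_def[abs_def]]
  show "wp_regular holomorphic_on - (\<Lambda> - {0})"
    by (rule H(1))
  show "((\<lambda>w. - 2 / (x - w) ^ 3) has_sum deriv wp_regular x) (\<Lambda> - {0})" if "x \<notin> \<Lambda> - {0}"
  proof -
    have s: "((\<lambda>w. deriv (\<lambda>x. 1 / (x - w)\<^sup>2 - 1 / w\<^sup>2) x) has_sum deriv wp_regular x) (\<Lambda> - {0})"
      by (rule H(2)) (use that in auto)
    have eq: "deriv (\<lambda>x. 1 / (x - w)\<^sup>2 - 1 / w\<^sup>2) x = - 2 / (x - w) ^ 3" if "w \<in> \<Lambda> - {0}" for w
    proof (rule DERIV_imp_deriv)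
      have "x - w \<noteq> 0" using that \<open>x \<notin> \<Lambda> - {0}\<close> by auto
      then have "((\<lambda>x. 1 / (x - w)\<^sup>2) has_field_derivative - 2 / (x - w) ^ 3) (at x)"
        by (auto intro!: derivative_eq_intros simp: power2_eq_square power3_eq_cube divide_simps)
      from DERIV_diff[OF this DERIV_const]
      show "((\<lambda>x. 1 / (x - w)\<^sup>2 - 1 / w\<^sup>2) has_field_derivative - 2 / (x - w) ^ 3) (at x)"
        by simp
    qed
    show ?thesis
      by (rule has_sum_cong[THEN iffD1, OF eq s])
  qed
qed

lemma open_off_lattice: "open (- \<Lambda>)"
  by (intro open_Compl closed_sub_lattice) auto

lemma connected_off_lattice: "connected (- \<Lambda>)"
  using path_connected_complement_countable[OF _ countable_lattice]
  by (simp add: path_connected_imp_connected)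

lemma wp_holomorphic: "\<P> holomorphic_on - \<Lambda>"
proof -
  have "(\<lambda>x. 1 / x\<^sup>2 + wp_regular x) holomorphic_on - \<Lambda>"
    by (intro holomorphic_intros holomorphic_on_subset[OF wp_regular_holomorphic]) auto
  then show ?thesis by (simp add: wp_eq[abs_def])
qed

lemma wp_has_deriv: "x \<notin> \<Lambda> \<Longrightarrow> (\<P> has_field_derivative deriv \<P> x) (at x)"
  using wp_holomorphic open_off_lattice by (intro holomorphic_derivI[of _ "- \<Lambda>"]) auto

lemma deriv_wp_has_sum:
  assumes "x \<notin> \<Lambda>"
  shows "((\<lambda>w. - 2 / (x - w) ^ 3) has_sum deriv \<P> x) \<Lambda>"
proof -
  have x0: "x \<noteq> 0" using assms by auto
  have op: "open (- (\<Lambda> - {0}))"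
    by (intro open_Compl closed_sub_lattice) auto
  have "(wp_regular has_field_derivative deriv wp_regular x) (at x)"
    by (rule holomorphic_derivI[OF wp_regular_holomorphic op]) (use assms in auto)
  moreover have "((\<lambda>x. 1 / x\<^sup>2) has_field_derivative - 2 / x ^ 3) (at x)"
    using x0 by (auto intro!: derivative_eq_intros simp: power2_eq_square power3_eq_cube divide_simps)
  ultimately have "((\<lambda>x. 1 / x\<^sup>2 + wp_regular x) has_field_derivative - 2 / x ^ 3 + deriv wp_regular x) (at x)"
    by (intro DERIV_add)
  then have d: "deriv \<P> x = - 2 / (x - 0) ^ 3 + deriv wp_regular x"
    by (simp add: wp_eq[abs_def] DERIV_imp_deriv)
  have "((\<lambda>w. - 2 / (x - w) ^ 3) has_sum - 2 / (x - 0) ^ 3 + deriv wp_regular x) (insert 0 (\<Lambda> - {0}))"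
    by (rule has_sum_insert) (use wp_regular_deriv[of x] assms in auto)
  then show ?thesis
    by (simp add: d insert_absorb)
qed

lemma wp_regular_even: "wp_regular (- x) = wp_regular x"
  unfolding wp_regular_def
  by (rule infsum_reindex_bij_witness[where i = uminus and j = uminus])
     (auto simp: power2_eq_square algebra_simps)

lemma wp_even: "\<P> (- x) = \<P> x"
  by (simp add: wp_eq wp_regular_even)

lemma wp_regular_0: "wp_regular 0 = 0"
  unfolding wp_regular_def by (simp add: infsum_0)

text \<open>
  The sum for the derivative converges absolutely over the whole lattice, so a translation of the
  summation index is allowed. For \<open>\<wp>\<close> itself this is not possible directly.
\<close>

lemma deriv_wp_periodic:
  assumes "\<omega> \<in> \<Lambda>" "x \<notin> \<Lambda>"
  shows "deriv \<P> (x + \<omega>) = deriv \<P> x"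
proof -
  have "((\<lambda>w. - 2 / (x + \<omega> - w) ^ 3) has_sum deriv \<P> (x + \<omega>)) \<Lambda>"
    using assms by (intro deriv_wp_has_sum) simp
  also have "?this \<longleftrightarrow> ((\<lambda>w. - 2 / (x - w) ^ 3) has_sum deriv \<P> (x + \<omega>)) \<Lambda>"
    by (rule has_sum_reindex_bij_witness[where i = "\<lambda>w. w + \<omega>" and j = "\<lambda>w. w - \<omega>"])
       (use assms in \<open>auto simp: algebra_simps\<close>)
  finally show ?thesis
    using deriv_wp_has_sum[OF assms(2)] by (rule has_sum_unique)
qed

text \<open>
  By periodicity of the derivative, \<open>\<wp> (x + \<omega>) - \<wp> x\<close> is a constant \<open>c\<close>. The substitution of \<open>- x - \<omega>\<close> for
  \<open>x\<close> and evenness give \<open>c = - c\<close>.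
\<close>

lemma wp_periodic:
  assumes w: "\<omega> \<in> \<Lambda>" and x: "x \<notin> \<Lambda>"
  shows "\<P> (x + \<omega>) = \<P> x"
proof -
  have "(\<lambda>x. \<P> (x + \<omega>) - \<P> x) constant_on - \<Lambda>"
  proof (rule has_field_derivative_0_imp_constant_on[OF _ connected_off_lattice open_off_lattice])
    fix x assume "x \<in> - \<Lambda>"
    then have x: "x \<notin> \<Lambda>" "x + \<omega> \<notin> \<Lambda>" using w by auto
    have "((\<lambda>x. \<P> (x + \<omega>)) has_field_derivative deriv \<P> (x + \<omega>)) (at x)"
      using wp_has_deriv[OF x(2)] by (simp add: DERIV_shift)
    from DERIV_diff[OF this wp_has_deriv[OF x(1)]]
    show "((\<lambda>x. \<P> (x + \<omega>) - \<P> x) has_field_derivative 0) (at x)"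
      by (simp add: deriv_wp_periodic[OF w x(1)])
  qed
  then obtain c where c: "\<And>x. x \<notin> \<Lambda> \<Longrightarrow> \<P> (x + \<omega>) - \<P> x = c"
    unfolding constant_on_def by auto
  have "- x - \<omega> \<notin> \<Lambda>" using w x by simp
  from c[OF this] have "\<P> (- x) - \<P> (- (x + \<omega>)) = c" by simp
  then have "\<P> x - \<P> (x + \<omega>) = c" unfolding wp_even .
  with c[OF x] have "c = - c" by (metis minus_diff_eq)
  then have "c = 0" by simp
  with c[OF x] show ?thesis by simp
qed

end

section \<open>Local lemmas on holomorphic functions\<close>

lemma tendsto_at_holomorphic:
  assumes "g holomorphic_on ball p r" "r > 0" "\<And>x. x \<in> ball p r \<Longrightarrow> x \<noteq> p \<Longrightarrow> f x = g x"
  shows "(f \<longlongrightarrow> g p) (at p)"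
proof (rule Lim_transform_within_open[of g _ _ _ "ball p r"])
  have "isCont g p"
    using assms(1,2) holomorphic_on_imp_continuous_on[of g "ball p r"]
    by (simp add: continuous_on_eq_continuous_at)
  then show "g \<midarrow>p\<rightarrow> g p" by (simp add: isCont_def)
qed (use assms in auto)

lemma DERIV_uminus_arg:
  fixes h :: "complex \<Rightarrow> complex"
  assumes "(h has_field_derivative D) (at (- x))"
  shows "((\<lambda>x. h (- x)) has_field_derivative - D) (at x)"
proof -
  have "((\<lambda>x. h (uminus x)) has_field_derivative D * (- 1)) (at x)"
    by (rule DERIV_chain2[where f = h and g = uminus, OF assms]) (auto intro!: derivative_eq_intros)
  then show ?thesis by simp
qed

lemma second_deriv_square_factor:
  fixes h k :: "complex \<Rightarrow> complex"
  assumes U: "open U" "p \<in> U" and k: "k holomorphic_on U"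
    and h: "\<And>x. x \<in> U \<Longrightarrow> h x = c + (x - p)\<^sup>2 * k x"
  shows "deriv (deriv h) p = 2 * k p"
proof -
  have k1: "(k has_field_derivative deriv k x) (at x)" if "x \<in> U" for x
    using holomorphic_derivI[OF k U(1) that] .
  have k2: "(deriv k has_field_derivative deriv (deriv k) p) (at p)"
    using holomorphic_derivI[OF holomorphic_deriv[OF k U(1)] U] .
  have d: "deriv h x = 2 * (x - p) * k x + (x - p)\<^sup>2 * deriv k x" if x: "x \<in> U" for x
  proof -
    have "((\<lambda>x. c + (x - p)\<^sup>2 * k x) has_field_derivative 2 * (x - p) * k x + (x - p)\<^sup>2 * deriv k x) (at x)"
      by (rule derivative_eq_intros k1[OF x] refl)+ simp
    then have "(h has_field_derivative 2 * (x - p) * k x + (x - p)\<^sup>2 * deriv k x) (at x)"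
      by (rule has_field_derivative_transform_within_open[OF _ U(1) x]) (simp add: h)
    then show ?thesis by (rule DERIV_imp_deriv)
  qed
  have "((\<lambda>x. 2 * (x - p) * k x + (x - p)\<^sup>2 * deriv k x) has_field_derivative 2 * k p) (at p)"
    by (rule derivative_eq_intros k1[OF U(2)] k2 refl)+ simp
  then have "(deriv h has_field_derivative 2 * k p) (at p)"
    by (rule has_field_derivative_transform_within_open[OF _ U]) (simp add: d)
  then show ?thesis by (rule DERIV_imp_deriv)
qed

text \<open>
  The Taylor expansion of an even function contains even powers only. One application removes the
  constant term; the quotient is even again, so that the lemma can be iterated.
\<close>

lemma even_holomorphic_factor:
  fixes h :: "complex \<Rightarrow> complex"
  assumes h: "h holomorphic_on ball 0 r" "r > 0" and even: "\<And>x. x \<in> ball 0 r \<Longrightarrow> h (- x) = h x"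
  obtains k where "k holomorphic_on ball 0 r" "\<And>x. x \<in> ball 0 r \<Longrightarrow> k (- x) = k x"
    "\<And>x. x \<in> ball 0 r \<Longrightarrow> h x = h 0 + x\<^sup>2 * k x" "deriv (deriv h) 0 = 2 * k 0"
proof -
  \<comment> \<open>Divide by \<open>x\<close> twice; the first quotient vanishes at \<open>0\<close> because \<open>h\<close> is even.\<close>
  define k1 where "k1 = (\<lambda>x. if x = 0 then deriv h 0 else (h x - h 0) / (x - 0))"
  define k where "k = (\<lambda>x. if x = 0 then deriv k1 0 else (k1 x - k1 0) / (x - 0))"
  have k1h: "k1 holomorphic_on ball 0 r"
    unfolding k1_def by (rule pole_lemma_open[OF h(1) open_ball])
  have kh: "k holomorphic_on ball 0 r"
    unfolding k_def by (rule pole_lemma_open[OF k1h open_ball])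
  have "(h has_field_derivative deriv h 0) (at (- 0))"
    using holomorphic_derivI[OF h(1) open_ball, of 0] h(2) by simp
  then have "((\<lambda>x. h (- x)) has_field_derivative - deriv h 0) (at 0)"
    by (rule DERIV_uminus_arg)
  then have "(h has_field_derivative - deriv h 0) (at 0)"
    by (rule has_field_derivative_transform_within_open[OF _ open_ball, of _ _ _ 0 r])
       (use h(2) even in auto)
  then have "deriv h 0 = - deriv h 0"
    using DERIV_imp_deriv by blast
  then have k10: "k1 0 = 0" by (simp add: k1_def)
  have fac: "h x = h 0 + x\<^sup>2 * k x" for x
    by (cases "x = 0") (auto simp: k_def k10, auto simp: k1_def power2_eq_square)
  show ?thesis
  proof
    show "k holomorphic_on ball 0 r" by (rule kh)
    show "k (- x) = k x" if "x \<in> ball 0 r" for x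
    proof (cases "x = 0")
      case False
      have "h 0 + x\<^sup>2 * k (- x) = h (- x)" by (subst fac[of "- x"]) simp
      also have "\<dots> = h x" by (rule even[OF that])
      also have "\<dots> = h 0 + x\<^sup>2 * k x" by (rule fac)
      finally show ?thesis using False by simp
    qed simp
    show "deriv (deriv h) 0 = 2 * k 0"
    proof (rule second_deriv_square_factor[OF open_ball _ kh, where c = "h 0"])
      show "h x = h 0 + (x - 0)\<^sup>2 * k x" for x
        using fac[of x] by (simp only: diff_zero)
    qed (use h(2) in simp)
  qed (rule fac)
qed

text \<open>
  If a product vanishes on an open set and the first factor vanishes on no open subset, then the
  second factor vanishes, provided that it is continuous.
\<close>

lemma zero_factor:
  fixes t b :: "complex \<Rightarrow> complex"
  assumes "open U" "continuous_on U b" "\<And>y. y \<in> U \<Longrightarrow> t y * b y = 0"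
    and "\<And>V. open V \<Longrightarrow> V \<noteq> {} \<Longrightarrow> V \<subseteq> U \<Longrightarrow> \<exists>y\<in>V. t y \<noteq> 0" and "y \<in> U"
  shows "b y = 0"
proof (rule ccontr)
  assume "b y \<noteq> 0"
  define V where "V = U \<inter> b -` (- {0})"
  have "open V"
    unfolding V_def by (rule continuous_open_preimage[OF assms(2,1)]) auto
  moreover have "V \<noteq> {}" using assms(5) \<open>b y \<noteq> 0\<close> by (auto simp: V_def)
  ultimately obtain y' where "y' \<in> V" "t y' \<noteq> 0" using assms(4)[of V] by (auto simp: V_def)
  with assms(3)[of y'] show False by (auto simp: V_def)
qed

section \<open>Elliptic functions without poles are constant\<close>

context wp_lattice
begin

text \<open>
  The points that are congruent to a point of \<open>K\<close> modulo the lattice.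
\<close>

definition congruent_to :: "complex set \<Rightarrow> complex set" where
  "congruent_to K = {x. \<exists>p\<in>K. x - p \<in> \<Lambda>}"

lemma closed_sub_congruent:
  assumes "finite K" "T \<subseteq> congruent_to K"
  shows "closed T"
proof -
  have "T = (\<Union>p\<in>K. (+) p ` {\<omega>\<in>\<Lambda>. p + \<omega> \<in> T})" (is "_ = ?R")
  proof
    show "T \<subseteq> ?R"
    proof
      fix x assume x: "x \<in> T"
      then obtain p where "p \<in> K" "x - p \<in> \<Lambda>" using assms(2) by (auto simp: congruent_to_def)
      with x show "x \<in> ?R" by (auto intro!: bexI[of _ p] image_eqI[of _ _ "x - p"])
    qed
  qed auto
  moreover have "closed ?R"
    by (intro closed_UN assms(1) closed_translation ballI closed_sub_lattice) auto
  ultimately show ?thesis by simp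
qed

lemma congruent_isolated:
  assumes "finite K"
  obtains r where "r > 0" "\<And>x. x \<in> ball z r \<Longrightarrow> x \<noteq> z \<Longrightarrow> x \<notin> congruent_to K"
proof -
  have "open (- (congruent_to K - {z}))"
    by (intro open_Compl closed_sub_congruent[OF assms]) auto
  then obtain r where "r > 0" "ball z r \<subseteq> - (congruent_to K - {z})"
    using open_contains_ball by blast
  then show ?thesis by (intro that[of r]) auto
qed

lemma congruent_add_iff: "\<omega> \<in> \<Lambda> \<Longrightarrow> x + \<omega> \<in> congruent_to K \<longleftrightarrow> x \<in> congruent_to K"
  unfolding congruent_to_def
  using lattice_add_right_iff[of \<omega> "x - p" for p] by (simp add: algebra_simps)

lemma real_coordinates: "\<exists>s t::real. x = of_real s * (2 * w1) + of_real t * (2 * w3)"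
proof -
  define \<tau> y where "\<tau> = w3 / w1" and "y = x / (2 * w1)"
  define t where "t = Im y / Im \<tau>"
  define s where "s = Re y - t * Re \<tau>"
  have "Im \<tau> \<noteq> 0" using nondegenerate by (simp add: \<tau>_def)
  then have "y = of_real s + of_real t * \<tau>"
    by (intro complex_eqI) (auto simp: s_def t_def)
  then have "2 * w1 * y = of_real s * (2 * w1) + of_real t * (2 * (w1 * \<tau>))"
    by (simp add: algebra_simps)
  moreover have "2 * w1 * y = x" "w1 * \<tau> = w3"
    using w1_nz by (auto simp: y_def \<tau>_def)
  ultimately show ?thesis by metis
qed

lemma fundamental_domain:
  obtains Q where "compact Q" "\<And>x. \<exists>\<omega>\<in>\<Lambda>. x - \<omega> \<in> Q"
proof -
  define Q where "Q = (\<lambda>(s, t). complex_of_real s * (2 * w1) + of_real t * (2 * w3)) ` ({0..1} \<times> {0..1})"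
  have "compact Q"
    unfolding Q_def
    by (intro compact_continuous_image compact_Times)
       (auto simp: case_prod_unfold intro!: continuous_intros)
  moreover have "\<exists>\<omega>\<in>\<Lambda>. x - \<omega> \<in> Q" for x
  proof -
    obtain s t where x: "x = of_real s * (2 * w1) + of_real t * (2 * w3)"
      using real_coordinates by blast
    define \<omega> where "\<omega> = lattice_point (\<lfloor>s\<rfloor>, \<lfloor>t\<rfloor>)"
    have "x - \<omega> = of_real (frac s) * (2 * w1) + of_real (frac t) * (2 * w3)"
      by (simp add: x \<omega>_def lattice_point_def frac_def algebra_simps)
    moreover have "frac s \<in> {0..1}" "frac t \<in> {0..1}"
      by (auto intro: less_imp_le frac_lt_1)
    ultimately have "x - \<omega> \<in> Q"
      unfolding Q_def by (intro image_eqI[of _ _ "(frac s, frac t)"]) auto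
    moreover have "\<omega> \<in> \<Lambda>" unfolding lattice_eq \<omega>_def by simp
    ultimately show ?thesis by blast
  qed
  ultimately show ?thesis using that by blast
qed

text \<open>
  Limits at the points of \<open>K\<close> give limits at all congruent points, so all singularities are removable.
  The extended function is entire, and it is bounded because the values on the compact fundamental
  parallelogram exhaust all values outside \<open>congruent_to K\<close>.
\<close>

lemma elliptic_without_poles_constant:
  assumes K: "finite K" and hol: "f holomorphic_on - congruent_to K"
    and per: "\<And>x \<omega>. x \<notin> congruent_to K \<Longrightarrow> \<omega> \<in> \<Lambda> \<Longrightarrow> f (x + \<omega>) = f x"
    and lim: "\<And>p. p \<in> K \<Longrightarrow> \<exists>l. (f \<longlongrightarrow> l) (at p)"
  obtains c where "\<And>x. x \<notin> congruent_to K \<Longrightarrow> f x = c"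
proof -
  define P where "P = congruent_to K"
  have clP: "closed P" unfolding P_def by (rule closed_sub_congruent[OF K order_refl])
  have lim': "\<exists>l. (f \<longlongrightarrow> l) (at z)" if z: "z \<in> P" for z
  proof -
    from z obtain p where p: "p \<in> K" "z - p \<in> \<Lambda>" by (auto simp: P_def congruent_to_def)
    obtain l where "(f \<longlongrightarrow> l) (at p)" using lim[OF p(1)] by blast
    then have "((\<lambda>x. f (x + (p - z))) \<longlongrightarrow> l) (at (p - (p - z)))"
      by (rule LIM_offset)
    then have "((\<lambda>x. f (x + (p - z))) \<longlongrightarrow> l) (at z)"
      by simp
    moreover obtain r where r: "r > 0" "\<And>x. x \<in> ball z r \<Longrightarrow> x \<noteq> z \<Longrightarrow> x \<notin> congruent_to K"
      using congruent_isolated[OF K] by blast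
    have "p - z \<in> \<Lambda>" using p(2) lattice_minus_commute by blast
    then have "f (x + (p - z)) = f x" if "x \<in> ball z r" "x \<noteq> z" for x
      using per r(2)[OF that] by blast
    ultimately have "(f \<longlongrightarrow> l) (at z)"
      using r(1) by (intro Lim_transform_within_open[of "\<lambda>x. f (x + (p - z))" l z UNIV "ball z r" f]) auto
    then show ?thesis by blast
  qed
  define g where "g = (\<lambda>x. if x \<in> P then Lim (at x) f else f x)"
  have glim: "(f \<longlongrightarrow> g z) (at z)" if z: "z \<in> P" for z
    using lim'[OF z] z tendsto_Lim[of "at z" f] by (auto simp: g_def)
  have "g holomorphic_on UNIV"
  proof -
    have "\<exists>D. (g has_field_derivative D) (at z)" for z
    proof (cases "z \<in> P")
      case False
      have "open (- P)" using clP by auto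
      then have "(f has_field_derivative deriv f z) (at z)"
        using hol False unfolding P_def by (intro holomorphic_derivI[of f "- congruent_to K"]) auto
      then have "(g has_field_derivative deriv f z) (at z)"
        by (rule has_field_derivative_transform_within_open[OF _ \<open>open (- P)\<close>])
           (use False in \<open>auto simp: g_def\<close>)
      then show ?thesis by blast
    next
      case True
      obtain r where r: "r > 0" "\<And>x. x \<in> ball z r \<Longrightarrow> x \<noteq> z \<Longrightarrow> x \<notin> congruent_to K"
        using congruent_isolated[OF K] by blast
      have "f holomorphic_on ball z r - {z}"
        by (rule holomorphic_on_subset[OF hol]) (use r in auto)
      then have "(\<lambda>y. if y = z then g z else f y) holomorphic_on ball z r"
        by (rule removable_singularity) (auto intro: glim True)
      then have "g holomorphic_on ball z r"
        by (rule holomorphic_transform) (use r(2) in \<open>auto simp: g_def P_def\<close>)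
      then show ?thesis
        using holomorphic_derivI[of g "ball z r" z] r(1) by auto
    qed
    then show ?thesis by (simp add: holomorphic_on_open)
  qed
  moreover have "bounded (range g)"
  proof -
    obtain Q where Q: "compact Q" "\<And>x. \<exists>\<omega>\<in>\<Lambda>. x - \<omega> \<in> Q"
      using fundamental_domain by blast
    have "compact (g ` Q)"
      using \<open>g holomorphic_on UNIV\<close> Q(1)
      by (meson compact_continuous_image continuous_on_subset holomorphic_on_imp_continuous_on subset_UNIV)
    then obtain B where B: "\<And>x. x \<in> Q \<Longrightarrow> norm (g x) \<le> B"
      using compact_imp_bounded bounded_iff by (metis imageI)
    have f: "norm (f x) \<le> B" if "x \<notin> P" for x
    proof -
      from Q(2) obtain \<omega> where w: "\<omega> \<in> \<Lambda>" "x - \<omega> \<in> Q" by blast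
      then have "x - \<omega> \<notin> P"
        using congruent_add_iff[of "- \<omega>" x K] that by (simp add: P_def)
      then have "f x = g (x - \<omega>)"
        using per[of "x - \<omega>" \<omega>] w by (simp add: g_def P_def)
      with B[OF w(2)] show ?thesis by simp
    qed
    have "norm (g z) \<le> B" for z
    proof (cases "z \<in> P")
      case True
      obtain r where r: "r > 0" "\<And>x. x \<in> ball z r \<Longrightarrow> x \<noteq> z \<Longrightarrow> x \<notin> congruent_to K"
        using congruent_isolated[OF K] by blast
      show ?thesis
      proof (rule tendsto_upperbound[OF tendsto_norm[OF glim[OF True]]])
        show "\<forall>\<^sub>F x in at z. norm (f x) \<le> B"
          unfolding eventually_at using r f by (auto simp: P_def dist_commute intro!: exI[of _ r])
      qed simp
    qed (simp add: g_def f)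
    then show ?thesis unfolding bounded_iff by blast
  qed
  ultimately obtain c where "\<And>x. g x = c"
    using Liouville_theorem by (metis constant_on_def UNIV_I)
  then show ?thesis
    by (intro that[of c]) (metis g_def P_def)
qed

section \<open>The differential equations of the Weierstrass function\<close>

lemma lattice_free_ball:
  assumes "z \<notin> \<Lambda>"
  obtains r where "r > 0" "ball z r \<inter> \<Lambda> = {}"
  using open_off_lattice assms open_contains_ball[of "- \<Lambda>"] by blast

lemma lattice_ball_0:
  obtains r where "r > 0" "ball 0 r \<inter> \<Lambda> = {0}"
proof -
  obtain c where c: "c > 0" "\<And>x. x \<in> \<Lambda> \<Longrightarrow> x \<noteq> 0 \<Longrightarrow> c \<le> norm x"
    using lattice_separation by blast
  then show ?thesis by (intro that[of c]) force+
qed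

lemma wp_regular_holomorphic_ball: "ball 0 r \<inter> \<Lambda> = {0} \<Longrightarrow> wp_regular holomorphic_on ball 0 r"
  by (rule holomorphic_on_subset[OF wp_regular_holomorphic]) auto

lemma wp_regular_expansion:
  assumes "ball 0 r \<inter> \<Lambda> = {0}" "r > 0"
  obtains B where "B holomorphic_on ball 0 r" "\<And>x. x \<in> ball 0 r \<Longrightarrow> wp_regular x = x\<^sup>2 * B x"
proof -
  obtain B where B: "B holomorphic_on ball 0 r"
    "\<And>x. x \<in> ball 0 r \<Longrightarrow> wp_regular x = wp_regular 0 + x\<^sup>2 * B x"
    using even_holomorphic_factor[OF wp_regular_holomorphic_ball[OF assms(1)] assms(2)] wp_regular_even
    by (metis (no_types, lifting))
  show ?thesis
  proof (rule that[OF B(1)])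
    show "wp_regular x = x\<^sup>2 * B x" if "x \<in> ball 0 r" for x
      by (subst B(2)[OF that]) (simp add: wp_regular_0)
  qed
qed

lemma wp_not_locally_constant:
  assumes "open V" "V \<noteq> {}" "V \<subseteq> - \<Lambda>"
  shows "\<exists>y\<in>V. \<P> y \<noteq> c"
proof (rule ccontr)
  assume "\<not> (\<exists>y\<in>V. \<P> y \<noteq> c)"
  then have V: "\<And>y. y \<in> V \<Longrightarrow> \<P> y = c" by blast
  have all: "\<P> x = c" if "x \<in> - \<Lambda>" for x
    by (rule analytic_continuation_open[OF assms(1) open_off_lattice assms(2) connected_off_lattice
          assms(3) wp_holomorphic holomorphic_on_const V that])
  obtain r where r: "r > 0" "ball 0 r \<inter> \<Lambda> = {0}" using lattice_ball_0 by blast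
  have "((\<lambda>x. 1::complex) \<longlongrightarrow> 0\<^sup>2 * (c - wp_regular 0)) (at (0::complex))"
  proof (rule tendsto_at_holomorphic[OF _ r(1), where g = "\<lambda>x. x\<^sup>2 * (c - wp_regular x)"])
    show "(\<lambda>x. x\<^sup>2 * (c - wp_regular x)) holomorphic_on ball 0 r"
      by (intro holomorphic_intros wp_regular_holomorphic_ball r)
    fix x :: complex assume "x \<in> ball 0 r" "x \<noteq> 0"
    then have "x \<notin> \<Lambda>" using r(2) by blast
    then have "1 / x\<^sup>2 + wp_regular x = c" using all[of x] by (simp add: wp_eq)
    then show "1 = x\<^sup>2 * (c - wp_regular x)"
      using \<open>x \<noteq> 0\<close> by (auto simp: field_simps)
  qed
  then have "(1::complex) = 0"
    using LIM_const_eq by fastforce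
  then show False by simp
qed

lemma deriv_wp_holomorphic: "deriv \<P> holomorphic_on - \<Lambda>"
  and deriv2_wp_holomorphic: "deriv (deriv \<P>) holomorphic_on - \<Lambda>"
  by (intro holomorphic_deriv wp_holomorphic open_off_lattice)+

lemma deriv_wp_has_deriv: "x \<notin> \<Lambda> \<Longrightarrow> (deriv \<P> has_field_derivative deriv (deriv \<P>) x) (at x)"
  using deriv_wp_holomorphic open_off_lattice by (intro holomorphic_derivI[of _ "- \<Lambda>"]) auto

lemma deriv2_wp_periodic:
  assumes "\<omega> \<in> \<Lambda>" "x \<notin> \<Lambda>"
  shows "deriv (deriv \<P>) (x + \<omega>) = deriv (deriv \<P>) x"
proof -
  have "((\<lambda>x. deriv \<P> (x + \<omega>)) has_field_derivative deriv (deriv \<P>) (x + \<omega>)) (at x)"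
    using deriv_wp_has_deriv[of "x + \<omega>"] assms by (simp add: DERIV_shift)
  then have "(deriv \<P> has_field_derivative deriv (deriv \<P>) (x + \<omega>)) (at x)"
    by (rule has_field_derivative_transform_within_open[OF _ open_off_lattice])
       (use assms in \<open>auto simp: deriv_wp_periodic\<close>)
  then show ?thesis by (simp add: DERIV_imp_deriv)
qed

lemma deriv_wp_odd: "x \<notin> \<Lambda> \<Longrightarrow> deriv \<P> (- x) = - deriv \<P> x"
proof -
  assume "x \<notin> \<Lambda>"
  then have "((\<lambda>x. \<P> (- x)) has_field_derivative - deriv \<P> (- x)) (at x)"
    by (intro DERIV_uminus_arg wp_has_deriv) simp
  then have "(\<P> has_field_derivative - deriv \<P> (- x)) (at x)"
    by (simp add: wp_even)
  then show ?thesis by (simp add: DERIV_imp_deriv)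
qed

lemma deriv2_wp_even: "x \<notin> \<Lambda> \<Longrightarrow> deriv (deriv \<P>) (- x) = deriv (deriv \<P>) x"
proof -
  assume x: "x \<notin> \<Lambda>"
  then have "((\<lambda>x. - deriv \<P> (- x)) has_field_derivative - (- deriv (deriv \<P>) (- x))) (at x)"
    by (intro DERIV_minus DERIV_uminus_arg deriv_wp_has_deriv) simp
  then have "(deriv \<P> has_field_derivative - (- deriv (deriv \<P>) (- x))) (at x)"
    by (rule has_field_derivative_transform_within_open[OF _ open_off_lattice])
       (use x in \<open>auto simp: deriv_wp_odd\<close>)
  then show ?thesis by (simp add: DERIV_imp_deriv)
qed

lemma congruent_to_0: "congruent_to {0} = \<Lambda>"
  by (simp add: congruent_to_def)

text \<open>
  With \<open>\<wp> x = 1 / x\<^sup>2 + A x\<close> the singular parts of \<open>\<wp>''\<close> and \<open>6 \<wp>\<^sup>2\<close> at the origin are both \<open>6 / x\<^sup>4\<close>, since the mixed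
  term \<open>12 A x / x\<^sup>2\<close> stays bounded.
\<close>

lemma wp_ode2: "\<exists>g. \<forall>x. x \<notin> \<Lambda> \<longrightarrow> deriv (deriv \<P>) x = 6 * (\<P> x)\<^sup>2 - g / 2"
proof -
  define f where "f = (\<lambda>x. deriv (deriv \<P>) x - 6 * (\<P> x)\<^sup>2)"
  obtain c where c: "\<And>x. x \<notin> congruent_to {0} \<Longrightarrow> f x = c"
  proof (rule elliptic_without_poles_constant[of "{0}" f])
    show "f holomorphic_on - congruent_to {0}"
      unfolding f_def congruent_to_0
      by (intro holomorphic_intros deriv2_wp_holomorphic wp_holomorphic)
    show "f (x + \<omega>) = f x" if "x \<notin> congruent_to {0}" "\<omega> \<in> \<Lambda>" for x \<omega>
      using that by (simp add: f_def congruent_to_0 wp_periodic deriv2_wp_periodic)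
    fix p :: complex assume "p \<in> {0}"
    then have p: "p = 0" by simp
    obtain r where r: "r > 0" "ball 0 r \<inter> \<Lambda> = {0}" using lattice_ball_0 by blast
    obtain B where B: "B holomorphic_on ball 0 r" "\<And>x. x \<in> ball 0 r \<Longrightarrow> wp_regular x = x\<^sup>2 * B x"
      using wp_regular_expansion[OF r(2,1)] by blast
    note A = wp_regular_holomorphic_ball[OF r(2)]
    have A1: "deriv wp_regular holomorphic_on ball 0 r"
      by (intro holomorphic_deriv A open_ball)
    define U where "U = ball (0::complex) r - {0}"
    have U: "open U" "x \<in> U \<Longrightarrow> x \<notin> \<Lambda>" "x \<in> U \<Longrightarrow> x \<noteq> 0" for x
      using r(2) unfolding U_def by (blast intro: open_delete open_ball)+
    have d1: "deriv \<P> x = - 2 / x ^ 3 + deriv wp_regular x" if x: "x \<in> U" for x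
    proof -
      have "(wp_regular has_field_derivative deriv wp_regular x) (at x)"
        by (rule holomorphic_derivI[OF A open_ball]) (use x in \<open>auto simp: U_def\<close>)
      moreover have "((\<lambda>x. 1 / x\<^sup>2) has_field_derivative - 2 / x ^ 3) (at x)"
        using U(3)[OF x] by (auto intro!: derivative_eq_intros simp: power2_eq_square power3_eq_cube divide_simps)
      ultimately have "((\<lambda>x. 1 / x\<^sup>2 + wp_regular x) has_field_derivative - 2 / x ^ 3 + deriv wp_regular x) (at x)"
        by (intro DERIV_add)
      then show ?thesis by (simp add: wp_eq[abs_def] DERIV_imp_deriv)
    qed
    have d2: "deriv (deriv \<P>) x = 6 / x ^ 4 + deriv (deriv wp_regular) x" if x: "x \<in> U" for x
    proof -
      have "(deriv wp_regular has_field_derivative deriv (deriv wp_regular) x) (at x)"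
        by (rule holomorphic_derivI[OF A1 open_ball]) (use x in \<open>auto simp: U_def\<close>)
      moreover have "((\<lambda>x. - 2 / x ^ 3) has_field_derivative 6 / x ^ 4) (at x)"
        using U(3)[OF x] by (auto intro!: derivative_eq_intros simp: eval_nat_numeral divide_simps)
      ultimately have "((\<lambda>x. - 2 / x ^ 3 + deriv wp_regular x) has_field_derivative
          6 / x ^ 4 + deriv (deriv wp_regular) x) (at x)"
        by (intro DERIV_add)
      then have "(deriv \<P> has_field_derivative 6 / x ^ 4 + deriv (deriv wp_regular) x) (at x)"
        by (rule has_field_derivative_transform_within_open[OF _ U(1) x]) (simp add: d1)
      then show ?thesis by (rule DERIV_imp_deriv)
    qed
    have "(f \<longlongrightarrow> deriv (deriv wp_regular) 0 - 12 * B 0 - 6 * (wp_regular 0)\<^sup>2) (at 0)"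
    proof (rule tendsto_at_holomorphic[OF _ r(1),
          where g = "\<lambda>x. deriv (deriv wp_regular) x - 12 * B x - 6 * (wp_regular x)\<^sup>2"])
      show "(\<lambda>x. deriv (deriv wp_regular) x - 12 * B x - 6 * (wp_regular x)\<^sup>2) holomorphic_on ball 0 r"
        by (intro holomorphic_intros holomorphic_deriv A1 A B open_ball)
      fix x :: complex assume x: "x \<in> ball 0 r" "x \<noteq> 0"
      then have "f x = 6 / x ^ 4 + deriv (deriv wp_regular) x - 6 * (1 / x\<^sup>2 + wp_regular x)\<^sup>2"
        by (simp add: f_def wp_eq d2 U_def)
      also have "6 * (1 / x\<^sup>2 + wp_regular x)\<^sup>2
          = 6 / x ^ 4 + 12 * (wp_regular x / x\<^sup>2) + 6 * (wp_regular x)\<^sup>2"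
        using x(2) by (simp add: power2_sum power_divide flip: power_mult)
      also have "wp_regular x / x\<^sup>2 = B x"
        using B(2)[OF x(1)] x(2) by simp
      finally show "f x = deriv (deriv wp_regular) x - 12 * B x - 6 * (wp_regular x)\<^sup>2"
        by simp
    qed
    then show "\<exists>l. (f \<longlongrightarrow> l) (at p)" unfolding p by blast
  qed auto
  then show ?thesis
    by (intro exI[of _ "- 2 * c"]) (auto simp: f_def congruent_to_0 algebra_simps)
qed

definition g2 :: complex where
  "g2 = (SOME g. \<forall>x. x \<notin> \<Lambda> \<longrightarrow> deriv (deriv \<P>) x = 6 * (\<P> x)\<^sup>2 - g / 2)"

lemma deriv2_wp: "x \<notin> \<Lambda> \<Longrightarrow> deriv (deriv \<P>) x = 6 * (\<P> x)\<^sup>2 - g2 / 2"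
  using someI_ex[OF wp_ode2] unfolding g2_def by blast

text \<open>
  The derivative of \<open>\<wp>'\<^sup>2 - 4 \<wp>\<^sup>3 + g\<^sub>2 \<wp>\<close> is \<open>2 \<wp>' (\<wp>'' - 6 \<wp>\<^sup>2 + g\<^sub>2 / 2) = 0\<close>.
\<close>

lemma wp_ode1: "\<exists>g. \<forall>x. x \<notin> \<Lambda> \<longrightarrow> (deriv \<P> x)\<^sup>2 = 4 * \<P> x ^ 3 - g2 * \<P> x - g"
proof -
  have "(\<lambda>x. (deriv \<P> x)\<^sup>2 - 4 * \<P> x ^ 3 + g2 * \<P> x) constant_on - \<Lambda>"
  proof (rule has_field_derivative_0_imp_constant_on[OF _ connected_off_lattice open_off_lattice])
    fix x assume "x \<in> - \<Lambda>"
    then have x: "x \<notin> \<Lambda>" by simp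
    show "((\<lambda>x. (deriv \<P> x)\<^sup>2 - 4 * \<P> x ^ 3 + g2 * \<P> x) has_field_derivative 0) (at x)"
      by (rule derivative_eq_intros wp_has_deriv[OF x] deriv_wp_has_deriv[OF x] refl)+
         (simp add: deriv2_wp[OF x] power2_eq_square algebra_simps)
  qed
  then obtain c where "\<And>x. x \<notin> \<Lambda> \<Longrightarrow> (deriv \<P> x)\<^sup>2 - 4 * \<P> x ^ 3 + g2 * \<P> x = c"
    unfolding constant_on_def by auto
  then show ?thesis
    by (intro exI[of _ "- c"]) (auto simp: algebra_simps)
qed

definition g3 :: complex where
  "g3 = (SOME g. \<forall>x. x \<notin> \<Lambda> \<longrightarrow> (deriv \<P> x)\<^sup>2 = 4 * \<P> x ^ 3 - g2 * \<P> x - g)"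

lemma deriv_wp_squared: "x \<notin> \<Lambda> \<Longrightarrow> (deriv \<P> x)\<^sup>2 = 4 * \<P> x ^ 3 - g2 * \<P> x - g3"
  using someI_ex[OF wp_ode1] unfolding g3_def by blast

text \<open>
  If the value \<open>c\<close> were omitted, \<open>1 / (\<wp> - c)\<close> would be elliptic without poles, hence constant, and its
  limit at the origin is \<open>0\<close>.
\<close>

lemma wp_surjective: "\<exists>x. x \<notin> \<Lambda> \<and> \<P> x = c"
proof (rule ccontr)
  assume "\<not> ?thesis"
  then have ne: "\<P> x - c \<noteq> 0" if "x \<notin> \<Lambda>" for x using that by auto
  define f where "f = (\<lambda>x. 1 / (\<P> x - c))"
  obtain r where r: "r > 0" "ball 0 r \<inter> \<Lambda> = {0}" using lattice_ball_0 by blast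
  have "isCont (\<lambda>x. 1 + x\<^sup>2 * (wp_regular x - c)) 0"
  proof -
    have "(\<lambda>x. 1 + x\<^sup>2 * (wp_regular x - c)) holomorphic_on ball 0 r"
      by (intro holomorphic_intros wp_regular_holomorphic_ball r)
    from continuous_on_interior[OF holomorphic_on_imp_continuous_on[OF this], of 0]
    show ?thesis using r(1) by simp
  qed
  then have "((\<lambda>x. 1 + x\<^sup>2 * (wp_regular x - c)) \<longlongrightarrow> 1) (at 0)"
    by (simp add: isCont_def)
  moreover have "((\<lambda>x::complex. x\<^sup>2) \<longlongrightarrow> 0\<^sup>2) (at 0)"
    by (intro tendsto_intros)
  ultimately have "((\<lambda>x. x\<^sup>2 / (1 + x\<^sup>2 * (wp_regular x - c))) \<longlongrightarrow> 0\<^sup>2 / 1) (at 0)"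
    by (intro tendsto_divide) auto
  then have f0: "(f \<longlongrightarrow> 0) (at 0)"
  proof (rule Lim_transform_within_open[where s = "ball 0 r", THEN tendsto_eq_rhs])
    fix x :: complex assume x: "x \<in> ball 0 r" "x \<noteq> 0"
    then have "\<P> x - c = (1 + x\<^sup>2 * (wp_regular x - c)) / x\<^sup>2"
      by (simp add: wp_eq field_simps)
    then show "x\<^sup>2 / (1 + x\<^sup>2 * (wp_regular x - c)) = f x"
      by (simp add: f_def)
  qed (use r in auto)
  obtain d where d: "\<And>x. x \<notin> congruent_to {0} \<Longrightarrow> f x = d"
  proof (rule elliptic_without_poles_constant[of "{0}" f])
    show "f holomorphic_on - congruent_to {0}"
      unfolding f_def congruent_to_0 by (intro holomorphic_intros wp_holomorphic) (use ne in auto)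
    show "f (x + \<omega>) = f x" if "x \<notin> congruent_to {0}" "\<omega> \<in> \<Lambda>" for x \<omega>
      using that by (simp add: f_def congruent_to_0 wp_periodic)
    show "\<exists>l. (f \<longlongrightarrow> l) (at p)" if "p \<in> {0}" for p
      using f0 that by auto
  qed auto
  have "((\<lambda>x. d) \<longlongrightarrow> 0) (at (0::complex))"
  proof (rule Lim_transform_within_open[OF f0, of "ball 0 r"])
    fix x :: complex assume "x \<in> ball 0 r" "x \<noteq> 0"
    then have "x \<notin> \<Lambda>" using r(2) by blast
    then show "f x = d" using d by (simp add: congruent_to_0)
  qed (use r in auto)
  then have "d = 0" by (simp add: LIM_const_eq)
  define x :: complex where "x = of_real (r / 2)"
  have "x \<in> ball 0 r" "x \<noteq> 0" using r(1) by (auto simp: x_def)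
  then have x: "x \<notin> \<Lambda>" using r(2) by blast
  with d[of x] ne[OF x] \<open>d = 0\<close> show False by (simp add: f_def congruent_to_0)
qed

section \<open>The addition formula\<close>

lemma wp_shift_holomorphic:
  assumes "\<And>x. x \<in> U \<Longrightarrow> x + d \<notin> \<Lambda>"
  shows "(\<lambda>x. \<P> (x + d)) holomorphic_on U"
proof -
  have "\<P> \<circ> (\<lambda>x. x + d) holomorphic_on U"
    by (rule holomorphic_on_compose_gen[OF _ wp_holomorphic]) (use assms in \<open>auto intro!: holomorphic_intros\<close>)
  then show ?thesis by (simp add: o_def)
qed

lemma deriv_wp_half_period:
  assumes "d \<notin> \<Lambda>" "2 * d \<in> \<Lambda>"
  shows "deriv \<P> d = 0"
proof -
  have "deriv \<P> (- d + 2 * d) = deriv \<P> (- d)"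
    by (rule deriv_wp_periodic) (use assms in auto)
  then have "deriv \<P> d = - deriv \<P> d"
    using deriv_wp_odd[OF assms(1)] by simp
  then show ?thesis by simp
qed

context
  fixes d :: complex
  assumes d: "d \<notin> \<Lambda>"
begin

text \<open>
  For a fixed point \<open>d\<close> outside the lattice the addition formula expresses the product of \<open>wp_pair\<close>
  with the square of \<open>wp_gap\<close>. The product can have poles only at the points congruent to those of
  \<open>pair_poles\<close>.
\<close>

definition wp_gap :: "complex \<Rightarrow> complex" where "wp_gap x = \<P> x - \<P> d"
definition wp_pair :: "complex \<Rightarrow> complex" where "wp_pair x = \<P> (x + d) + \<P> (x - d)"
definition pair_poles :: "complex set" where "pair_poles = {0, d, - d}"

lemma not_congruent_pair_poles: "x \<notin> congruent_to pair_poles \<longleftrightarrow> x \<notin> \<Lambda> \<and> x - d \<notin> \<Lambda> \<and> x + d \<notin> \<Lambda>"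
  by (auto simp: congruent_to_def pair_poles_def)

lemma wp_gap_not_locally_zero:
  assumes "open V" "V \<noteq> {}" "V \<subseteq> - \<Lambda>"
  shows "\<exists>y\<in>V. wp_gap y \<noteq> 0"
  using wp_not_locally_constant[OF assms, of "\<P> d"] by (simp add: wp_gap_def)

lemma wp_pair_even: "wp_pair (- x) = wp_pair x"
proof -
  have a: "\<P> (- x + d) = \<P> (x - d)" "\<P> (- x - d) = \<P> (x + d)"
  proof -
    have "- x + d = - (x - d)" "- x - d = - (x + d)" by simp_all
    then show "\<P> (- x + d) = \<P> (x - d)" "\<P> (- x - d) = \<P> (x + d)"
      by (simp_all only: wp_even)
  qed
  show ?thesis unfolding wp_pair_def a by (rule add.commute)
qed

text \<open>
  With \<open>G = wp_pair\<close> and \<open>t = wp_gap\<close>: \<open>G\<close> is even, so \<open>G x = 2 \<wp> d + \<gamma> x\<^sup>2 + O(x\<^sup>4)\<close> with \<open>\<gamma> = \<wp>'' d\<close>, while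
  \<open>x\<^sup>2 t x = 1 + O(x\<^sup>2)\<close>. Hence \<open>t\<^sup>2 (G - 2 \<wp> d) - \<gamma> t = t (x\<^sup>2 t (\<gamma> + O(x\<^sup>2)) - \<gamma>)\<close> is bounded.
\<close>

lemma expansion_at_0:
  "\<exists>l. ((\<lambda>x. (wp_gap x)\<^sup>2 * wp_pair x - 2 * \<P> d * (wp_gap x)\<^sup>2 - deriv (deriv \<P>) d * wp_gap x) \<longlongrightarrow> l) (at 0)"
proof -
  obtain r1 where r1: "r1 > 0" "ball 0 r1 \<inter> \<Lambda> = {0}" using lattice_ball_0 by blast
  obtain r2 where r2: "r2 > 0" "ball d r2 \<inter> \<Lambda> = {}" using lattice_free_ball[OF d] by blast
  define r where "r = min r1 r2"
  have r: "r > 0" "ball 0 r \<inter> \<Lambda> = {0}"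
  proof -
    show "r > 0" using r1 r2 by (simp add: r_def)
    then have "0 \<in> ball 0 r \<inter> \<Lambda>" by simp
    moreover have "ball 0 r \<subseteq> ball 0 r1" by (rule subset_ball) (simp add: r_def)
    ultimately show "ball 0 r \<inter> \<Lambda> = {0}" using r1(2) by blast
  qed
  have xd: "x + d \<notin> \<Lambda>" "x - d \<notin> \<Lambda>" if "x \<in> ball 0 r" for x
  proof -
    have "x + d \<in> ball d r2" "d - x \<in> ball d r2" using that by (auto simp: r_def dist_norm)
    then show "x + d \<notin> \<Lambda>" "x - d \<notin> \<Lambda>"
      using r2(2) lattice_minus_commute[of x d] by blast+
  qed
  define \<gamma> where "\<gamma> = deriv (deriv \<P>) d"
  have Sh: "wp_pair holomorphic_on ball 0 r"
    unfolding wp_pair_def[abs_def] using xd wp_shift_holomorphic[of "ball 0 r" "- d"]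
    by (intro holomorphic_intros wp_shift_holomorphic) auto
  obtain k where k: "k holomorphic_on ball 0 r" "\<And>x. x \<in> ball 0 r \<Longrightarrow> k (- x) = k x"
    "\<And>x. x \<in> ball 0 r \<Longrightarrow> wp_pair x = wp_pair 0 + x\<^sup>2 * k x" "deriv (deriv wp_pair) 0 = 2 * k 0"
    using even_holomorphic_factor[OF Sh r(1) wp_pair_even] by metis
  obtain l where l: "l holomorphic_on ball 0 r"
    "\<And>x. x \<in> ball 0 r \<Longrightarrow> k x = k 0 + x\<^sup>2 * l x"
    using even_holomorphic_factor[OF k(1) r(1) k(2)] by metis
  obtain B where B: "B holomorphic_on ball 0 r" "\<And>x. x \<in> ball 0 r \<Longrightarrow> wp_regular x = x\<^sup>2 * B x"
    using wp_regular_expansion[OF r(2,1)] by blast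
  have S0: "wp_pair 0 = 2 * \<P> d"
    by (simp add: wp_pair_def wp_even)
  have k0: "k 0 = \<gamma>"
  proof -
    have D1: "deriv wp_pair x = deriv \<P> (x + d) + deriv \<P> (x - d)" if "x \<in> ball 0 r" for x
    proof -
      have "((\<lambda>x. \<P> (x + d)) has_field_derivative deriv \<P> (x + d)) (at x)"
        using wp_has_deriv[OF xd(1)[OF that]] by (simp add: DERIV_shift)
      moreover have "((\<lambda>x. \<P> (x + - d)) has_field_derivative deriv \<P> (x + - d)) (at x)"
        using wp_has_deriv[of "x + - d"] xd(2)[OF that] unfolding DERIV_shift by simp
      ultimately show ?thesis
        unfolding wp_pair_def[abs_def] by (intro DERIV_imp_deriv DERIV_add) simp_all
    qed
    have "((\<lambda>x. deriv \<P> (x + d)) has_field_derivative deriv (deriv \<P>) (0 + d)) (at 0)"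
      using deriv_wp_has_deriv[of "0 + d"] d unfolding DERIV_shift by simp
    moreover have "((\<lambda>x. deriv \<P> (x + - d)) has_field_derivative deriv (deriv \<P>) (0 + - d)) (at 0)"
      using deriv_wp_has_deriv[of "0 + - d"] d unfolding DERIV_shift by simp
    ultimately have "((\<lambda>x. deriv \<P> (x + d) + deriv \<P> (x + - d)) has_field_derivative
        deriv (deriv \<P>) (0 + d) + deriv (deriv \<P>) (0 + - d)) (at 0)"
      by (rule DERIV_add)
    then have "(deriv wp_pair has_field_derivative deriv (deriv \<P>) (0 + d) + deriv (deriv \<P>) (0 + - d)) (at 0)"
      by (rule has_field_derivative_transform_within_open[OF _ open_ball, of _ _ _ 0 r])
         (use r D1 in auto)
    then have "deriv (deriv wp_pair) 0 = 2 * \<gamma>"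
      by (simp add: DERIV_imp_deriv deriv2_wp_even d \<gamma>_def)
    then show ?thesis using k(4) by simp
  qed
  define C where "C = (\<lambda>x. x\<^sup>2 * B x - \<P> d)"
  define G where "G = (\<lambda>x. (1 + x\<^sup>2 * C x) * (l x + C x * \<gamma> + x\<^sup>2 * C x * l x))"
  have "((\<lambda>x. (wp_gap x)\<^sup>2 * wp_pair x - 2 * \<P> d * (wp_gap x)\<^sup>2 - \<gamma> * wp_gap x) \<longlongrightarrow> G 0) (at 0)"
  proof (rule tendsto_at_holomorphic[OF _ r(1)])
    show "G holomorphic_on ball 0 r"
      unfolding G_def C_def by (intro holomorphic_intros B l)
    fix x :: complex assume x: "x \<in> ball 0 r" "x \<noteq> 0"
    have tx: "x\<^sup>2 * wp_gap x = 1 + x\<^sup>2 * C x"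
      using x(2) by (simp add: wp_gap_def wp_eq[of x] B(2)[OF x(1)] C_def field_simps)
    have Sx: "wp_pair x - 2 * \<P> d = x\<^sup>2 * (\<gamma> + x\<^sup>2 * l x)"
      using k(3)[OF x(1)] l(2)[OF x(1)] by (simp add: S0 k0)
    have "(wp_gap x)\<^sup>2 * wp_pair x - 2 * \<P> d * (wp_gap x)\<^sup>2 - \<gamma> * wp_gap x
        = wp_gap x * (wp_gap x * (wp_pair x - 2 * \<P> d) - \<gamma>)"
      by (simp add: power2_eq_square algebra_simps)
    also have "wp_gap x * (wp_pair x - 2 * \<P> d) = (1 + x\<^sup>2 * C x) * (\<gamma> + x\<^sup>2 * l x)"
      unfolding Sx tx[symmetric] by (simp add: mult_ac)
    also have "wp_gap x * ((1 + x\<^sup>2 * C x) * (\<gamma> + x\<^sup>2 * l x) - \<gamma>)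
        = (x\<^sup>2 * wp_gap x) * (l x + C x * \<gamma> + x\<^sup>2 * C x * l x)"
      by (simp add: algebra_simps)
    finally show "(wp_gap x)\<^sup>2 * wp_pair x - 2 * \<P> d * (wp_gap x)\<^sup>2 - \<gamma> * wp_gap x = G x"
      unfolding tx G_def .
  qed
  then show ?thesis unfolding \<gamma>_def by blast
qed

text \<open>
  The number \<open>c\<close> is the coefficient of the double pole of \<open>\<wp> (x + d) + \<wp> (x - d)\<close> at \<open>x = d\<close>. It is \<open>1\<close> in general
  and \<open>2\<close> if \<open>d\<close> is a half-period, when both summands have a pole. In the second case \<open>\<wp>' d = 0\<close>, so
  that \<open>c * \<wp>' d\<^sup>2 = \<wp>' d\<^sup>2\<close> always and no case distinction is needed afterwards.
\<close>

lemma expansion_at_d: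
  obtains r k R c where "r > 0" "k holomorphic_on ball d r" "R holomorphic_on ball d r" "ball d r \<inter> \<Lambda> = {}"
    "\<And>x. x \<in> ball d r \<Longrightarrow> wp_gap x = (x - d) * k x" "k d = deriv \<P> d"
    "\<And>x. x \<in> ball d r \<Longrightarrow> x \<noteq> d \<Longrightarrow> (x - d)\<^sup>2 * wp_pair x = c + (x - d)\<^sup>2 * R x"
    "c * (deriv \<P> d)\<^sup>2 = (deriv \<P> d)\<^sup>2" "2 * d \<notin> \<Lambda> \<Longrightarrow> c = 1"
    "\<And>x. x \<in> ball d r \<Longrightarrow> x \<noteq> d \<Longrightarrow> x \<notin> congruent_to pair_poles"
proof -
  obtain r1 where r1: "r1 > 0" "ball 0 r1 \<inter> \<Lambda> = {0}" using lattice_ball_0 by blast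
  obtain r2 where r2: "r2 > 0" "ball d r2 \<inter> \<Lambda> = {}" using lattice_free_ball[OF d] by blast
  obtain r3 where r3: "r3 > 0" "2 * d \<notin> \<Lambda> \<Longrightarrow> ball (2 * d) r3 \<inter> \<Lambda> = {}"
    using lattice_free_ball[of "2 * d"] by (metis zero_less_one)
  obtain r4 where r4: "r4 > 0" "\<And>x. x \<in> ball d r4 \<Longrightarrow> x \<noteq> d \<Longrightarrow> x \<notin> congruent_to pair_poles"
    using congruent_isolated[of pair_poles d] by (auto simp: pair_poles_def)
  define r where "r = min (min r1 r2) (min r3 r4)"
  have r: "r > 0" "r \<le> r1" "r \<le> r2" "r \<le> r3" "r \<le> r4" using r1 r2 r3 r4 by (auto simp: r_def)
  define k where "k = (\<lambda>x. if x = d then deriv \<P> d else (\<P> x - \<P> d) / (x - d))"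
  have bd: "ball d r \<inter> \<Lambda> = {}" using r2(2) subset_ball[OF r(3), of d] by blast
  have kh: "k holomorphic_on ball d r"
    unfolding k_def
    by (rule pole_lemma_open[OF holomorphic_on_subset[OF wp_holomorphic] open_ball]) (use bd in blast)
  have tk: "wp_gap x = (x - d) * k x" for x
    by (simp add: k_def wp_gap_def)
  define A where "A = (\<lambda>x. wp_regular (x - d))"
  have Ah: "A holomorphic_on ball d r"
  proof -
    have "wp_regular \<circ> (\<lambda>x. x - d) holomorphic_on ball d r"
    proof (rule holomorphic_on_compose_gen[OF _ wp_regular_holomorphic_ball[OF r1(2)]])
      show "(\<lambda>x. x - d) ` ball d r \<subseteq> ball 0 r1"
        using r(2) by (auto simp: dist_norm norm_minus_commute)
    qed (intro holomorphic_intros)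
    then show ?thesis by (simp add: o_def A_def)
  qed
  have near: "\<P> (x - d) = 1 / (x - d)\<^sup>2 + A x" for x
    by (simp add: wp_eq A_def)
  have nc: "x \<notin> congruent_to pair_poles" if "x \<in> ball d r" "x \<noteq> d" for x
    using r4(2)[of x] that r(5) by auto
  show ?thesis
  proof (cases "2 * d \<in> \<Lambda>")
    case False
    have xd: "x + d \<notin> \<Lambda>" if "x \<in> ball d r" for x
    proof -
      have "x + d \<in> ball (2 * d) r3" using that r(4) by (auto simp: dist_norm)
      then show ?thesis using r3(2)[OF False] by blast
    qed
    show ?thesis
    proof (rule that[OF r(1) kh _ bd tk])
      show "(\<lambda>x. A x + \<P> (x + d)) holomorphic_on ball d r"
        by (intro holomorphic_intros Ah wp_shift_holomorphic xd)
      show "(x - d)\<^sup>2 * wp_pair x = 1 + (x - d)\<^sup>2 * (A x + \<P> (x + d))" if "x \<in> ball d r" "x \<noteq> d" for x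
        using that by (simp add: wp_pair_def near field_simps)
    qed (use nc in \<open>auto simp: k_def\<close>)
  next
    case True
    have "\<P> (x + d) = \<P> (x - d)" if "x \<in> ball d r" "x \<noteq> d" for x
      using wp_periodic[OF True, of "x - d"] nc[OF that] by (simp add: not_congruent_pair_poles algebra_simps)
    then have S2: "wp_pair x = 2 / (x - d)\<^sup>2 + 2 * A x" if "x \<in> ball d r" "x \<noteq> d" for x
      using that by (simp add: wp_pair_def near)
    show ?thesis
    proof (rule that[OF r(1) kh _ bd tk])
      show "(\<lambda>x. 2 * A x) holomorphic_on ball d r"
        by (intro holomorphic_intros Ah)
      show "(x - d)\<^sup>2 * wp_pair x = 2 + (x - d)\<^sup>2 * (2 * A x)" if "x \<in> ball d r" "x \<noteq> d" for x
        using that(2) unfolding S2[OF that] by (simp add: distrib_left)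
    qed (use nc deriv_wp_half_period[OF d True] True in \<open>auto simp: k_def\<close>)
  qed
qed

text \<open>
  The difference of the two sides has no poles and is constant by Liouville's theorem. Its limit at
  \<open>x = d\<close> identifies the constant: \<open>wp_gap x\<close> behaves like \<open>\<wp>' d (x - d)\<close> and \<open>wp_pair x\<close> like
  \<open>c / (x - d)\<^sup>2\<close>.
\<close>

lemma wp_addition_aux:
  assumes "x \<notin> \<Lambda>" "x - d \<notin> \<Lambda>" "x + d \<notin> \<Lambda>"
  shows "(wp_gap x)\<^sup>2 * wp_pair x = 2 * \<P> d * (wp_gap x)\<^sup>2 + deriv (deriv \<P>) d * wp_gap x + (deriv \<P> d)\<^sup>2"
proof -
  define f where "f = (\<lambda>x. (wp_gap x)\<^sup>2 * wp_pair x - 2 * \<P> d * (wp_gap x)\<^sup>2 - deriv (deriv \<P>) d * wp_gap x)"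
  obtain r k R c where e: "r > 0" "k holomorphic_on ball d r" "R holomorphic_on ball d r" "ball d r \<inter> \<Lambda> = {}"
    "\<And>x. x \<in> ball d r \<Longrightarrow> wp_gap x = (x - d) * k x" "k d = deriv \<P> d"
    "\<And>x. x \<in> ball d r \<Longrightarrow> x \<noteq> d \<Longrightarrow> (x - d)\<^sup>2 * wp_pair x = c + (x - d)\<^sup>2 * R x"
    "c * (deriv \<P> d)\<^sup>2 = (deriv \<P> d)\<^sup>2" "2 * d \<notin> \<Lambda> \<Longrightarrow> c = 1"
    "\<And>x. x \<in> ball d r \<Longrightarrow> x \<noteq> d \<Longrightarrow> x \<notin> congruent_to pair_poles"
    by (rule expansion_at_d) blast
  define G where "G = (\<lambda>x. (k x)\<^sup>2 * (c + (x - d)\<^sup>2 * R x) - 2 * \<P> d * ((x - d) * k x)\<^sup>2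
      - deriv (deriv \<P>) d * ((x - d) * k x))"
  have Gd: "G d = (deriv \<P> d)\<^sup>2"
    using e(8) by (simp add: G_def e(6) mult.commute)
  have G: "G holomorphic_on ball d r"
    unfolding G_def by (intro holomorphic_intros e)
  have fG: "f x = G x" if "x \<in> ball d r" "x \<noteq> d" for x
  proof -
    have "(wp_gap x)\<^sup>2 * wp_pair x = (k x)\<^sup>2 * ((x - d)\<^sup>2 * wp_pair x)"
      by (simp add: e(5)[OF that(1)] power_mult_distrib mult_ac)
    then show ?thesis
      unfolding f_def G_def e(7)[OF that] by (simp add: e(5)[OF that(1)])
  qed
  have limd: "(f \<longlongrightarrow> (deriv \<P> d)\<^sup>2) (at d)"
    using tendsto_at_holomorphic[OF G e(1) fG] unfolding Gd .
  have fe: "f (- x) = f x" for x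
    by (simp add: f_def wp_gap_def wp_pair_even wp_even)
  have limmd: "(f \<longlongrightarrow> G (- (- d))) (at (- d))"
  proof (rule tendsto_at_holomorphic[OF _ e(1), where g = "\<lambda>x. G (- x)"])
    have "G \<circ> uminus holomorphic_on ball (- d) r"
      by (rule holomorphic_on_compose_gen[OF _ G]) (auto intro!: holomorphic_intros simp: dist_norm norm_minus_commute add.commute)
    then show "(\<lambda>x. G (- x)) holomorphic_on ball (- d) r" by (simp add: o_def)
    fix x assume "x \<in> ball (- d) r" "x \<noteq> - d"
    then have "- x \<in> ball d r" "- x \<noteq> d"
      by (auto simp: dist_norm) (metis add.commute diff_minus_eq_add norm_minus_commute uminus_add_conv_diff)
    then show "f x = G (- x)" using fG[of "- x"] fe[of x] by simp
  qed
  obtain C where C: "\<And>x. x \<notin> congruent_to pair_poles \<Longrightarrow> f x = C"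
  proof (rule elliptic_without_poles_constant[of pair_poles f])
    show "finite pair_poles" by (simp add: pair_poles_def)
    show "f holomorphic_on - congruent_to pair_poles"
    proof -
      have "- congruent_to pair_poles \<subseteq> - \<Lambda>" using not_congruent_pair_poles by blast
      then have h: "\<P> holomorphic_on - congruent_to pair_poles"
        by (rule holomorphic_on_subset[OF wp_holomorphic])
      have "(\<lambda>x. \<P> (x + d)) holomorphic_on - congruent_to pair_poles"
        "(\<lambda>x. \<P> (x + - d)) holomorphic_on - congruent_to pair_poles"
        by (rule wp_shift_holomorphic, simp add: not_congruent_pair_poles)+
      with h show ?thesis
        unfolding f_def wp_gap_def wp_pair_def by (intro holomorphic_intros) simp_all
    qed
    fix x \<omega> assume "x \<notin> congruent_to pair_poles" "\<omega> \<in> \<Lambda>"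
    then have x: "x \<notin> \<Lambda>" "x - d \<notin> \<Lambda>" "x + d \<notin> \<Lambda>" "\<omega> \<in> \<Lambda>" by (auto simp: not_congruent_pair_poles)
    have "\<P> (x + \<omega> + d) = \<P> (x + d)" "\<P> (x + \<omega> - d) = \<P> (x - d)"
      using wp_periodic[OF x(4,3)] wp_periodic[OF x(4,2)] by (simp_all add: algebra_simps)
    then show "f (x + \<omega>) = f x"
      by (simp add: f_def wp_gap_def wp_pair_def wp_periodic x)
  next
    fix p assume "p \<in> pair_poles"
    then show "\<exists>l. (f \<longlongrightarrow> l) (at p)"
      using limd limmd expansion_at_0 unfolding f_def[symmetric] pair_poles_def by auto
  qed blast
  have "((\<lambda>x. C) \<longlongrightarrow> (deriv \<P> d)\<^sup>2) (at d)"
    by (rule Lim_transform_within_open[OF limd, of "ball d r"]) (use e C in auto)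
  then have "C = (deriv \<P> d)\<^sup>2" by (simp add: LIM_const_eq)
  then show ?thesis
    using C[of x] assms by (simp add: not_congruent_pair_poles f_def algebra_simps)
qed

text \<open>
  If \<open>\<wp>' d = 0\<close>, the gap is \<open>(x - d)\<^sup>2 m x\<close> with \<open>\<wp>'' d = 2 m d\<close>. If \<open>d\<close> were not a half-period, the addition
  formula divided by the gap would give \<open>m d = \<wp>'' d\<close> in the limit \<open>x = d\<close>. Both vanish then, and the
  formula reduces to \<open>\<wp> (x + d) + \<wp> (x - d) = 2 \<wp> d\<close>, which contradicts the pole at \<open>x = d\<close>.
\<close>

lemma half_period_if_deriv_wp_0_aux:
  assumes z: "deriv \<P> d = 0"
  shows "2 * d \<in> \<Lambda>"
proof (rule ccontr)
  assume n: "2 * d \<notin> \<Lambda>"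
  define \<gamma> where "\<gamma> = deriv (deriv \<P>) d"
  obtain r k R c where e: "r > 0" "k holomorphic_on ball d r" "R holomorphic_on ball d r" "ball d r \<inter> \<Lambda> = {}"
    "\<And>x. x \<in> ball d r \<Longrightarrow> wp_gap x = (x - d) * k x" "k d = deriv \<P> d"
    "\<And>x. x \<in> ball d r \<Longrightarrow> x \<noteq> d \<Longrightarrow> (x - d)\<^sup>2 * wp_pair x = c + (x - d)\<^sup>2 * R x"
    "c * (deriv \<P> d)\<^sup>2 = (deriv \<P> d)\<^sup>2" "2 * d \<notin> \<Lambda> \<Longrightarrow> c = 1"
    "\<And>x. x \<in> ball d r \<Longrightarrow> x \<noteq> d \<Longrightarrow> x \<notin> congruent_to pair_poles"
    by (rule expansion_at_d) blast
  have c: "c = 1" by (rule e(9)[OF n])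
  define m where "m = (\<lambda>x. if x = d then deriv k d else (k x - k d) / (x - d))"
  have mh: "m holomorphic_on ball d r"
    unfolding m_def by (rule pole_lemma_open[OF e(2) open_ball])
  have tm: "wp_gap x = (x - d)\<^sup>2 * m x" if "x \<in> ball d r" for x
    using e(5)[OF that] z by (simp add: m_def e(6) power2_eq_square)
  have md: "\<gamma> = 2 * m d"
    unfolding \<gamma>_def
  proof (rule second_deriv_square_factor[OF open_ball _ mh, where c = "\<P> d"])
    show "\<P> x = \<P> d + (x - d)\<^sup>2 * m x" if "x \<in> ball d r" for x
      using tm[OF that] unfolding wp_gap_def by (simp add: diff_eq_eq add.commute)
  qed (use e(1) in simp)
  define U where "U = ball d r - {d}"
  have U: "open U" unfolding U_def by (intro open_delete open_ball)
  have hR: "R holomorphic_on U" "m holomorphic_on U"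
    using e(3) mh by (auto simp: U_def intro: holomorphic_on_subset)
  have nz: "\<exists>y\<in>V. wp_gap y \<noteq> 0" if "open V" "V \<noteq> {}" "V \<subseteq> U" for V
    by (rule wp_gap_not_locally_zero[OF that(1,2)]) (use that(3) e(4) in \<open>auto simp: U_def\<close>)
  have id: "wp_gap x * (wp_gap x * wp_pair x - 2 * \<P> d * wp_gap x - \<gamma>) = 0" if "x \<in> U" for x
    using wp_addition_aux[of x] e(10)[of x] that z
    by (simp add: U_def not_congruent_pair_poles \<gamma>_def power2_eq_square algebra_simps)
  have tS: "wp_gap x * wp_pair x = m x * (1 + (x - d)\<^sup>2 * R x)" if "x \<in> U" for x
    using e(7)[of x] tm[of x] that by (simp add: U_def c mult_ac)
  have 1: "m x * (1 + (x - d)\<^sup>2 * R x) - 2 * \<P> d * ((x - d)\<^sup>2 * m x) - \<gamma> = 0" if "x \<in> U" for x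
  proof (rule zero_factor[OF U _ _ nz that])
    show "continuous_on U (\<lambda>x. m x * (1 + (x - d)\<^sup>2 * R x) - 2 * \<P> d * ((x - d)\<^sup>2 * m x) - \<gamma>)"
      by (intro holomorphic_on_imp_continuous_on holomorphic_intros hR)
    show "wp_gap y * (m y * (1 + (y - d)\<^sup>2 * R y) - 2 * \<P> d * ((y - d)\<^sup>2 * m y) - \<gamma>) = 0" if "y \<in> U" for y
      using id[OF that] tS[OF that] tm[of y] that by (simp add: U_def)
  qed
  have "((\<lambda>x. 0) \<longlongrightarrow> m d * (1 + (d - d)\<^sup>2 * R d) - 2 * \<P> d * ((d - d)\<^sup>2 * m d) - \<gamma>) (at d)"
  proof (rule tendsto_at_holomorphic[OF _ e(1),
        where g = "\<lambda>x. m x * (1 + (x - d)\<^sup>2 * R x) - 2 * \<P> d * ((x - d)\<^sup>2 * m x) - \<gamma>"])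
    show "0 = m x * (1 + (x - d)\<^sup>2 * R x) - 2 * \<P> d * ((x - d)\<^sup>2 * m x) - \<gamma>"
      if "x \<in> ball d r" "x \<noteq> d" for x
      using 1[of x] that by (simp add: U_def)
  qed (intro holomorphic_intros mh e)
  from LIM_const_eq[OF this] have "m d = \<gamma>" by simp
  with md have g0: "\<gamma> = 0" by simp
  have 2: "m x * (1 + (x - d)\<^sup>2 * R x - 2 * \<P> d * (x - d)\<^sup>2) = 0" if "x \<in> U" for x
    using 1[OF that] by (simp add: g0 algebra_simps)
  have nzm: "\<exists>y\<in>V. m y \<noteq> 0" if "open V" "V \<noteq> {}" "V \<subseteq> U" for V
    using nz[OF that] tm that(3) by (auto simp: U_def)
  have 3: "1 + (x - d)\<^sup>2 * R x - 2 * \<P> d * (x - d)\<^sup>2 = 0" if "x \<in> U" for x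
  proof (rule zero_factor[OF U _ 2 nzm that])
    show "continuous_on U (\<lambda>x. 1 + (x - d)\<^sup>2 * R x - 2 * \<P> d * (x - d)\<^sup>2)"
      by (intro holomorphic_on_imp_continuous_on holomorphic_intros hR)
  qed
  have "((\<lambda>x. 0) \<longlongrightarrow> 1 + (d - d)\<^sup>2 * R d - 2 * \<P> d * (d - d)\<^sup>2) (at d)"
  proof (rule tendsto_at_holomorphic[OF _ e(1), where g = "\<lambda>x. 1 + (x - d)\<^sup>2 * R x - 2 * \<P> d * (x - d)\<^sup>2"])
    show "0 = 1 + (x - d)\<^sup>2 * R x - 2 * \<P> d * (x - d)\<^sup>2" if "x \<in> ball d r" "x \<noteq> d" for x
      using 3[of x] that by (simp add: U_def)
  qed (intro holomorphic_intros e)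
  from LIM_const_eq[OF this] show False by simp
qed

text \<open>
  For a half-period \<open>d\<close> the addition formula reads \<open>2 t (\<wp> (y - d) - \<wp> d) = \<wp>'' d\<close> with \<open>t = \<wp> y - \<wp> d\<close>. If \<open>t\<close>
  vanished at a further point \<open>x\<close>, then \<open>\<wp>'' d = 0\<close>, and \<open>\<wp> (y - d)\<close> would be constant.
\<close>

lemma wp_eq_imp_congruent_aux:
  assumes x: "x \<notin> \<Lambda>" and eq: "\<P> x = \<P> d"
  assumes half: "2 * x \<in> \<Lambda>" "2 * d \<in> \<Lambda>"
  shows "x - d \<in> \<Lambda>"
proof (rule ccontr)
  assume n: "x - d \<notin> \<Lambda>"
  have n2: "y + d \<in> \<Lambda> \<longleftrightarrow> y - d \<in> \<Lambda>" for y
    using lattice_add_right_iff[OF half(2), of "y - d"] by (simp add: algebra_simps)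
  define \<gamma> where "\<gamma> = deriv (deriv \<P>) d"
  have "x \<notin> congruent_to pair_poles" using x n n2 by (simp add: not_congruent_pair_poles)
  moreover have "open (- congruent_to pair_poles)"
    by (intro open_Compl closed_sub_congruent[of pair_poles]) (auto simp: pair_poles_def)
  ultimately obtain r where r: "r > 0" "ball x r \<subseteq> - congruent_to pair_poles"
    using open_contains_ball by blast
  have y: "y \<notin> \<Lambda>" "y - d \<notin> \<Lambda>" "y + d \<notin> \<Lambda>" if "y \<in> ball x r" for y
    using r(2) that not_congruent_pair_poles by blast+
  have wp_pair: "wp_pair y = 2 * \<P> (y - d)" if "y \<in> ball x r" for y
    using wp_periodic[OF half(2) y(2)[OF that]] by (simp add: wp_pair_def algebra_simps)
  have nz: "\<exists>y\<in>V. wp_gap y \<noteq> 0" if "open V" "V \<noteq> {}" "V \<subseteq> ball x r" for V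
    by (rule wp_gap_not_locally_zero[OF that(1,2)]) (use that(3) y in auto)
  have th: "wp_gap holomorphic_on ball x r"
    unfolding wp_gap_def[abs_def] by (intro holomorphic_intros holomorphic_on_subset[OF wp_holomorphic]) (use y in auto)
  have Ph: "(\<lambda>y. \<P> (y - d)) holomorphic_on ball x r"
    using wp_shift_holomorphic[of "ball x r" "- d"] y by simp
  have id: "wp_gap y * (2 * wp_gap y * (\<P> (y - d) - \<P> d) - \<gamma>) = 0" if "y \<in> ball x r" for y
    using wp_addition_aux[OF y[OF that]] deriv_wp_half_period[OF d half(2)]
    by (simp add: wp_pair[OF that] \<gamma>_def power2_eq_square algebra_simps)
  have 1: "2 * wp_gap y * (\<P> (y - d) - \<P> d) - \<gamma> = 0" if "y \<in> ball x r" for y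
    by (rule zero_factor[OF open_ball _ id nz that])
       (intro holomorphic_on_imp_continuous_on holomorphic_intros th Ph)
  from 1[of x] r(1) have "\<gamma> = 0" by (simp add: wp_gap_def eq)
  with 1 have id2: "wp_gap y * (\<P> (y - d) - \<P> d) = 0" if "y \<in> ball x r" for y
    using that by fastforce
  have 2: "\<P> (y - d) - \<P> d = 0" if "y \<in> ball x r" for y
    by (rule zero_factor[OF open_ball _ id2 nz that])
       (intro holomorphic_on_imp_continuous_on holomorphic_intros Ph)
  have "\<exists>y\<in>ball (x - d) r. \<P> y \<noteq> \<P> d"
  proof (rule wp_not_locally_constant)
    show "ball (x - d) r \<subseteq> - \<Lambda>"
    proof
      fix y assume "y \<in> ball (x - d) r"
      then have "y + d \<in> ball x r" by (simp add: dist_norm algebra_simps)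
      from y(2)[OF this] show "y \<in> - \<Lambda>" by simp
    qed
  qed (use r(1) in auto)
  then obtain y where y': "y \<in> ball (x - d) r" "\<P> y \<noteq> \<P> d" by blast
  then have "y + d \<in> ball x r" by (simp add: dist_norm algebra_simps)
  from 2[OF this] y'(2) show False by simp
qed

end

theorem wp_addition:
  assumes "d \<notin> \<Lambda>" "x \<notin> \<Lambda>" "x - d \<notin> \<Lambda>" "x + d \<notin> \<Lambda>"
  shows "(\<P> x - \<P> d)\<^sup>2 * (\<P> (x + d) + \<P> (x - d))
    = 2 * \<P> d * (\<P> x - \<P> d)\<^sup>2 + deriv (deriv \<P>) d * (\<P> x - \<P> d) + (deriv \<P> d)\<^sup>2"
  using wp_addition_aux[OF assms] unfolding wp_gap_def[OF assms(1)] wp_pair_def[OF assms(1)] .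

theorem deriv_wp_eq_0_iff: "d \<notin> \<Lambda> \<Longrightarrow> deriv \<P> d = 0 \<longleftrightarrow> 2 * d \<in> \<Lambda>"
  using half_period_if_deriv_wp_0_aux deriv_wp_half_period by blast

text \<open>
  If \<open>\<wp> x = \<wp> y\<close> and \<open>x\<close>, \<open>y\<close> are not congruent up to sign, the addition formula at \<open>x\<close> for the point \<open>y\<close>
  becomes \<open>0 = \<wp>' y\<^sup>2\<close>, and likewise with \<open>x\<close> and \<open>y\<close> exchanged. So both are half-periods.
\<close>

theorem wp_eq_iff:
  assumes "x \<notin> \<Lambda>" "y \<notin> \<Lambda>"
  shows "\<P> x = \<P> y \<longleftrightarrow> x - y \<in> \<Lambda> \<or> x + y \<in> \<Lambda>"
proof
  assume eq: "\<P> x = \<P> y"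
  show "x - y \<in> \<Lambda> \<or> x + y \<in> \<Lambda>"
  proof (rule ccontr)
    assume n: "\<not> ?thesis"
    then have "deriv \<P> y = 0"
      using wp_addition[of y x] assms eq by simp
    moreover have "deriv \<P> x = 0"
      using wp_addition[of x y] assms eq n lattice_minus_commute[of x y] by (simp add: add.commute)
    ultimately have "2 * x \<in> \<Lambda>" "2 * y \<in> \<Lambda>"
      using deriv_wp_eq_0_iff assms by auto
    with wp_eq_imp_congruent_aux[OF assms(2,1) eq] n show False by blast
  qed
next
  assume "x - y \<in> \<Lambda> \<or> x + y \<in> \<Lambda>"
  then show "\<P> x = \<P> y"
  proof
    assume "x - y \<in> \<Lambda>"
    from wp_periodic[OF this assms(2)] show ?thesis by simp
  next
    assume "x + y \<in> \<Lambda>"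
    from wp_periodic[OF this, of "- y"] assms(2) show ?thesis by (simp add: wp_even)
  qed
qed

section \<open>Half-periods\<close>

lemma int_combination_in_lattice_iff:
  "of_int p * w1 + of_int q * w3 \<in> \<Lambda> \<longleftrightarrow> even p \<and> even q"
proof
  assume "of_int p * w1 + of_int q * w3 \<in> \<Lambda>"
  then obtain i j where "of_int p * w1 + of_int q * w3 = 2 * of_int i * w1 + 2 * of_int j * w3"
    unfolding period_lattice_def by blast
  then have "of_real (real_of_int (p - 2 * i)) * w1 + of_real (real_of_int (q - 2 * j)) * w3 = 0"
    by (simp add: algebra_simps)
  then have "p - 2 * i = 0 \<and> q - 2 * j = 0"
    unfolding combination_eq_0_iff by linarith
  then show "even p \<and> even q" by presburger
next
  assume "even p \<and> even q"
  then obtain i j where "p = 2 * i" "q = 2 * j" by (auto elim!: evenE)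
  then show "of_int p * w1 + of_int q * w3 \<in> \<Lambda>"
    unfolding period_lattice_def by force
qed

lemma half_periods:
  "w1 \<notin> \<Lambda>" "w1 + w3 \<notin> \<Lambda>" "w3 \<notin> \<Lambda>"
  "2 * w1 \<in> \<Lambda>" "2 * (w1 + w3) \<in> \<Lambda>" "2 * w3 \<in> \<Lambda>"
  "w1 - (w1 + w3) \<notin> \<Lambda>" "w1 - w3 \<notin> \<Lambda>" "(w1 + w3) - w3 \<notin> \<Lambda>"
  "w1 + (w1 + w3) \<notin> \<Lambda>" "w1 + w3 + w3 \<notin> \<Lambda>"
  using int_combination_in_lattice_iff[of 1 0] int_combination_in_lattice_iff[of 1 1]
    int_combination_in_lattice_iff[of 0 1] int_combination_in_lattice_iff[of 2 0]
    int_combination_in_lattice_iff[of 2 2] int_combination_in_lattice_iff[of 0 2]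
    int_combination_in_lattice_iff[of 0 "-1"] int_combination_in_lattice_iff[of 1 "-1"]
    int_combination_in_lattice_iff[of 2 1] int_combination_in_lattice_iff[of 1 2]
  by (simp_all add: algebra_simps)

abbreviation "E1 \<equiv> e1 w1 w3"
abbreviation "E2 \<equiv> e2 w1 w3"
abbreviation "E3 \<equiv> e3 w1 w3"

lemma E_distinct: "E1 \<noteq> E2" "E1 \<noteq> E3" "E2 \<noteq> E3"
  unfolding e1_def e2_def e3_def
  using half_periods by (simp_all add: wp_eq_iff del: wp_def)

lemma E_roots:
  "4 * E1 ^ 3 - g2 * E1 - g3 = 0" "4 * E2 ^ 3 - g2 * E2 - g3 = 0" "4 * E3 ^ 3 - g2 * E3 - g3 = 0"
  unfolding e1_def e2_def e3_def
  using half_periods deriv_wp_half_period by (simp_all flip: deriv_wp_squared)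

text \<open>
  Three distinct roots of the Weierstrass cubic are all of its roots, so that its coefficients are the
  elementary symmetric functions of them, up to sign and the factor \<open>4\<close>.
\<close>

lemma cubic_roots_relations:
  fixes x y z g h :: complex
  assumes "x \<noteq> y" "x \<noteq> z" "y \<noteq> z"
    and "4 * x ^ 3 - g * x - h = 0" "4 * y ^ 3 - g * y - h = 0" "4 * z ^ 3 - g * z - h = 0"
  shows "x + y + z = 0" "g = - 4 * (x * y + x * z + y * z)" "h = 4 * x * y * z"
proof -
  have "(x - y) * (4 * (x\<^sup>2 + x * y + y\<^sup>2) - g) = (4 * x ^ 3 - g * x - h) - (4 * y ^ 3 - g * y - h)"
    by (simp add: power2_eq_square power3_eq_cube algebra_simps)
  then have xy: "4 * (x\<^sup>2 + x * y + y\<^sup>2) = g" using assms by simp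
  have "(x - z) * (4 * (x\<^sup>2 + x * z + z\<^sup>2) - g) = (4 * x ^ 3 - g * x - h) - (4 * z ^ 3 - g * z - h)"
    by (simp add: power2_eq_square power3_eq_cube algebra_simps)
  then have xz: "4 * (x\<^sup>2 + x * z + z\<^sup>2) = g" using assms by simp
  have "4 * ((y - z) * (x + y + z)) = 4 * (x\<^sup>2 + x * y + y\<^sup>2) - 4 * (x\<^sup>2 + x * z + z\<^sup>2)"
    by (simp add: power2_eq_square algebra_simps)
  also have "\<dots> = 0" by (simp only: xy xz) simp
  finally show s: "x + y + z = 0" using assms(3) by simp
  then have z: "z = - x - y" by (simp add: eq_neg_iff_add_eq_0 algebra_simps)
  show g: "g = - 4 * (x * y + x * z + y * z)"
    unfolding xy[symmetric] z by (simp add: power2_eq_square algebra_simps)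
  have "h = 4 * x ^ 3 - g * x" using assms(4) by simp
  then show "h = 4 * x * y * z"
    unfolding g z by (simp add: power2_eq_square power3_eq_cube algebra_simps)
qed

lemmas E_relations = cubic_roots_relations[OF E_distinct E_roots]

lemma deriv_wp_squared_factored:
  assumes "x \<notin> \<Lambda>"
  shows "(deriv \<P> x)\<^sup>2 = 4 * (\<P> x - E1) * (\<P> x - E2) * (\<P> x - E3)"
proof -
  have e: "E3 = - E1 - E2" using E_relations(1) by (simp add: eq_neg_iff_add_eq_0 algebra_simps)
  show ?thesis
    unfolding deriv_wp_squared[OF assms] E_relations(2,3) unfolding e
    by (simp add: power2_eq_square power3_eq_cube algebra_simps)
qed

lemma deriv2_wp_factored:
  assumes "x \<notin> \<Lambda>"
  shows "deriv (deriv \<P>) x = 2 * ((\<P> x - E2) * (\<P> x - E3) + (\<P> x - E1) * (\<P> x - E3)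
     + (\<P> x - E1) * (\<P> x - E2))"
proof -
  have e: "E3 = - E1 - E2" using E_relations(1) by (simp add: eq_neg_iff_add_eq_0 algebra_simps)
  show ?thesis
    unfolding deriv2_wp[OF assms] E_relations(2) unfolding e
    by (simp add: power2_eq_square algebra_simps)
qed

section \<open>The coordinate z\<close>

definition \<kappa> :: complex where "\<kappa> = E2 - E1"
definition modulus :: complex where "modulus = (E3 - E1) / \<kappa>"
abbreviation "Z \<equiv> zcoord w1 w3"

lemma \<kappa>_nz: "\<kappa> \<noteq> 0" using E_distinct by (simp add: \<kappa>_def)

lemma E_eq: "E2 = E1 + \<kappa>" "E3 = E1 + \<kappa> * modulus"
  using \<kappa>_nz by (simp_all add: modulus_def) (simp add: \<kappa>_def)

lemma wp_zcoord: "\<P> x = E1 + \<kappa> * Z x"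
  using \<kappa>_nz by (simp add: zcoord_def \<kappa>_def)

lemma zcoord_holomorphic: "Z holomorphic_on - \<Lambda>"
  unfolding zcoord_def[abs_def] using E_distinct by (intro holomorphic_intros wp_holomorphic) auto

lemma deriv_zcoord: "x \<notin> \<Lambda> \<Longrightarrow> deriv Z x = deriv \<P> x / \<kappa>"
  unfolding zcoord_def[abs_def] \<kappa>_def[symmetric]
  by (rule DERIV_imp_deriv) (auto intro!: derivative_eq_intros wp_has_deriv \<kappa>_nz)

lemma deriv2_zcoord: "x \<notin> \<Lambda> \<Longrightarrow> deriv (deriv Z) x = deriv (deriv \<P>) x / \<kappa>"
proof (rule DERIV_imp_deriv)
  assume x: "x \<notin> \<Lambda>"
  have "((\<lambda>x. deriv \<P> x / \<kappa>) has_field_derivative deriv (deriv \<P>) x / \<kappa>) (at x)"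
    by (rule DERIV_cdivide[OF deriv_wp_has_deriv[OF x]])
  then show "(deriv Z has_field_derivative deriv (deriv \<P>) x / \<kappa>) (at x)"
    by (rule has_field_derivative_transform_within_open[OF _ open_off_lattice])
       (use x in \<open>auto simp: deriv_zcoord\<close>)
qed

lemma wp_at_zcoord:
  assumes "x \<notin> \<Lambda>"
  shows "(deriv \<P> x)\<^sup>2 = 4 * \<kappa> ^ 3 * cubic modulus (Z x)"
    "deriv (deriv \<P>) x = 2 * \<kappa>\<^sup>2 * deriv (cubic modulus) (Z x)"
  unfolding deriv_wp_squared_factored[OF assms] deriv2_wp_factored[OF assms] wp_zcoord E_eq cubic_def
    deriv_cubic
  by (simp_all add: power2_eq_square power3_eq_cube algebra_simps)

lemma zcoord_ode:
  assumes "x \<notin> \<Lambda>"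
  shows "(deriv Z x)\<^sup>2 = 4 * \<kappa> * cubic modulus (Z x)"
    "deriv (deriv Z) x = 4 * \<kappa> / 2 * deriv (cubic modulus) (Z x)"
  using \<kappa>_nz unfolding deriv_zcoord[OF assms] deriv2_zcoord[OF assms] power_divide wp_at_zcoord[OF assms]
  by (simp_all add: power2_eq_square power3_eq_cube)

lemma zcoord_eq_iff:
  assumes "x \<notin> \<Lambda>" "y \<notin> \<Lambda>"
  shows "Z x = Z y \<longleftrightarrow> x - y \<in> \<Lambda> \<or> x + y \<in> \<Lambda>"
  using wp_eq_iff[OF assms] \<kappa>_nz unfolding wp_zcoord by simp

lemma zcoord_half_periods: "Z w1 = 0" "Z (w1 + w3) = 1" "Z w3 = modulus"
  using E_distinct unfolding zcoord_def modulus_def \<kappa>_def by (auto simp: e1_def e2_def e3_def)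

lemma half_period_shift_in_lattice: "2 * w \<in> \<Lambda> \<Longrightarrow> x + w \<in> \<Lambda> \<longleftrightarrow> x - w \<in> \<Lambda>"
  using lattice_add_right_iff[of "2 * w" "x - w"] by (simp add: algebra_simps)

text \<open>
  The addition formula for \<open>d = w\<close>: both shifted values coincide and \<open>\<wp>' w = 0\<close>, so that a factor
  \<open>\<wp> x - \<wp> w\<close> cancels.
\<close>

lemma wp_half_period_shift:
  assumes x: "x \<notin> \<Lambda>" and w: "w \<notin> \<Lambda>" "2 * w \<in> \<Lambda>" and xw: "x - w \<notin> \<Lambda>"
  shows "\<P> (x - w) = \<P> w + \<kappa> * deriv (cubic modulus) (Z w) / (Z x - Z w)"
proof -
  have xw': "x + w \<notin> \<Lambda>" using xw half_period_shift_in_lattice[OF w(2)] by simp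
  have t: "\<P> x - \<P> w = \<kappa> * (Z x - Z w)" by (simp add: wp_zcoord algebra_simps)
  have ne: "Z x - Z w \<noteq> 0" using zcoord_eq_iff[OF x w(1)] xw xw' by simp
  have eq: "\<P> (x + w) = \<P> (x - w)"
    using wp_periodic[OF w(2) xw] by (simp add: algebra_simps)
  have "(\<kappa> * (Z x - Z w))\<^sup>2 * (2 * \<P> (x - w)) = 2 * \<P> w * (\<kappa> * (Z x - Z w))\<^sup>2
      + 2 * \<kappa>\<^sup>2 * deriv (cubic modulus) (Z w) * (\<kappa> * (Z x - Z w))"
    using wp_addition[OF w(1) x xw xw'] deriv_wp_half_period[OF w]
    unfolding t eq wp_at_zcoord(2)[OF w(1)] by simp
  then have "(2 * \<kappa>\<^sup>2 * (Z x - Z w)) * ((Z x - Z w) * (\<P> (x - w) - \<P> w) - \<kappa> * deriv (cubic modulus) (Z w)) = 0"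
    by (simp add: power2_eq_square algebra_simps)
  then have "(Z x - Z w) * (\<P> (x - w) - \<P> w) = \<kappa> * deriv (cubic modulus) (Z w)"
    using ne \<kappa>_nz by simp
  then show ?thesis using ne by (simp add: field_simps)
qed

lemma wp_pair_shift:
  assumes x: "x \<notin> \<Lambda>" "d \<notin> \<Lambda>" "x - d \<notin> \<Lambda>" "x + d \<notin> \<Lambda>"
  shows "\<P> (x - d) + \<P> (x + d) = 2 * \<P> d + 4 * \<kappa> * (cubic modulus (Z d) / (Z x - Z d)\<^sup>2
       + deriv (cubic modulus) (Z d) / (2 * (Z x - Z d)))"
proof -
  have t: "\<P> x - \<P> d = \<kappa> * (Z x - Z d)" by (simp add: wp_zcoord algebra_simps)
  define s where "s = Z x - Z d"
  have ne: "s \<noteq> 0" using zcoord_eq_iff[OF x(1,2)] x(3,4) by (simp add: s_def)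
  define p q where "p = cubic modulus (Z d)" and "q = deriv (cubic modulus) (Z d)"
  have "(\<kappa> * s)\<^sup>2 * (\<P> (x + d) + \<P> (x - d)) = 2 * \<P> d * (\<kappa> * s)\<^sup>2
      + 2 * \<kappa>\<^sup>2 * q * (\<kappa> * s) + 4 * \<kappa> ^ 3 * p"
    using wp_addition[OF x(2,1,3,4)] unfolding t wp_at_zcoord[OF x(2)] s_def p_def q_def .
  also have "\<dots> = (\<kappa> * s)\<^sup>2 * (2 * \<P> d + 4 * \<kappa> * (p / s\<^sup>2 + q / (2 * s)))"
    using ne by (simp add: field_simps power2_eq_square power3_eq_cube)
  finally have "\<P> (x + d) + \<P> (x - d) = 2 * \<P> d + 4 * \<kappa> * (p / s\<^sup>2 + q / (2 * s))"
    using ne \<kappa>_nz by simp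
  then show ?thesis by (simp add: s_def p_def q_def add.commute)
qed

section \<open>The potential in the coordinate z\<close>

definition singular_points :: "nat \<Rightarrow> (nat \<Rightarrow> complex) \<Rightarrow> complex set" where
  "singular_points M \<delta> = {0, w1, w1 + w3, w3} \<union> \<delta> ` {1..M} \<union> (\<lambda>k. - \<delta> k) ` {1..M}"

lemma potential_domain_eq: "potential_domain w1 w3 M \<delta> = - congruent_to (singular_points M \<delta>)"
  by (auto simp: potential_domain_def congruent_to_def singular_points_def)

lemma open_potential_domain: "open (potential_domain w1 w3 M \<delta>)"
  unfolding potential_domain_eq
  by (intro open_Compl closed_sub_congruent[OF _ order_refl]) (simp add: singular_points_def)

lemma countable_congruent: "finite K \<Longrightarrow> countable (congruent_to K)"
proof -
  assume "finite K"
  then have "countable (\<Union>p\<in>K. (+) p ` \<Lambda>)"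
    by (intro countable_UN countable_image countable_lattice countable_finite)
  moreover have "congruent_to K \<subseteq> (\<Union>p\<in>K. (+) p ` \<Lambda>)"
  proof
    fix x assume "x \<in> congruent_to K"
    then obtain p where "p \<in> K" "x - p \<in> \<Lambda>" unfolding congruent_to_def by blast
    then show "x \<in> (\<Union>p\<in>K. (+) p ` \<Lambda>)" by (intro UN_I[of p] image_eqI[of _ _ "x - p"]) auto
  qed
  ultimately show ?thesis by (rule countable_subset[rotated])
qed

lemma connected_potential_domain: "connected (potential_domain w1 w3 M \<delta>)"
  and potential_domain_nonempty: "potential_domain w1 w3 M \<delta> \<noteq> {}"
proof -
  have c: "countable (congruent_to (singular_points M \<delta>))"
    by (intro countable_congruent) (simp add: singular_points_def)
  show "connected (potential_domain w1 w3 M \<delta>)"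
    unfolding potential_domain_eq
    by (intro path_connected_imp_connected path_connected_complement_countable c) simp
  show "potential_domain w1 w3 M \<delta> \<noteq> {}"
  proof
    assume "potential_domain w1 w3 M \<delta> = {}"
    then have "congruent_to (singular_points M \<delta>) = UNIV"
      unfolding potential_domain_eq by blast
    with c show False using uncountable_UNIV_complex by simp
  qed
qed

lemma potential_domainD:
  assumes "x \<in> potential_domain w1 w3 M \<delta>"
  shows "x \<notin> \<Lambda>" "x - w1 \<notin> \<Lambda>" "x - (w1 + w3) \<notin> \<Lambda>" "x - w3 \<notin> \<Lambda>"
    "k \<in> {1..M} \<Longrightarrow> x - \<delta> k \<notin> \<Lambda>" "k \<in> {1..M} \<Longrightarrow> x + \<delta> k \<notin> \<Lambda>"
proof -
  have *: "x - p \<notin> \<Lambda>" if "p \<in> singular_points M \<delta>" for p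
    using assms that by (auto simp: potential_domain_eq congruent_to_def)
  show "x \<notin> \<Lambda>" "x - w1 \<notin> \<Lambda>" "x - (w1 + w3) \<notin> \<Lambda>" "x - w3 \<notin> \<Lambda>"
    "k \<in> {1..M} \<Longrightarrow> x - \<delta> k \<notin> \<Lambda>" "k \<in> {1..M} \<Longrightarrow> x + \<delta> k \<notin> \<Lambda>"
    using *[of 0] *[of w1] *[of "w1 + w3"] *[of w3] *[of "\<delta> k"] *[of "- \<delta> k"]
    by (auto simp: singular_points_def)
qed

context
  fixes M :: nat and m n :: "nat \<Rightarrow> nat" and b \<delta> :: "nat \<Rightarrow> complex"
  assumes \<delta>: "\<And>k. k \<in> {1..M} \<Longrightarrow> \<delta> k \<notin> \<Lambda>" "\<And>k. k \<in> {1..M} \<Longrightarrow> Z (\<delta> k) = b k"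
begin

lemma zcoord_potential_domain:
  assumes x: "x \<in> potential_domain w1 w3 M \<delta>"
  shows "Z x \<in> fuchs_domain modulus M b"
proof -
  note D = potential_domainD[OF x]
  have "Z x \<noteq> Z w1" "Z x \<noteq> Z (w1 + w3)" "Z x \<noteq> Z w3"
    using D half_periods half_period_shift_in_lattice by (auto simp: zcoord_eq_iff)
  moreover have "Z x \<noteq> b k" if "k \<in> {1..M}" for k
    using D(1) D(5,6)[OF that] \<delta>(1)[OF that] unfolding \<delta>(2)[OF that, symmetric]
    by (simp add: zcoord_eq_iff)
  then have "Z x \<notin> b ` {1..M}" by blast
  ultimately show ?thesis
    by (simp add: fuchs_domain_def zcoord_half_periods)
qed

text \<open>
  Each half-period summand of the potential is a Moebius function of \<open>z\<close>, and each pair of summands at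
  \<open>\<delta> k\<close> and \<open>- \<delta> k\<close> has principal parts of order two and one at \<open>z = b k\<close>. Up to constants these are the
  summands of \<open>I\<^sub>0\<close>, multiplied by \<open>4 \<kappa>\<close>.
\<close>

lemma potential_eq:
  "\<exists>C. \<forall>x\<in>potential_domain w1 w3 M \<delta>.
     potential w1 w3 m M n \<delta> x = 4 * \<kappa> * fuchs_I0 modulus m M n b (Z x) + C"
proof -
  define c0 c1 c2 c3 ck where "c0 = complex_of_nat (m 0 * (m 0 + 1))" and "c1 = complex_of_nat (m 1 * (m 1 + 1))"
    and "c2 = complex_of_nat (m 2 * (m 2 + 1))" and "c3 = complex_of_nat (m 3 * (m 3 + 1))"
    and "ck = (\<lambda>k. complex_of_nat (n k * (n k + 1)))"
  define C where "C = c0 * E1 + c1 * E1 + c2 * (E2 - \<kappa>) + c3 * (E3 - \<kappa> * modulus)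
     + (\<Sum>k=1..M. ck k * (2 * \<P> (\<delta> k)))"
  have "potential w1 w3 m M n \<delta> x = 4 * \<kappa> * fuchs_I0 modulus m M n b (Z x) + C"
    if x: "x \<in> potential_domain w1 w3 M \<delta>" for x
  proof -
    note D = potential_domainD[OF x]
    define z where "z = Z x"
    have "z \<in> fuchs_domain modulus M b" unfolding z_def by (rule zcoord_potential_domain[OF x])
    then have z: "z \<noteq> 0" "z - 1 \<noteq> 0" "z - modulus \<noteq> 0" by (auto simp: fuchs_domain_def)
    have s1: "\<P> (x - w1) = E1 + \<kappa> * (modulus / z)"
      using wp_half_period_shift[OF D(1) half_periods(1,4) D(2)]
      by (simp add: zcoord_half_periods deriv_cubic z_def e1_def)
    have "\<P> (x - (w1 + w3)) = E2 + \<kappa> * ((1 - modulus) / (z - 1))"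
      using wp_half_period_shift[OF D(1) half_periods(2,5) D(3)]
      by (simp add: zcoord_half_periods deriv_cubic z_def e2_def algebra_simps)
    also have "(1 - modulus) / (z - 1) = (z - modulus) / (z - 1) - 1"
      using z by (simp add: field_simps)
    finally have s2: "\<P> (x - (w1 + w3)) = (E2 - \<kappa>) + \<kappa> * ((z - modulus) / (z - 1))"
      by (simp add: algebra_simps)
    have "\<P> (x - w3) = E3 + \<kappa> * ((modulus\<^sup>2 - modulus) / (z - modulus))"
      using wp_half_period_shift[OF D(1) half_periods(3,6) D(4)]
      by (simp add: zcoord_half_periods deriv_cubic z_def e3_def power2_eq_square algebra_simps)
    also have "(modulus\<^sup>2 - modulus) / (z - modulus) = modulus * (z - 1) / (z - modulus) - modulus"
      using z by (simp add: field_simps power2_eq_square)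
    finally have s3: "\<P> (x - w3) = (E3 - \<kappa> * modulus) + \<kappa> * (modulus * (z - 1) / (z - modulus))"
      by (simp add: algebra_simps)
    have sk: "\<P> (x - \<delta> k) + \<P> (x + \<delta> k) = 2 * \<P> (\<delta> k) + 4 * \<kappa> *
        (b k * (b k - 1) * (b k - modulus) / (z - b k)\<^sup>2
         + (3 * (b k)\<^sup>2 - 2 * (modulus + 1) * b k + modulus) / (2 * (z - b k)))" if k: "k \<in> {1..M}" for k
      using wp_pair_shift[OF D(1) \<delta>(1)[OF k] D(5,6)[OF k]]
      unfolding \<delta>(2)[OF k] z_def deriv_cubic cubic_def .
    have "(\<Sum>k=1..M. ck k * (\<P> (x - \<delta> k) + \<P> (x + \<delta> k)))
        = (\<Sum>k=1..M. ck k * (2 * \<P> (\<delta> k) + 4 * \<kappa> * (b k * (b k - 1) * (b k - modulus) / (z - b k)\<^sup>2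
         + (3 * (b k)\<^sup>2 - 2 * (modulus + 1) * b k + modulus) / (2 * (z - b k)))))"
      by (intro sum.cong refl) (simp only: sk)
    also have "\<dots> = (\<Sum>k=1..M. ck k * (2 * \<P> (\<delta> k))) + 4 * \<kappa> * (\<Sum>k=1..M. ck k *
        (b k * (b k - 1) * (b k - modulus) / (z - b k)\<^sup>2
         + (3 * (b k)\<^sup>2 - 2 * (modulus + 1) * b k + modulus) / (2 * (z - b k))))"
      unfolding sum_distrib_left sum.distrib[symmetric]
      by (intro sum.cong refl) (simp only: distrib_left mult.left_commute)
    finally have S: "(\<Sum>k=1..M. ck k * (\<P> (x - \<delta> k) + \<P> (x + \<delta> k))) = \<dots>" .
    define q1 q2 q3 where "q1 = modulus / z" and "q2 = (z - modulus) / (z - 1)"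
      and "q3 = modulus * (z - 1) / (z - modulus)"
    show ?thesis
      unfolding potential_def fuchs_I0_def C_def z_def[symmetric] s1 s2 s3 wp_zcoord[of x]
        c0_def[symmetric] c1_def[symmetric] c2_def[symmetric] c3_def[symmetric]
        fun_cong[OF ck_def, symmetric] S q1_def[symmetric] q2_def[symmetric] q3_def[symmetric]
      by (simp add: algebra_simps)
  qed
  then show ?thesis by blast
qed

theorem finite_gap_potential_iff_novikov:
  "finite_gap (potential w1 w3 m M n \<delta>) (potential_domain w1 w3 M \<delta>) \<longleftrightarrow>
   (\<exists>g. novikov_equation modulus (fuchs_I0 modulus m M n b) (fuchs_domain modulus M b) g)"
proof -
  obtain C where C: "\<And>x. x \<in> potential_domain w1 w3 M \<delta> \<Longrightarrow>
     potential w1 w3 m M n \<delta> x = 4 * \<kappa> * fuchs_I0 modulus m M n b (Z x) + C"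
    using potential_eq by blast
  have Z: "Z holomorphic_on potential_domain w1 w3 M \<delta>"
    by (rule holomorphic_on_subset[OF zcoord_holomorphic]) (use potential_domainD in blast)
  have fin: "finite ({0, 1, modulus} \<union> b ` {1..M})" by simp
  have S: "open (fuchs_domain modulus M b)" "connected (fuchs_domain modulus M b)"
    unfolding fuchs_domain_def
    by (intro open_Compl finite_imp_closed fin)
       (intro path_connected_imp_connected path_connected_complement_countable
          countable_finite fin, simp)
  have I: "fuchs_I0 modulus m M n b holomorphic_on fuchs_domain modulus M b"
    unfolding fuchs_I0_def[abs_def]
    by (intro holomorphic_intros) (auto simp: fuchs_domain_def)
  show ?thesis
    by (rule finite_gap_iff_novikov[OF open_potential_domain connected_potential_domain
          potential_domain_nonempty Z _ S _ I _ _ C])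
       (use zcoord_potential_domain zcoord_ode potential_domainD(1) \<kappa>_nz in
         \<open>auto simp: fuchs_domain_def\<close>)
qed

end

end

section \<open>Partial fractions of the conjugated operator\<close>

lemma double_sum_off_diagonal_swap:
  fixes f :: "'a \<Rightarrow> 'a \<Rightarrow> complex"
  assumes "finite A"
  shows "(\<Sum>i\<in>A. \<Sum>j\<in>A - {i}. f i j) = (\<Sum>i\<in>A. \<Sum>j\<in>A - {i}. f j i)"
proof -
  have e: "(\<Sum>i\<in>A. \<Sum>j\<in>A - {i}. g i j) = (\<Sum>i\<in>A. \<Sum>j\<in>A. if i \<noteq> j then g i j else 0)"
    for g :: "'a \<Rightarrow> 'a \<Rightarrow> complex"
    using assms by (intro sum.cong refl sum.mono_neutral_cong_left) auto
  show ?thesis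
    unfolding e by (subst sum.swap) (intro sum.cong refl, auto)
qed

context
  fixes A :: "nat set" and c \<mu> :: "nat \<Rightarrow> complex"
  assumes A: "finite A" and inj: "inj_on c A"
begin

text \<open>
  The residues of the square of \<open>\<Sum>i. \<mu> i / (z - c i)\<close> are \<open>2 * \<mu> i * pole_coupling i\<close>.
\<close>

definition pole_coupling :: "nat \<Rightarrow> complex" where
  "pole_coupling i = (\<Sum>j\<in>A - {i}. \<mu> j / (c i - c j))"

lemma square_of_simple_poles:
  assumes z: "z \<notin> c ` A"
  shows "(\<Sum>i\<in>A. \<mu> i / (z - c i))\<^sup>2
    = (\<Sum>i\<in>A. (\<mu> i)\<^sup>2 / (z - c i)\<^sup>2 + 2 * \<mu> i * pole_coupling i / (z - c i))"
proof -
  have nz: "z - c i \<noteq> 0" if "i \<in> A" for i using z that by auto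
  have "(\<Sum>i\<in>A. \<mu> i / (z - c i))\<^sup>2 = (\<Sum>i\<in>A. \<Sum>j\<in>A. \<mu> i / (z - c i) * (\<mu> j / (z - c j)))"
    by (simp add: power2_eq_square sum_product)
  also have "\<dots> = (\<Sum>i\<in>A. (\<mu> i)\<^sup>2 / (z - c i)\<^sup>2
      + (\<Sum>j\<in>A - {i}. \<mu> i / (z - c i) * (\<mu> j / (z - c j))))"
    using A by (intro sum.cong refl, subst sum.remove) (auto simp: power2_eq_square)
  also have "\<dots> = (\<Sum>i\<in>A. (\<mu> i)\<^sup>2 / (z - c i)\<^sup>2)
      + (\<Sum>i\<in>A. \<Sum>j\<in>A - {i}. \<mu> i / (z - c i) * (\<mu> j / (z - c j)))"
    by (rule sum.distrib)
  also have "(\<Sum>i\<in>A. \<Sum>j\<in>A - {i}. \<mu> i / (z - c i) * (\<mu> j / (z - c j)))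
      = (\<Sum>i\<in>A. \<Sum>j\<in>A - {i}. \<mu> i * \<mu> j / (c i - c j) / (z - c i) + \<mu> j * \<mu> i / (c j - c i) / (z - c j))"
  proof (intro sum.cong refl)
    fix i j assume "i \<in> A" "j \<in> A - {i}"
    then have n: "z - c i \<noteq> 0" "z - c j \<noteq> 0" "c i - c j \<noteq> 0" "c j - c i \<noteq> 0"
      using nz inj by (auto simp: inj_on_def)
    have e: "c j - c i = - (c i - c j)" by simp
    show "\<mu> i / (z - c i) * (\<mu> j / (z - c j))
      = \<mu> i * \<mu> j / (c i - c j) / (z - c i) + \<mu> j * \<mu> i / (c j - c i) / (z - c j)"
      unfolding e using n by (simp add: divide_simps) (simp add: algebra_simps)
  qed
  also have "\<dots> = (\<Sum>i\<in>A. \<Sum>j\<in>A - {i}. \<mu> i * \<mu> j / (c i - c j) / (z - c i))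
      + (\<Sum>i\<in>A. \<Sum>j\<in>A - {i}. \<mu> j * \<mu> i / (c j - c i) / (z - c j))"
    by (simp add: sum.distrib)
  also have "(\<Sum>i\<in>A. \<Sum>j\<in>A - {i}. \<mu> j * \<mu> i / (c j - c i) / (z - c j))
      = (\<Sum>i\<in>A. \<Sum>j\<in>A - {i}. \<mu> i * \<mu> j / (c i - c j) / (z - c i))"
    by (rule double_sum_off_diagonal_swap[OF A])
  also have "(\<Sum>i\<in>A. \<Sum>j\<in>A - {i}. \<mu> i * \<mu> j / (c i - c j) / (z - c i))
      = (\<Sum>i\<in>A. \<mu> i * pole_coupling i / (z - c i))"
    by (simp add: pole_coupling_def sum_distrib_left sum_divide_distrib)
  finally show ?thesis
    by (simp add: sum.distrib mult.assoc flip: sum_distrib_left times_divide_eq_right)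
qed

lemma sum_pole_coupling: "(\<Sum>i\<in>A. \<mu> i * pole_coupling i) = 0"
proof -
  define f where "f = (\<lambda>i j. \<mu> i * \<mu> j / (c i - c j))"
  have eq: "(\<Sum>i\<in>A. \<mu> i * pole_coupling i) = (\<Sum>i\<in>A. \<Sum>j\<in>A - {i}. f i j)"
    by (simp add: pole_coupling_def f_def sum_distrib_left)
  have anti: "f j i = - f i j" for i j
  proof -
    have "c j - c i = - (c i - c j)" by simp
    then show ?thesis unfolding f_def by (simp only: divide_minus_right mult.commute)
  qed
  have "(\<Sum>i\<in>A. \<Sum>j\<in>A - {i}. f i j) = (\<Sum>i\<in>A. \<Sum>j\<in>A - {i}. f j i)"
    by (rule double_sum_off_diagonal_swap[OF A])
  also have "\<dots> = (\<Sum>i\<in>A. \<Sum>j\<in>A - {i}. - f i j)"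
    by (intro sum.cong refl anti)
  also have "\<dots> = - (\<Sum>i\<in>A. \<Sum>j\<in>A - {i}. f i j)"
    by (simp only: sum_negf)
  finally show ?thesis unfolding eq by simp
qed

text \<open>
  Exchanging the two indices turns \<open>c i / (c i - c j) + c j / (c j - c i)\<close> into \<open>1\<close>, which leaves the sum of
  all products \<open>\<mu> i * \<mu> j\<close> with \<open>i \<noteq> j\<close>.
\<close>

lemma sum_pole_coupling_moment:
  "2 * (\<Sum>i\<in>A. \<mu> i * pole_coupling i * c i) = (\<Sum>i\<in>A. \<mu> i)\<^sup>2 - (\<Sum>i\<in>A. (\<mu> i)\<^sup>2)"
proof -
  define f where "f = (\<lambda>i j. \<mu> i * \<mu> j / (c i - c j) * c i)"
  have "(\<Sum>i\<in>A. \<mu> i * pole_coupling i * c i) = (\<Sum>i\<in>A. \<Sum>j\<in>A - {i}. f i j)"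
    by (simp add: pole_coupling_def f_def sum_distrib_left sum_distrib_right)
  moreover have "(\<Sum>i\<in>A. \<Sum>j\<in>A - {i}. f i j) = (\<Sum>i\<in>A. \<Sum>j\<in>A - {i}. f j i)"
    by (rule double_sum_off_diagonal_swap[OF A])
  ultimately have "2 * (\<Sum>i\<in>A. \<mu> i * pole_coupling i * c i) = (\<Sum>i\<in>A. \<Sum>j\<in>A - {i}. f i j + f j i)"
    by (simp add: sum.distrib)
  also have "\<dots> = (\<Sum>i\<in>A. \<Sum>j\<in>A - {i}. \<mu> i * \<mu> j)"
  proof (intro sum.cong refl)
    fix i j assume "i \<in> A" "j \<in> A - {i}"
    then have n: "c i - c j \<noteq> 0" using inj by (auto simp: inj_on_def)
    have e: "c j - c i = - (c i - c j)" by simp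
    have "f i j + f j i = \<mu> i * \<mu> j / (c i - c j) * c i - \<mu> i * \<mu> j / (c i - c j) * c j"
      unfolding f_def e by (simp add: mult.commute del: minus_diff_eq)
    also have "\<dots> = \<mu> i * \<mu> j / (c i - c j) * (c i - c j)"
      by (rule right_diff_distrib[symmetric])
    finally show "f i j + f j i = \<mu> i * \<mu> j" using n by simp
  qed
  also have "\<dots> = (\<Sum>i\<in>A. (\<Sum>j\<in>A. \<mu> i * \<mu> j) - (\<mu> i)\<^sup>2)"
    using A by (intro sum.cong refl, subst (2) sum.remove) (auto simp: power2_eq_square)
  also have "\<dots> = (\<Sum>i\<in>A. \<mu> i)\<^sup>2 - (\<Sum>i\<in>A. (\<mu> i)\<^sup>2)"
    by (simp add: sum_subtractf power2_eq_square sum_product)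
  finally show ?thesis .
qed

text \<open>
  The left-hand side is the zeroth-order coefficient of the operator \<open>p y'' + p' y' / 2\<close> conjugated by the
  product of the \<open>(z - c i)\<close> to the powers \<open>- \<mu> i\<close>. Its polar part at each \<open>c i\<close> comes from the Taylor
  expansion of the cubic there. In the polynomial part the quadratic term cancels by
  \<open>sum_pole_coupling\<close>, and \<open>sum_pole_coupling_moment\<close> gives the coefficient of \<open>z\<close>.
\<close>

lemma conjugated_operator_partial_fractions:
  "\<exists>K. \<forall>z. z \<notin> c ` A \<longrightarrow>
     cubic a z * ((\<Sum>i\<in>A. \<mu> i / (z - c i)\<^sup>2) + (\<Sum>i\<in>A. \<mu> i / (z - c i))\<^sup>2)
     - deriv (cubic a) z / 2 * (\<Sum>i\<in>A. \<mu> i / (z - c i))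
     = (\<Sum>i\<in>A. \<mu> i * (\<mu> i + 1) * cubic a (c i) / (z - c i)\<^sup>2
          + (\<mu> i * (\<mu> i + 1 / 2) * deriv (cubic a) (c i)
             + 2 * \<mu> i * pole_coupling i * cubic a (c i)) / (z - c i))
       + ((\<Sum>i\<in>A. \<mu> i)\<^sup>2 - (\<Sum>i\<in>A. \<mu> i) / 2) * z + K"
proof -
  define q where "q = (\<lambda>i. 3 * c i - (a + 1))"
  define D where "D = pole_coupling"
  define k0 where "k0 = (\<lambda>i. \<mu> i * (\<mu> i + 1) * (q i - c i)
      + 2 * \<mu> i * D i * (deriv (cubic a) (c i) - q i * c i + (c i)\<^sup>2) - \<mu> i / 2 * (2 * q i - 3 * c i))"
  have expand: "cubic a z * (\<mu> i / h\<^sup>2 + (\<mu> i)\<^sup>2 / h\<^sup>2 + 2 * \<mu> i * D i / h) - deriv (cubic a) z / 2 * (\<mu> i / h)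
    = \<mu> i * (\<mu> i + 1) * cubic a (c i) / h\<^sup>2
          + (\<mu> i * (\<mu> i + 1 / 2) * deriv (cubic a) (c i) + 2 * \<mu> i * D i * cubic a (c i)) / h
      + (2 * (\<mu> i * D i) * (z\<^sup>2 - (a + 1) * z) + (2 * (\<mu> i * D i * c i) + (\<mu> i)\<^sup>2 - \<mu> i / 2) * z + k0 i)"
    if h: "h = z - c i" "h \<noteq> 0" for z h i
  proof -
    have p: "cubic a z = cubic a (c i) + deriv (cubic a) (c i) * h + q i * h\<^sup>2 + h ^ 3"
      "deriv (cubic a) z = deriv (cubic a) (c i) + 2 * q i * h + 3 * h\<^sup>2"
      unfolding h(1) cubic_def deriv_cubic q_def by (simp_all add: power2_eq_square power3_eq_cube algebra_simps)
    define P P' where "P = cubic a (c i)" and "P' = deriv (cubic a) (c i)"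
    define M where "M = \<mu> i"
    define d where "d = D i"
    have "(P + P' * h + q i * h\<^sup>2 + h ^ 3) * (M / h\<^sup>2 + M\<^sup>2 / h\<^sup>2 + 2 * M * d / h)
        - (P' + 2 * q i * h + 3 * h\<^sup>2) / 2 * (M / h)
      = M * (M + 1) * P / h\<^sup>2 + (M * (M + 1 / 2) * P' + 2 * M * d * P) / h
       + (M * (M + 1) * (q i + h) + 2 * M * d * (P' + q i * h + h\<^sup>2) - M / 2 * (2 * q i + 3 * h))"
      using h(2) by (simp add: field_simps power2_eq_square power3_eq_cube)
    also have "M * (M + 1) * (q i + h) + 2 * M * d * (P' + q i * h + h\<^sup>2) - M / 2 * (2 * q i + 3 * h)
      = 2 * (M * d) * (z\<^sup>2 - (a + 1) * z) + (2 * (M * d * c i) + M\<^sup>2 - M / 2) * z + k0 i"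
      unfolding k0_def h(1) M_def d_def P'_def q_def by (simp add: field_simps power2_eq_square)
    finally show ?thesis
      unfolding p P_def P'_def M_def d_def .
  qed
  have main: "cubic a z * ((\<Sum>i\<in>A. \<mu> i / (z - c i)\<^sup>2) + (\<Sum>i\<in>A. \<mu> i / (z - c i))\<^sup>2)
     - deriv (cubic a) z / 2 * (\<Sum>i\<in>A. \<mu> i / (z - c i))
     = (\<Sum>i\<in>A. \<mu> i * (\<mu> i + 1) * cubic a (c i) / (z - c i)\<^sup>2
          + (\<mu> i * (\<mu> i + 1 / 2) * deriv (cubic a) (c i)
             + 2 * \<mu> i * D i * cubic a (c i)) / (z - c i))
       + ((\<Sum>i\<in>A. \<mu> i)\<^sup>2 - (\<Sum>i\<in>A. \<mu> i) / 2) * z + (\<Sum>i\<in>A. k0 i)"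
    if z: "z \<notin> c ` A" for z
  proof -
    have nz: "z - c i \<noteq> 0" if "i \<in> A" for i using z that by auto
    have "cubic a z * ((\<Sum>i\<in>A. \<mu> i / (z - c i)\<^sup>2) + (\<Sum>i\<in>A. \<mu> i / (z - c i))\<^sup>2)
     - deriv (cubic a) z / 2 * (\<Sum>i\<in>A. \<mu> i / (z - c i))
     = (\<Sum>i\<in>A. cubic a z * (\<mu> i / (z - c i)\<^sup>2 + (\<mu> i)\<^sup>2 / (z - c i)\<^sup>2 + 2 * \<mu> i * D i / (z - c i))
          - deriv (cubic a) z / 2 * (\<mu> i / (z - c i)))"
      unfolding square_of_simple_poles[OF z] D_def sum.distrib[symmetric] sum_distrib_left sum_subtractf[symmetric]
      by (simp add: add.assoc)
    also have "\<dots> = (\<Sum>i\<in>A. (\<mu> i * (\<mu> i + 1) * cubic a (c i) / (z - c i)\<^sup>2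
          + (\<mu> i * (\<mu> i + 1 / 2) * deriv (cubic a) (c i) + 2 * \<mu> i * D i * cubic a (c i)) / (z - c i))
      + (2 * (\<mu> i * D i) * (z\<^sup>2 - (a + 1) * z) + (2 * (\<mu> i * D i * c i) + (\<mu> i)\<^sup>2 - \<mu> i / 2) * z + k0 i))"
      by (intro sum.cong refl expand nz)
    also have "\<dots> = (\<Sum>i\<in>A. (\<mu> i * (\<mu> i + 1) * cubic a (c i) / (z - c i)\<^sup>2
          + (\<mu> i * (\<mu> i + 1 / 2) * deriv (cubic a) (c i) + 2 * \<mu> i * D i * cubic a (c i)) / (z - c i)))
      + (2 * (\<Sum>i\<in>A. \<mu> i * D i) * (z\<^sup>2 - (a + 1) * z)
         + (2 * (\<Sum>i\<in>A. \<mu> i * D i * c i) + (\<Sum>i\<in>A. (\<mu> i)\<^sup>2) - (\<Sum>i\<in>A. \<mu> i) / 2) * z + (\<Sum>i\<in>A. k0 i))"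
      by (simp only: sum.distrib sum_subtractf sum_distrib_left sum_distrib_right sum_divide_distrib
            distrib_right left_diff_distrib)
    finally show ?thesis
      unfolding D_def sum_pole_coupling sum_pole_coupling_moment by (simp add: algebra_simps)
  qed
  then show ?thesis
    unfolding D_def by (intro exI[of _ "\<Sum>i\<in>A. k0 i"]) blast
qed

end

text \<open>
  The logarithmic derivative, with respect to \<open>z\<close>, of the factor in the change of variables.
\<close>

definition log_deriv :: "complex \<Rightarrow> (nat \<Rightarrow> nat) \<Rightarrow> nat \<Rightarrow> (nat \<Rightarrow> nat) \<Rightarrow> (nat \<Rightarrow> complex) \<Rightarrow> complex \<Rightarrow> complex" where
  "log_deriv a m M n b z = - (of_nat (m 1) / (2 * z) + of_nat (m 2) / (2 * (z - 1))
     + of_nat (m 3) / (2 * (z - a)) + (\<Sum>k=1..M. of_nat (n k) / (z - b k)))"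

definition log_deriv' :: "complex \<Rightarrow> (nat \<Rightarrow> nat) \<Rightarrow> nat \<Rightarrow> (nat \<Rightarrow> nat) \<Rightarrow> (nat \<Rightarrow> complex) \<Rightarrow> complex \<Rightarrow> complex" where
  "log_deriv' a m M n b z = of_nat (m 1) / (2 * z\<^sup>2) + of_nat (m 2) / (2 * (z - 1)\<^sup>2)
     + of_nat (m 3) / (2 * (z - a)\<^sup>2) + (\<Sum>k=1..M. of_nat (n k) / (z - b k)\<^sup>2)"

lemma log_deriv_has_derivative:
  assumes "z \<in> fuchs_domain a M b"
  shows "(log_deriv a m M n b has_field_derivative log_deriv' a m M n b z) (at z)"
proof -
  have nz: "z \<noteq> 0" "z - 1 \<noteq> 0" "z - a \<noteq> 0" "\<And>k. k \<in> {1..M} \<Longrightarrow> z - b k \<noteq> 0"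
    using assms by (auto simp: fuchs_domain_def)
  have d: "((\<lambda>z. e / (z - c)) has_field_derivative - e / (z - c)\<^sup>2) (at z)" if "z - c \<noteq> 0" for e c :: complex
    using that by (auto intro!: derivative_eq_intros simp: power2_eq_square)
  have eq: "log_deriv a m M n b = (\<lambda>z. - (of_nat (m 1) / 2 / (z - 0) + of_nat (m 2) / 2 / (z - 1)
     + of_nat (m 3) / 2 / (z - a) + (\<Sum>k=1..M. of_nat (n k) / (z - b k))))"
    by (simp add: log_deriv_def fun_eq_iff)
  have "(log_deriv a m M n b has_field_derivative
      - (- (of_nat (m 1) / 2) / (z - 0)\<^sup>2 + - (of_nat (m 2) / 2) / (z - 1)\<^sup>2
     + - (of_nat (m 3) / 2) / (z - a)\<^sup>2 + (\<Sum>k=1..M. - of_nat (n k) / (z - b k)\<^sup>2))) (at z)"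
    unfolding eq by (intro DERIV_minus DERIV_add DERIV_sum d) (use nz in auto)
  then show ?thesis
    by (rule DERIV_cong) (simp add: log_deriv'_def sum_negf)
qed

text \<open>
  The polar parts of the conjugated operator at \<open>0\<close>, \<open>1\<close>, \<open>a\<close> and the double poles at the \<open>b k\<close> cancel
  against \<open>I\<^sub>0\<close>. The simple poles at the \<open>b k\<close> leave the terms with \<open>fuchs_rho\<close>, and the linear term
  becomes \<open>N (N - 2 m\<^sub>0 - 1) z / 4\<close>.
\<close>

lemma fuchs_Q_identity:
  assumes a: "a \<noteq> 0" "a \<noteq> 1" and b: "inj_on b {1..M}" "\<forall>k\<in>{1..M}. b k \<notin> {0, 1, a}"
  shows "\<exists>K. \<forall>z\<in>fuchs_domain a M b. \<forall>lam.
    cubic a z * (log_deriv' a m M n b z + (log_deriv a m M n b z)\<^sup>2)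
      + deriv (cubic a) z / 2 * log_deriv a m M n b z - fuchs_I0 a m M n b z
    = cubic a z * fuchs_Q a m M n b lam z - lam / 4 + K"
proof -
  \<comment> \<open>The poles \<open>0\<close>, \<open>1\<close>, \<open>a\<close> with weights \<open>m\<^sub>i / 2\<close> are appended to the \<open>b k\<close> with weights \<open>n k\<close>.\<close>
  define c where "c = (\<lambda>i. if i = M + 1 then 0 else if i = M + 2 then 1 else if i = M + 3 then a else b i)"
  define \<mu> :: "nat \<Rightarrow> complex" where "\<mu> = (\<lambda>i. if i = M + 1 then of_nat (m 1) / 2 else if i = M + 2 then of_nat (m 2) / 2
      else if i = M + 3 then of_nat (m 3) / 2 else of_nat (n i))"
  define A where "A = {1..M + 3}"
  have A_eq: "A = {1..M} \<union> {M + 1, M + 2, M + 3}" by (auto simp: A_def)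
  have A: "finite A" by (simp add: A_def)
  have sumA: "(\<Sum>i\<in>A. f i) = (\<Sum>k=1..M. f k) + f (M + 1) + f (M + 2) + f (M + 3)" for f :: "nat \<Rightarrow> complex"
    unfolding A_eq by (subst sum.union_disjoint) (auto simp: add.assoc)
  have [simp]: "c (M + 1) = 0" "c (M + 2) = 1" "c (M + 3) = a" "\<mu> (M + 1) = of_nat (m 1) / 2"
    "\<mu> (M + 2) = of_nat (m 2) / 2" "\<mu> (M + 3) = of_nat (m 3) / 2"
    by (simp_all add: c_def \<mu>_def)
  have [simp]: "c (Suc M) = 0" "c (Suc (Suc M)) = 1" "\<mu> (Suc M) = of_nat (m 1) / 2"
    "\<mu> (Suc (Suc M)) = of_nat (m 2) / 2"
    by (simp_all add: c_def \<mu>_def)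
  have ck: "c k = b k" "\<mu> k = of_nat (n k)" if "k \<in> {1..M}" for k
    using that by (auto simp: c_def \<mu>_def)
  have sum_cong: "(\<Sum>k=1..M. f (\<mu> k) (c k) k) = (\<Sum>k=1..M. f (of_nat (n k)) (b k) k)"
    for f :: "complex \<Rightarrow> complex \<Rightarrow> nat \<Rightarrow> complex"
    by (intro sum.cong refl) (simp add: ck)
  have inj: "inj_on c A"
    unfolding A_eq
  proof (subst inj_on_Un, intro conjI)
    show "inj_on c {1..M}" using b(1) inj_on_cong[of "{1..M}" c b] ck(1) by blast
    show "inj_on c {M + 1, M + 2, M + 3}" using a by (auto simp: inj_on_def)
    have "c ` {1..M} = b ` {1..M}" using ck(1) by (intro image_cong) auto
    then show "c ` ({1..M} - {M + 1, M + 2, M + 3}) \<inter> c ` ({M + 1, M + 2, M + 3} - {1..M}) = {}"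
      using b(2) by auto
  qed
  have cA: "c ` A = {0, 1, a} \<union> b ` {1..M}"
  proof -
    have "c ` {1..M} = b ` {1..M}" using ck(1) by (intro image_cong) auto
    then show ?thesis unfolding A_eq image_Un by auto
  qed
  define D where "D = pole_coupling A c \<mu>"
  obtain K where K: "\<And>z. z \<notin> c ` A \<Longrightarrow>
     cubic a z * ((\<Sum>i\<in>A. \<mu> i / (z - c i)\<^sup>2) + (\<Sum>i\<in>A. \<mu> i / (z - c i))\<^sup>2)
     - deriv (cubic a) z / 2 * (\<Sum>i\<in>A. \<mu> i / (z - c i))
     = (\<Sum>i\<in>A. \<mu> i * (\<mu> i + 1) * cubic a (c i) / (z - c i)\<^sup>2
          + (\<mu> i * (\<mu> i + 1 / 2) * deriv (cubic a) (c i)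
             + 2 * \<mu> i * D i * cubic a (c i)) / (z - c i))
       + ((\<Sum>i\<in>A. \<mu> i)\<^sup>2 - (\<Sum>i\<in>A. \<mu> i) / 2) * z + K"
    using conjugated_operator_partial_fractions[OF A inj, of a \<mu>] unfolding D_def by blast
  define \<mu>1 \<mu>2 \<mu>3 \<mu>0 where "\<mu>1 = complex_of_nat (m 1)" and "\<mu>2 = complex_of_nat (m 2)"
    and "\<mu>3 = complex_of_nat (m 3)" and "\<mu>0 = complex_of_nat (m 0)"
  define sn where "sn = (\<Sum>k=1..M. complex_of_nat (n k))"
  have s: "(\<Sum>i\<in>A. \<mu> i) = (\<mu>1 + \<mu>2 + \<mu>3) / 2 + sn"
    unfolding sumA using sum_cong[of "\<lambda>x y k. x"] by (simp add: sn_def \<mu>1_def \<mu>2_def \<mu>3_def add_divide_distrib)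
  have N: "of_nat (fuchs_N m M n) = \<mu>0 + \<mu>1 + \<mu>2 + \<mu>3 + 2 * sn"
    by (simp add: fuchs_N_def \<mu>0_def \<mu>1_def \<mu>2_def \<mu>3_def sn_def eval_nat_numeral)
  have rho: "fuchs_rho a m M n b k = of_nat (n k) * deriv (cubic a) (b k) + 4 * D k * cubic a (b k)"
    if k: "k \<in> {1..M}" for k
  proof -
    have Ak: "A - {k} = ({1..M} - {k}) \<union> {M + 1, M + 2, M + 3}" using k by (auto simp: A_eq)
    have "D k = (\<Sum>j\<in>{1..M} - {k}. \<mu> j / (c k - c j)) + \<mu> (M + 1) / (c k - c (M + 1))
        + \<mu> (M + 2) / (c k - c (M + 2)) + \<mu> (M + 3) / (c k - c (M + 3))"
      unfolding D_def pole_coupling_def[OF A inj] Ak by (subst sum.union_disjoint) (auto simp: add.assoc)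
    also have "(\<Sum>j\<in>{1..M} - {k}. \<mu> j / (c k - c j)) = (\<Sum>j\<in>{1..M} - {k}. of_nat (n j) / (b k - b j))"
      by (intro sum.cong refl) (use k ck in auto)
    finally have D: "D k = (\<Sum>j\<in>{1..M} - {k}. of_nat (n j) / (b k - b j)) + \<mu>1 / (2 * b k)
        + \<mu>2 / (2 * (b k - 1)) + \<mu>3 / (2 * (b k - a))"
      using ck[OF k] by (simp add: \<mu>1_def \<mu>2_def \<mu>3_def)
    have nz: "b k \<noteq> 0" "b k - 1 \<noteq> 0" "b k - a \<noteq> 0" using b(2) k by auto
    have "4 * D k * cubic a (b k) = 4 * (\<Sum>j\<in>{1..M} - {k}. of_nat (n j) / (b k - b j)) * cubic a (b k)
       + 2 * (b k - 1) * (b k - a) * \<mu>1 + 2 * b k * (b k - a) * \<mu>2 + 2 * b k * (b k - 1) * \<mu>3"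
    proof -
      have "4 * (T + \<mu>1 / (2 * x) + \<mu>2 / (2 * y) + \<mu>3 / (2 * w)) * (x * y * w)
          = 4 * T * (x * y * w) + 2 * y * w * \<mu>1 + 2 * x * w * \<mu>2 + 2 * x * y * \<mu>3"
        if "x \<noteq> 0" "y \<noteq> 0" "w \<noteq> 0" for T x y w :: complex
        using that by (simp add: field_simps)
      from this[OF nz] show ?thesis unfolding D cubic_def .
    qed
    moreover have "(\<Sum>j\<in>{1..M} - {k}. of_nat (n j) / (b k - b j)) * cubic a (b k)
        = (\<Sum>j\<in>{1..M} - {k}. b k * (b k - 1) * (b k - a) / (b k - b j) * of_nat (n j))"
      unfolding sum_distrib_right cubic_def by (intro sum.cong refl) (simp add: mult_ac)
    ultimately show ?thesis
      unfolding fuchs_rho_def deriv_cubic \<mu>1_def \<mu>2_def \<mu>3_def by (simp add: mult.assoc algebra_simps)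
  qed
  have "cubic a z * (log_deriv' a m M n b z + (log_deriv a m M n b z)\<^sup>2)
      + deriv (cubic a) z / 2 * log_deriv a m M n b z - fuchs_I0 a m M n b z
    = cubic a z * fuchs_Q a m M n b lam z - lam / 4 
      + (K - \<mu>2 * (\<mu>2 + 1) / 4 - \<mu>3 * (\<mu>3 + 1) / 4 * a)"
    if zd: "z \<in> fuchs_domain a M b" for z lam
  proof -
    have nz: "z \<noteq> 0" "z - 1 \<noteq> 0" "z - a \<noteq> 0" "\<And>k. k \<in> {1..M} \<Longrightarrow> z - b k \<noteq> 0"
      using zd by (auto simp: fuchs_domain_def)
    have zc: "z \<notin> c ` A" using zd unfolding cA fuchs_domain_def by blast
    have 1: "log_deriv a m M n b z = - (\<Sum>i\<in>A. \<mu> i / (z - c i))"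
      unfolding sumA log_deriv_def using sum_cong[of "\<lambda>x y k. x / (z - y)"] by simp
    have 2: "log_deriv' a m M n b z = (\<Sum>i\<in>A. \<mu> i / (z - c i)\<^sup>2)"
      unfolding sumA log_deriv'_def using sum_cong[of "\<lambda>x y k. x / (z - y)\<^sup>2"] by simp
    define s2 s1 where "s2 = (\<Sum>k=1..M. of_nat (n k * (n k + 1)) * cubic a (b k) / (z - b k)\<^sup>2)"
      and "s1 = (\<Sum>k=1..M. of_nat (n k * (n k + 1)) * deriv (cubic a) (b k) / (2 * (z - b k)))"
    have cubs: "cubic a 0 = 0" "cubic a 1 = 0" "cubic a a = 0" "deriv (cubic a) 0 = a"
      "deriv (cubic a) 1 = 1 - a" "deriv (cubic a) a = a * (a - 1)"
      by (simp_all add: cubic_def deriv_cubic power2_eq_square algebra_simps)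
    have R: "(\<Sum>k=1..M. \<mu> k * (\<mu> k + 1) * cubic a (c k) / (z - c k)\<^sup>2
          + (\<mu> k * (\<mu> k + 1 / 2) * deriv (cubic a) (c k) + 2 * \<mu> k * D k * cubic a (c k)) / (z - c k))
        = s2 + s1 + fuchs_R a m M n b z / 4"
    proof -
      have "(\<Sum>k=1..M. \<mu> k * (\<mu> k + 1) * cubic a (c k) / (z - c k)\<^sup>2
          + (\<mu> k * (\<mu> k + 1 / 2) * deriv (cubic a) (c k) + 2 * \<mu> k * D k * cubic a (c k)) / (z - c k))
        = (\<Sum>k=1..M. of_nat (n k * (n k + 1)) * cubic a (b k) / (z - b k)\<^sup>2
          + of_nat (n k * (n k + 1)) * deriv (cubic a) (b k) / (2 * (z - b k))
          + 2 * (of_nat (n k) * fuchs_rho a m M n b k / (z - b k)) / 4)"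
      proof (intro sum.cong refl)
        fix k assume k: "k \<in> {1..M}"
        define x p p' h d where "x = complex_of_nat (n k)" and "p = cubic a (b k)"
          and "p' = deriv (cubic a) (b k)" and "h = z - b k" and "d = D k"
        have h: "h \<noteq> 0" using nz(4)[OF k] by (simp add: h_def)
        have "x * (x + 1) * p / h\<^sup>2 + (x * (x + 1 / 2) * p' + 2 * x * d * p) / h
          = x * (x + 1) * p / h\<^sup>2 + x * (x + 1) * p' / (2 * h) + 2 * (x * (x * p' + 4 * d * p) / h) / 4"
          using h by (simp add: field_simps)
        moreover have nn: "complex_of_nat (n k * (n k + 1)) = of_nat (n k) * (of_nat (n k) + 1)"
          by (simp add: algebra_simps)
        ultimately show "\<mu> k * (\<mu> k + 1) * cubic a (c k) / (z - c k)\<^sup>2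
          + (\<mu> k * (\<mu> k + 1 / 2) * deriv (cubic a) (c k) + 2 * \<mu> k * D k * cubic a (c k)) / (z - c k)
          = of_nat (n k * (n k + 1)) * cubic a (b k) / (z - b k)\<^sup>2
          + of_nat (n k * (n k + 1)) * deriv (cubic a) (b k) / (2 * (z - b k))
          + 2 * (of_nat (n k) * fuchs_rho a m M n b k / (z - b k)) / 4"
          unfolding ck[OF k] rho[OF k] nn x_def p_def p'_def h_def d_def by (simp only:)
      qed
      then show ?thesis
        by (simp add: s2_def s1_def fuchs_R_def sum.distrib sum_distrib_left sum_divide_distrib)
    qed
    have nn: "complex_of_nat (x * (x + 1)) = of_nat x * (of_nat x + 1)" for x
      by (simp add: algebra_simps)
    have sc: "s2 + s1 = (\<Sum>k=1..M. of_nat (n k * (n k + 1)) * (b k * (b k - 1) * (b k - a) / (z - b k)\<^sup>2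
           + (3 * (b k)\<^sup>2 - 2 * (a + 1) * b k + a) / (2 * (z - b k))))"
      unfolding s2_def s1_def cubic_def deriv_cubic sum.distrib[symmetric] distrib_left times_divide_eq_right ..
    have I: "fuchs_I0 a m M n b z = \<mu>0 * (\<mu>0 + 1) / 4 * z + \<mu>1 * (\<mu>1 + 1) / 4 * (a / z)
      + \<mu>2 * (\<mu>2 + 1) / 4 * ((z - a) / (z - 1)) + \<mu>3 * (\<mu>3 + 1) / 4 * (a * (z - 1) / (z - a)) + (s2 + s1)"
      unfolding fuchs_I0_def sc \<mu>0_def \<mu>1_def \<mu>2_def \<mu>3_def nn ..
    have Q: "cubic a z * fuchs_Q a m M n b lam z = (of_nat (fuchs_N m M n) * (of_nat (fuchs_N m M n) - 2 * \<mu>0 - 1) * z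
        + lam + fuchs_R a m M n b z) / 4"
    proof -
      have "x * y * t * (w / (4 * x * y * t)) = w / 4" if "x \<noteq> 0" "y \<noteq> 0" "t \<noteq> 0" for x y t w :: complex
        using that by simp
      from this[OF nz(1-3)] show ?thesis unfolding fuchs_Q_def cubic_def \<mu>0_def .
    qed
    have f2: "(1 - a) / (z - 1) = (z - a) / (z - 1) - 1" using nz by (simp add: field_simps)
    have f3: "a * (a - 1) / (z - a) = a * (z - 1) / (z - a) - a" using nz by (simp add: field_simps)
    have L1: "cubic a z * (log_deriv' a m M n b z + (log_deriv a m M n b z)\<^sup>2)
      + deriv (cubic a) z / 2 * log_deriv a m M n b z
      = s2 + s1 + fuchs_R a m M n b z / 4 + \<mu>1 / 2 * (\<mu>1 / 2 + 1 / 2) * (a / z)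
        + \<mu>2 / 2 * (\<mu>2 / 2 + 1 / 2) * ((1 - a) / (z - 1)) + \<mu>3 / 2 * (\<mu>3 / 2 + 1 / 2) * (a * (a - 1) / (z - a))
        + (((\<mu>1 + \<mu>2 + \<mu>3) / 2 + sn)\<^sup>2 - ((\<mu>1 + \<mu>2 + \<mu>3) / 2 + sn) / 2) * z + K"
    proof -
      have "(\<Sum>i\<in>A. \<mu> i * (\<mu> i + 1) * cubic a (c i) / (z - c i)\<^sup>2
          + (\<mu> i * (\<mu> i + 1 / 2) * deriv (cubic a) (c i) + 2 * \<mu> i * D i * cubic a (c i)) / (z - c i))
        = s2 + s1 + fuchs_R a m M n b z / 4 + \<mu>1 / 2 * (\<mu>1 / 2 + 1 / 2) * (a / z)
        + \<mu>2 / 2 * (\<mu>2 / 2 + 1 / 2) * ((1 - a) / (z - 1)) + \<mu>3 / 2 * (\<mu>3 / 2 + 1 / 2) * (a * (a - 1) / (z - a))"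
        unfolding sumA R by (simp add: cubs \<mu>1_def \<mu>2_def \<mu>3_def)
      note e = K[OF zc, unfolded this s]
      show ?thesis unfolding 1 2 e[symmetric] by simp
    qed
    have N2: "((\<mu>1 + \<mu>2 + \<mu>3) / 2 + sn)\<^sup>2 - ((\<mu>1 + \<mu>2 + \<mu>3) / 2 + sn) / 2
      = of_nat (fuchs_N m M n) * (of_nat (fuchs_N m M n) - 2 * \<mu>0 - 1) / 4 + \<mu>0 * (\<mu>0 + 1) / 4"
      unfolding N by (simp add: field_simps power2_eq_square)
    note L = L1[unfolded N2]
    define N' where "N' = complex_of_nat (fuchs_N m M n) * (of_nat (fuchs_N m M n) - 2 * \<mu>0 - 1)"
    define q1 q2 q3 where "q1 = a / z" and "q2 = (z - a) / (z - 1)" and "q3 = a * (z - 1) / (z - a)"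
    show ?thesis
      unfolding L I Q f2 f3 q1_def[symmetric] q2_def[symmetric] q3_def[symmetric] N'_def[symmetric]
      by (simp add: field_simps)
  qed
  then show ?thesis by blast
qed

section \<open>The change of variables\<close>

text \<open>
  A branch \<open>s\<close> of the square root of \<open>w\<close> enters only through \<open>2 s s' = w'\<close>, so that the result does not
  depend on the branch.
\<close>

lemma log_derivative_inverse_root_power:
  fixes s w :: "complex \<Rightarrow> complex"
  assumes X: "open X" "x \<in> X" and s: "s holomorphic_on X" "\<And>x. x \<in> X \<Longrightarrow> (s x)\<^sup>2 = w x"
    and w: "(w has_field_derivative w') (at x)" "w x \<noteq> 0"
  shows "((\<lambda>x. inverse (s x) ^ k) has_field_derivative inverse (s x) ^ k * (- of_nat k / (2 * w x) * w')) (at x)"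
proof -
  have ds: "(s has_field_derivative deriv s x) (at x)"
    using s(1) X by (rule holomorphic_derivI)
  have s0: "s x \<noteq> 0" using s(2)[OF X(2)] w(2) by auto
  have "((\<lambda>x. (s x)\<^sup>2) has_field_derivative w') (at x)"
    by (rule has_field_derivative_transform_within_open[OF w(1) X]) (simp add: s(2))
  moreover have "((\<lambda>x. (s x)\<^sup>2) has_field_derivative 2 * s x * deriv s x) (at x)"
    by (rule derivative_eq_intros ds refl)+ simp
  ultimately have w': "w' = 2 * s x * deriv s x"
    by (rule DERIV_unique)
  have "((\<lambda>x. inverse (s x)) has_field_derivative - (deriv s x / (s x)\<^sup>2)) (at x)"
    using DERIV_inverse_fun[OF ds s0] by (simp add: field_simps power2_eq_square)
  then have "((\<lambda>x. inverse (s x) ^ k) has_field_derivative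
      of_nat k * (- (deriv s x / (s x)\<^sup>2) * inverse (s x) ^ (k - Suc 0))) (at x)"
    by (rule DERIV_power)
  then show ?thesis
  proof (rule DERIV_cong)
    show "of_nat k * (- (deriv s x / (s x)\<^sup>2) * inverse (s x) ^ (k - Suc 0))
      = inverse (s x) ^ k * (- of_nat k / (2 * w x) * w')"
      unfolding w' s(2)[OF X(2), symmetric] using s0
      by (cases k) (simp_all add: field_simps power2_eq_square)
  qed
qed

lemma log_derivative_inverse_power:
  fixes w :: "complex \<Rightarrow> complex"
  assumes w: "(w has_field_derivative w') (at x)" "w x \<noteq> 0"
  shows "((\<lambda>x. inverse (w x) ^ k) has_field_derivative inverse (w x) ^ k * (- of_nat k / w x * w')) (at x)"
proof -
  have "((\<lambda>x. inverse (w x)) has_field_derivative - (w' / (w x)\<^sup>2)) (at x)"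
    using DERIV_inverse_fun[OF w] by (simp add: field_simps power2_eq_square)
  then have "((\<lambda>x. inverse (w x) ^ k) has_field_derivative
      of_nat k * (- (w' / (w x)\<^sup>2) * inverse (w x) ^ (k - Suc 0))) (at x)"
    by (rule DERIV_power)
  then show ?thesis
    by (rule DERIV_cong) (use w(2) in \<open>cases k, simp_all add: field_simps power2_eq_square\<close>)
qed

lemma log_derivative_mult:
  fixes f g :: "complex \<Rightarrow> complex"
  assumes "(f has_field_derivative f x * L) (at x)" "(g has_field_derivative g x * M) (at x)"
  shows "((\<lambda>x. f x * g x) has_field_derivative f x * g x * (L + M)) (at x)"
  using DERIV_mult[OF assms] by (rule DERIV_cong) (simp add: algebra_simps)

lemma log_derivative_prod:
  fixes f :: "'a \<Rightarrow> complex \<Rightarrow> complex"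
  assumes "finite A" "\<And>i. i \<in> A \<Longrightarrow> (f i has_field_derivative f i x * L i) (at x)"
  shows "((\<lambda>x. \<Prod>i\<in>A. f i x) has_field_derivative (\<Prod>i\<in>A. f i x) * (\<Sum>i\<in>A. L i)) (at x)"
  using assms
proof (induction A rule: finite_induct)
  case (insert i A)
  then have "((\<lambda>x. f i x * (\<Prod>i\<in>A. f i x)) has_field_derivative
      f i x * (\<Prod>i\<in>A. f i x) * (L i + (\<Sum>i\<in>A. L i))) (at x)"
    by (intro log_derivative_mult) auto
  then show ?case using insert by simp
qed simp

lemma fuchs_P_eq:
  assumes "z \<in> fuchs_domain a M b"
  shows "cubic a z * fuchs_P a m M n b z = 2 * cubic a z * log_deriv a m M n b z + deriv (cubic a) z / 2"
proof -
  have nz: "z \<noteq> 0" "z - 1 \<noteq> 0" "z - a \<noteq> 0" using assms by (auto simp: fuchs_domain_def)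
  have "cubic a z * (1 / z + 1 / (z - 1) + 1 / (z - a)) = deriv (cubic a) z"
  proof -
    have "x * y * t * (1 / x + 1 / y + 1 / t) = y * t + x * t + x * y" if "x \<noteq> 0" "y \<noteq> 0" "t \<noteq> 0"
      for x y t :: complex using that by (simp add: field_simps)
    from this[OF nz] show ?thesis
      unfolding cubic_def deriv_cubic by (simp add: power2_eq_square algebra_simps)
  qed
  moreover have "fuchs_P a m M n b z = 2 * log_deriv a m M n b z + (1 / z + 1 / (z - 1) + 1 / (z - a)) / 2"
  proof -
    have "1 / 2 * ((1 - 2 * A) / x + (1 - 2 * B) / y + (1 - 2 * C) / t) - 2 * D
        = 2 * - (A / (2 * x) + B / (2 * y) + C / (2 * t) + D) + (1 / x + 1 / y + 1 / t) / 2"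
      for A B C D x y t :: complex
      by (simp add: diff_divide_distrib algebra_simps)
    then show ?thesis unfolding fuchs_P_def log_deriv_def .
  qed
  ultimately show ?thesis by (simp add: algebra_simps)
qed

context wp_lattice
begin

lemma modulus_nz: "modulus \<noteq> 0" "modulus \<noteq> 1"
  using E_distinct \<kappa>_nz by (auto simp: modulus_def \<kappa>_def)

text \<open>
  With \<open>\<Phi>\<close> the factor of the change of variables and \<open>\<phi>\<close> its logarithmic derivative in \<open>z\<close>, the Schroedinger
  operator applied to \<open>y(z) \<Phi>\<close> equals \<open>4 \<kappa> \<Phi> p(z)\<close> times the Fuchsian operator applied to \<open>y\<close>, and the
  prefactor vanishes nowhere. The energy constant absorbs the constants of \<open>fuchs_Q_identity\<close> and
  \<open>potential_eq\<close>.
\<close>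

theorem schroedinger_to_fuchsian:
  assumes b: "inj_on b {1..M}" "\<forall>k\<in>{1..M}. b k \<notin> {0, 1, modulus}"
    and \<delta>: "\<And>k. k \<in> {1..M} \<Longrightarrow> \<delta> k \<notin> \<Lambda>" "\<And>k. k \<in> {1..M} \<Longrightarrow> Z (\<delta> k) = b k"
  shows "schroedinger_transforms_to_fuchsian w1 w3 \<delta> modulus m M n b"
proof -
  define \<phi> \<phi>' where "\<phi> = log_deriv modulus m M n b" and "\<phi>' = log_deriv' modulus m M n b"
  define u where "u = potential w1 w3 m M n \<delta>"
  define I where "I = fuchs_I0 modulus m M n b"
  define p where "p = cubic modulus"
  obtain K where K: "\<And>z lam. z \<in> fuchs_domain modulus M b \<Longrightarrow>
      p z * (\<phi>' z + (\<phi> z)\<^sup>2) + deriv p z / 2 * \<phi> z - I z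
      = p z * fuchs_Q modulus m M n b lam z - lam / 4 + K"
    using fuchs_Q_identity[OF modulus_nz b] unfolding \<phi>_def \<phi>'_def I_def p_def by blast
  have "\<exists>C. \<forall>x\<in>potential_domain w1 w3 M \<delta>. u x = 4 * \<kappa> * I (Z x) + C"
    unfolding u_def I_def by (rule potential_eq) (use \<delta> in auto)
  then obtain C where C: "\<And>x. x \<in> potential_domain w1 w3 M \<delta> \<Longrightarrow> u x = 4 * \<kappa> * I (Z x) + C"
    by blast
  have main: "solves_schroedinger u ((E1 - E2) * lam + (4 * \<kappa> * K - C))
       (\<lambda>x. y (Z x) * inverse (s1 x) ^ m 1 * inverse (s2 x) ^ m 2
            * inverse (s3 x) ^ m 3 * (\<Prod>k=1..M. inverse (Z x - b k) ^ n k)) X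
      \<longleftrightarrow> solves_fuchsian modulus m M n b lam y (Z ` X)"
    if X: "open X" "X \<subseteq> potential_domain w1 w3 M \<delta>"
      and s: "s1 holomorphic_on X" "\<And>x. x \<in> X \<Longrightarrow> (s1 x)\<^sup>2 = Z x"
        "s2 holomorphic_on X" "\<And>x. x \<in> X \<Longrightarrow> (s2 x)\<^sup>2 = Z x - 1"
        "s3 holomorphic_on X" "\<And>x. x \<in> X \<Longrightarrow> (s3 x)\<^sup>2 = Z x - modulus"
      and y: "y holomorphic_on Z ` X"
    for lam X s1 s2 s3 y
  proof -
    have inS: "Z x \<in> fuchs_domain modulus M b" if "x \<in> X" for x
      by (rule zcoord_potential_domain[where \<delta> = \<delta>]) (use \<delta> that X in auto)
    have nz: "Z x \<noteq> 0" "Z x - 1 \<noteq> 0" "Z x - modulus \<noteq> 0" "\<And>k. k \<in> {1..M} \<Longrightarrow> Z x - b k \<noteq> 0"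
      if "x \<in> X" for x using inS[OF that] by (auto simp: fuchs_domain_def)
    have off: "x \<notin> \<Lambda>" if "x \<in> X" for x using that X(2) potential_domainD(1) by blast
    have Zh: "Z holomorphic_on X"
      by (rule holomorphic_on_subset[OF zcoord_holomorphic]) (use off in auto)
    have Zd: "(Z has_field_derivative deriv Z x) (at x)" if "x \<in> X" for x
      by (rule holomorphic_derivI[OF Zh X(1) that])
    have Zdd: "(deriv Z has_field_derivative deriv (deriv Z) x) (at x)" if "x \<in> X" for x
      by (rule holomorphic_derivI[OF holomorphic_deriv[OF Zh X(1)] X(1) that])
    have pnz: "p (Z x) \<noteq> 0" if "x \<in> X" for x using nz[OF that] by (simp add: p_def cubic_def)
    have ode: "(deriv Z x)\<^sup>2 = 4 * \<kappa> * p (Z x)" "deriv (deriv Z) x = 4 * \<kappa> * (deriv p (Z x) / 2)"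
      if "x \<in> X" for x using zcoord_ode[OF off[OF that]] by (simp_all add: p_def)
    have Z'nz: "deriv Z x \<noteq> 0" if "x \<in> X" for x
      using ode(1)[OF that] pnz[OF that] \<kappa>_nz by auto
    have op: "open (Z ` X)"
    proof (rule open_mapping_thm2[OF Zh X(1) X(1) order_refl])
      fix U assume U: "open U" "U \<subseteq> X" "U \<noteq> {}"
      then obtain x where x: "x \<in> U" by blast
      show "\<not> Z constant_on U"
      proof
        assume "Z constant_on U"
        then obtain c where "\<And>x. x \<in> U \<Longrightarrow> Z x = c" unfolding constant_on_def by blast
        then have "(deriv ^^ 1) Z x = (deriv ^^ 1) (\<lambda>x. c) x"
          by (rule higher_deriv_cong_open[OF U(1) _ x])
        with Z'nz[of x] x U(2) show False by auto
      qed
    qed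
    have yd: "(y has_field_derivative deriv y z) (at z)" "(deriv y has_field_derivative deriv (deriv y) z) (at z)"
      if "z \<in> Z ` X" for z
      using holomorphic_derivI[OF y op that] holomorphic_derivI[OF holomorphic_deriv[OF y op] op that] .
    define \<Phi> where "\<Phi> = (\<lambda>x. inverse (s1 x) ^ m 1 * inverse (s2 x) ^ m 2
            * inverse (s3 x) ^ m 3 * (\<Prod>k=1..M. inverse (Z x - b k) ^ n k))"
    define \<psi> where "\<psi> = (\<lambda>x. y (Z x) * \<Phi> x)"
    have \<Phi>nz: "\<Phi> x \<noteq> 0" if "x \<in> X" for x
    proof -
      have "s1 x \<noteq> 0" "s2 x \<noteq> 0" "s3 x \<noteq> 0"
        using s(2,4,6)[OF that] nz[OF that] by auto
      then show ?thesis using nz(4)[OF that] by (simp add: \<Phi>_def)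
    qed
    have \<Phi>d: "(\<Phi> has_field_derivative \<Phi> x * (\<phi> (Z x) * deriv Z x)) (at x)" if x: "x \<in> X" for x
    proof -
      have Zc: "((\<lambda>x. Z x - c) has_field_derivative deriv Z x) (at x)" for c
        using DERIV_diff[OF Zd[OF x] DERIV_const[of c]] by simp
      have "(\<Phi> has_field_derivative \<Phi> x * (- of_nat (m 1) / (2 * Z x) * deriv Z x
          + - of_nat (m 2) / (2 * (Z x - 1)) * deriv Z x + - of_nat (m 3) / (2 * (Z x - modulus)) * deriv Z x
          + (\<Sum>k=1..M. - of_nat (n k) / (Z x - b k) * deriv Z x))) (at x)"
        unfolding \<Phi>_def
      proof (intro log_derivative_mult log_derivative_prod)
        show "((\<lambda>x. inverse (s1 x) ^ m 1) has_field_derivative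
            inverse (s1 x) ^ m 1 * (- of_nat (m 1) / (2 * Z x) * deriv Z x)) (at x)"
          by (rule log_derivative_inverse_root_power[OF X(1) x s(1,2) Zd[OF x] nz(1)[OF x]])
        show "((\<lambda>x. inverse (s2 x) ^ m 2) has_field_derivative
            inverse (s2 x) ^ m 2 * (- of_nat (m 2) / (2 * (Z x - 1)) * deriv Z x)) (at x)"
          by (rule log_derivative_inverse_root_power[OF X(1) x s(3,4) Zc nz(2)[OF x]])
        show "((\<lambda>x. inverse (s3 x) ^ m 3) has_field_derivative
            inverse (s3 x) ^ m 3 * (- of_nat (m 3) / (2 * (Z x - modulus)) * deriv Z x)) (at x)"
          by (rule log_derivative_inverse_root_power[OF X(1) x s(5,6) Zc nz(3)[OF x]])
        show "((\<lambda>x. inverse (Z x - b k) ^ n k) has_field_derivative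
            inverse (Z x - b k) ^ n k * (- of_nat (n k) / (Z x - b k) * deriv Z x)) (at x)"
          if "k \<in> {1..M}" for k
          by (rule log_derivative_inverse_power[OF Zc nz(4)[OF x that]])
      qed simp
      then show ?thesis
        by (rule DERIV_cong)
           (simp add: \<phi>_def log_deriv_def sum_negf algebra_simps sum_distrib_left sum_distrib_right)
    qed
    have \<phi>d: "(\<phi> has_field_derivative \<phi>' z) (at z)" if "z \<in> fuchs_domain modulus M b" for z
      unfolding \<phi>_def \<phi>'_def by (rule log_deriv_has_derivative[OF that])
    have \<psi>1: "deriv \<psi> x = (deriv y (Z x) + \<phi> (Z x) * y (Z x)) * (\<Phi> x * deriv Z x)" if x: "x \<in> X" for x
    proof -
      have "((\<lambda>x. y (Z x)) has_field_derivative deriv y (Z x) * deriv Z x) (at x)"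
        by (rule DERIV_chain2[OF yd(1) Zd[OF x]]) (use x in simp)
      from DERIV_mult[OF this \<Phi>d[OF x]] show ?thesis
        unfolding \<psi>_def by (intro DERIV_imp_deriv) (simp add: algebra_simps)
    qed
    have \<psi>2: "deriv (deriv \<psi>) x = 4 * \<kappa> * \<Phi> x * (p (Z x) * deriv (deriv y) (Z x)
        + (2 * p (Z x) * \<phi> (Z x) + deriv p (Z x) / 2) * deriv y (Z x)
        + (p (Z x) * (\<phi>' (Z x) + (\<phi> (Z x))\<^sup>2) + deriv p (Z x) / 2 * \<phi> (Z x)) * y (Z x))" if x: "x \<in> X" for x
    proof -
      define Z1 Z2 where "Z1 = deriv Z x" and "Z2 = deriv (deriv Z) x"
      have zX: "Z x \<in> Z ` X" using x by simp
      have g: "((\<lambda>z. deriv y z + \<phi> z * y z) has_field_derivative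
          deriv (deriv y) (Z x) + (\<phi>' (Z x) * y (Z x) + deriv y (Z x) * \<phi> (Z x))) (at (Z x))"
        by (intro DERIV_add DERIV_mult yd zX \<phi>d inS x)
      have "((\<lambda>x. deriv y (Z x) + \<phi> (Z x) * y (Z x)) has_field_derivative
          (deriv (deriv y) (Z x) + (\<phi>' (Z x) * y (Z x) + deriv y (Z x) * \<phi> (Z x))) * Z1) (at x)"
        unfolding Z1_def by (rule DERIV_chain2[OF g Zd[OF x]])
      moreover have "((\<lambda>x. \<Phi> x * deriv Z x) has_field_derivative
          \<Phi> x * (\<phi> (Z x) * Z1) * Z1 + Z2 * \<Phi> x) (at x)"
        using DERIV_mult[OF \<Phi>d[OF x] Zdd[OF x]] unfolding Z1_def Z2_def .
      ultimately have "((\<lambda>x. (deriv y (Z x) + \<phi> (Z x) * y (Z x)) * (\<Phi> x * deriv Z x)) has_field_derivative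
          (deriv (deriv y) (Z x) + (\<phi>' (Z x) * y (Z x) + deriv y (Z x) * \<phi> (Z x))) * Z1 * (\<Phi> x * deriv Z x)
          + (\<Phi> x * (\<phi> (Z x) * Z1) * Z1 + Z2 * \<Phi> x) * (deriv y (Z x) + \<phi> (Z x) * y (Z x))) (at x)"
        by (rule DERIV_mult)
      then have "(deriv \<psi> has_field_derivative
          (deriv (deriv y) (Z x) + (\<phi>' (Z x) * y (Z x) + deriv y (Z x) * \<phi> (Z x))) * Z1 * (\<Phi> x * Z1)
          + (\<Phi> x * (\<phi> (Z x) * Z1) * Z1 + Z2 * \<Phi> x) * (deriv y (Z x) + \<phi> (Z x) * y (Z x))) (at x)"
        unfolding Z1_def
        by (rule has_field_derivative_transform_within_open[OF _ X(1) x]) (simp add: \<psi>1)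
      then have "deriv (deriv \<psi>) x =
          (deriv (deriv y) (Z x) + (\<phi>' (Z x) * y (Z x) + deriv y (Z x) * \<phi> (Z x))) * Z1 * (\<Phi> x * Z1)
          + (\<Phi> x * (\<phi> (Z x) * Z1) * Z1 + Z2 * \<Phi> x) * (deriv y (Z x) + \<phi> (Z x) * y (Z x))"
        by (rule DERIV_imp_deriv)
      also have "\<dots> = \<Phi> x * (Z1\<^sup>2 * (deriv (deriv y) (Z x) + 2 * \<phi> (Z x) * deriv y (Z x)
          + (\<phi>' (Z x) + (\<phi> (Z x))\<^sup>2) * y (Z x)) + Z2 * (deriv y (Z x) + \<phi> (Z x) * y (Z x)))"
        by (simp add: power2_eq_square algebra_simps)
      finally show ?thesis
        unfolding Z1_def Z2_def ode[OF x] by (simp add: algebra_simps)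
    qed
    have key: "deriv (deriv \<psi>) x - u x * \<psi> x - ((E1 - E2) * lam + (4 * \<kappa> * K - C)) * \<psi> x
       = 4 * \<kappa> * \<Phi> x * p (Z x) * (deriv (deriv y) (Z x) + fuchs_P modulus m M n b (Z x) * deriv y (Z x)
           + fuchs_Q modulus m M n b lam (Z x) * y (Z x))" if x: "x \<in> X" for x
    proof -
      have ux: "u x = 4 * \<kappa> * I (Z x) + C" by (rule C) (use x X in auto)
      have e: "E1 - E2 = - \<kappa>" by (simp add: \<kappa>_def)
      define A B where "A = p (Z x) * (\<phi>' (Z x) + (\<phi> (Z x))\<^sup>2) + deriv p (Z x) / 2 * \<phi> (Z x)"
        and "B = p (Z x) * fuchs_Q modulus m M n b lam (Z x)"
      have AB: "A = B - lam / 4 + K + I (Z x)"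
        using K[OF inS[OF x], of lam] by (simp add: A_def B_def algebra_simps)
      have PP: "2 * p (Z x) * \<phi> (Z x) + deriv p (Z x) / 2 = p (Z x) * fuchs_P modulus m M n b (Z x)"
        using fuchs_P_eq[OF inS[OF x], of m n] by (simp add: p_def \<phi>_def)
      show ?thesis
        unfolding \<psi>2[OF x] ux e PP A_def[symmetric] AB unfolding \<psi>_def
        by (simp add: B_def algebra_simps)
    qed
    have "solves_schroedinger u ((E1 - E2) * lam + (4 * \<kappa> * K - C)) \<psi> X
      \<longleftrightarrow> (\<forall>x\<in>X. deriv (deriv \<psi>) x - u x * \<psi> x - ((E1 - E2) * lam + (4 * \<kappa> * K - C)) * \<psi> x = 0)"
      unfolding solves_schroedinger_def by simp
    also have "\<dots> \<longleftrightarrow> (\<forall>x\<in>X. deriv (deriv y) (Z x) + fuchs_P modulus m M n b (Z x) * deriv y (Z x)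
           + fuchs_Q modulus m M n b lam (Z x) * y (Z x) = 0)"
      by (intro ball_cong refl) (simp add: key \<kappa>_nz \<Phi>nz pnz)
    also have "\<dots> \<longleftrightarrow> solves_fuchsian modulus m M n b lam y (Z ` X)"
      unfolding solves_fuchsian_def by blast
    finally show ?thesis
      unfolding \<psi>_def \<Phi>_def mult.assoc .
  qed
  show ?thesis
    unfolding schroedinger_transforms_to_fuchsian_def u_def[symmetric]
    by (intro exI[of _ "4 * \<kappa> * K - C"] allI impI, elim conjE) (rule main; simp)
qed

end

section \<open>The half-period values as functions of the period ratio\<close>

lemma inverse_square_diff_bound:
  fixes A B :: complex
  assumes "m > 0" "m \<le> L * norm A" "m \<le> L * norm B" "L > 0"
  shows "norm (1 / A\<^sup>2 - 1 / B\<^sup>2) \<le> 2 * norm (A - B) * L ^ 3 * (1 / m ^ 3)"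
proof -
  have lb: "m / L \<le> norm A" "m / L \<le> norm B" "m / L > 0"
    using assms by (auto simp: field_simps)
  then have pos: "norm A > 0" "norm B > 0" by linarith+
  then have nz: "A \<noteq> 0" "B \<noteq> 0" by auto
  have "1 / A\<^sup>2 - 1 / B\<^sup>2 = (B - A) * (1 / (A * B\<^sup>2) + 1 / (A\<^sup>2 * B))"
    using nz by (simp add: field_simps power2_eq_square)
  then have "norm (1 / A\<^sup>2 - 1 / B\<^sup>2) = norm (A - B) * norm (1 / (A * B\<^sup>2) + 1 / (A\<^sup>2 * B))"
    by (simp only: norm_mult norm_minus_commute)
  also have "\<dots> \<le> norm (A - B) * (1 / (m / L) ^ 3 + 1 / (m / L) ^ 3)"
  proof (intro mult_left_mono norm_triangle_le add_mono)
    have "norm (1 / (A * B\<^sup>2)) = 1 / (norm A * norm B ^ 2)"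
      by (simp add: norm_divide norm_mult norm_power)
    also have "\<dots> \<le> 1 / (m / L * (m / L) ^ 2)"
      using lb pos by (intro divide_left_mono mult_mono power_mono mult_pos_pos) auto
    finally show "norm (1 / (A * B\<^sup>2)) \<le> 1 / (m / L) ^ 3"
      by (simp add: power2_eq_square power3_eq_cube)
    have "norm (1 / (A\<^sup>2 * B)) = 1 / (norm A ^ 2 * norm B)"
      by (simp add: norm_divide norm_mult norm_power)
    also have "\<dots> \<le> 1 / ((m / L) ^ 2 * (m / L))"
      using lb pos by (intro divide_left_mono mult_mono power_mono mult_pos_pos) auto
    finally show "norm (1 / (A\<^sup>2 * B)) \<le> 1 / (m / L) ^ 3"
      by (simp add: power2_eq_square power3_eq_cube)
  qed simp
  also have "\<dots> = 2 * norm (A - B) * L ^ 3 * (1 / m ^ 3)"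
    by (simp add: power_divide)
  finally show ?thesis .
qed

text \<open>
  Tannery's theorem for unordered sums and an arbitrary filter.
\<close>

lemma infsum_tendsto_dominated:
  fixes f :: "'b \<Rightarrow> 'c \<Rightarrow> complex"
  assumes lim: "\<And>p. p \<in> A \<Longrightarrow> (f p \<longlongrightarrow> g p) F"
    and dom: "\<forall>\<^sub>F x in F. \<forall>p\<in>A. norm (f p x) \<le> M p" and M: "M summable_on A"
  shows "((\<lambda>x. \<Sum>\<^sub>\<infinity>p\<in>A. f p x) \<longlongrightarrow> (\<Sum>\<^sub>\<infinity>p\<in>A. g p)) F"
proof (cases "F = bot")
  case False
  have gM: "norm (g p) \<le> M p" if "p \<in> A" for p
  proof (rule tendsto_upperbound[OF tendsto_norm[OF lim[OF that]] _ False])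
    show "\<forall>\<^sub>F x in F. norm (f p x) \<le> M p"
      using dom by eventually_elim (use that in auto)
  qed
  have "(\<lambda>p. norm (g p)) summable_on A"
    by (rule Infinite_Sum.abs_summable_on_comparison_test'[OF M gM])
  then have "g summable_on A" by (rule Infinite_Sum.abs_summable_summable)
  then have s: "(sum g \<longlongrightarrow> (\<Sum>\<^sub>\<infinity>p\<in>A. g p)) (finite_subsets_at_top A)"
    using has_sum_infsum unfolding has_sum_def by blast
  show ?thesis
  proof (rule swap_uniform_limit'[where f = "\<lambda>X x. \<Sum>p\<in>X. f p x" and g = "sum g"
        and F = "finite_subsets_at_top A" and S = "{x. \<forall>p\<in>A. norm (f p x) \<le> M p}"])
    show "\<forall>\<^sub>F X in finite_subsets_at_top A. ((\<lambda>x. \<Sum>p\<in>X. f p x) \<longlongrightarrow> sum g X) F"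
      by (rule eventually_finite_subsets_at_top_weakI) (auto intro!: tendsto_sum lim)
    show "uniform_limit {x. \<forall>p\<in>A. norm (f p x) \<le> M p} (\<lambda>X x. \<Sum>p\<in>X. f p x)
        (\<lambda>x. \<Sum>\<^sub>\<infinity>p\<in>A. f p x) (finite_subsets_at_top A)"
      by (rule Weierstrass_m_test_general[OF _ M]) auto
  qed (use dom s in simp_all)
qed simp

definition nonzero_pairs :: "(int \<times> int) set" where
  "nonzero_pairs = - {(0, 0)}"

definition half_term :: "real \<Rightarrow> real \<Rightarrow> int \<times> int \<Rightarrow> complex \<Rightarrow> complex" where
  "half_term \<alpha> \<beta> = (\<lambda>(i, j) \<tau>. 1 / (of_real (\<alpha> - of_int i) + of_real (\<beta> - of_int j) * \<tau>)\<^sup>2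
      - 1 / (of_int i + of_int j * \<tau>)\<^sup>2)"

text \<open>
  The value of the Weierstrass function of the lattice spanned by \<open>1\<close> and \<open>\<tau>\<close> at the point
  \<open>\<alpha> + \<beta> \<tau>\<close>, which moves with the lattice.
\<close>

definition half_value :: "real \<Rightarrow> real \<Rightarrow> complex \<Rightarrow> complex" where
  "half_value \<alpha> \<beta> \<tau> = 1 / (of_real \<alpha> + of_real \<beta> * \<tau>)\<^sup>2 + (\<Sum>\<^sub>\<infinity>p\<in>nonzero_pairs. half_term \<alpha> \<beta> p \<tau>)"

lemma wp_lattice_normalized: "Im \<tau> \<noteq> 0 \<Longrightarrow> wp_lattice (1 / 2) (\<tau> / 2)"
  by (simp add: wp_lattice_def)

lemma wp_normalized:
  assumes "Im \<tau> \<noteq> 0"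
  shows "wp (1 / 2) (\<tau> / 2) (of_real \<alpha> + of_real \<beta> * \<tau>) = half_value \<alpha> \<beta> \<tau>"
proof -
  interpret wp_lattice "1 / 2" "\<tau> / 2" by (rule wp_lattice_normalized[OF assms])
  have lp: "lattice_point (i, j) = of_int i + of_int j * \<tau>" for i j
    by (simp add: lattice_point_def)
  have "\<Lambda> - {0} = lattice_point ` nonzero_pairs"
    unfolding lattice_eq nonzero_pairs_def using lattice_point_eq_0_iff by auto
  moreover have "inj_on lattice_point nonzero_pairs"
    using inj_lattice_point by (rule inj_on_subset) simp
  ultimately have "wp_regular x = (\<Sum>\<^sub>\<infinity>p\<in>nonzero_pairs. 1 / (x - lattice_point p)\<^sup>2 - 1 / (lattice_point p)\<^sup>2)" for x
    unfolding wp_regular_def by (simp add: infsum_reindex o_def)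
  then show ?thesis
    unfolding wp_eq half_value_def
    by (auto intro!: infsum_cong simp: lp half_term_def algebra_simps)
qed

lemma wp_normalized_half_periods:
  assumes "Im \<tau> \<noteq> 0"
  shows "e1 (1 / 2) (\<tau> / 2) = half_value (1 / 2) 0 \<tau>"
    "e2 (1 / 2) (\<tau> / 2) = half_value (1 / 2) (1 / 2) \<tau>"
    "e3 (1 / 2) (\<tau> / 2) = half_value 0 (1 / 2) \<tau>"
  using wp_normalized[OF assms, of "1 / 2" 0] wp_normalized[OF assms, of "1 / 2" "1 / 2"]
    wp_normalized[OF assms, of 0 "1 / 2"]
  by (simp_all add: e1_def e2_def e3_def)

lemma max_half_shift:
  fixes i j :: int and \<alpha> \<beta> :: real
  assumes "\<alpha> \<in> {0, 1 / 2}" "\<beta> \<in> {0, 1 / 2}"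
  shows "real_of_int (max \<bar>i\<bar> \<bar>j\<bar>) \<le> 2 * max \<bar>\<alpha> - of_int i\<bar> \<bar>\<beta> - of_int j\<bar>"
proof -
  have h: "\<bar>real_of_int i\<bar> \<le> 2 * \<bar>x - of_int i\<bar>" if "x \<in> {0, 1 / 2}" for x :: real and i :: int
  proof -
    consider "i \<le> 0" | "i \<ge> 1" by linarith
    then show ?thesis using that by cases auto
  qed
  show ?thesis
    unfolding of_int_max of_int_abs
    by (intro max.boundedI order_trans[OF h[OF assms(1)]] order_trans[OF h[OF assms(2)]]) auto
qed

text \<open>
  The constant of \<open>max_le_norm_combination\<close>. It is bounded on compact subsets of the upper half-plane
  and on the reduced region.
\<close>

definition skew :: "complex \<Rightarrow> real" where
  "skew \<tau> = 1 + (norm \<tau> + 1) / \<bar>Im \<tau>\<bar>"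

lemma skew_pos: "skew \<tau> > 0"
  unfolding skew_def by (rule add_pos_nonneg) auto

lemma half_lower_bound:
  assumes "Im \<tau> \<noteq> 0" "\<alpha> \<in> {0, 1 / 2}" "\<beta> \<in> {0, 1 / 2}"
  shows "real_of_int (max \<bar>i\<bar> \<bar>j\<bar>)
     \<le> (2 * skew \<tau>) * norm (of_real (\<alpha> - of_int i) + of_real (\<beta> - of_int j) * \<tau>)"
  using max_half_shift[OF assms(2,3), of i j] max_le_norm_combination[OF assms(1), of "\<alpha> - of_int i" "\<beta> - of_int j"]
  unfolding skew_def by linarith

lemma max_pos: "(i, j) \<in> nonzero_pairs \<Longrightarrow> real_of_int (max \<bar>i\<bar> \<bar>j\<bar>) > 0"
  by (auto simp: nonzero_pairs_def max_def)

lemma half_term_bound: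
  assumes "Im \<tau> \<noteq> 0" "\<alpha> \<in> {0, 1 / 2}" "\<beta> \<in> {0, 1 / 2}" "p \<in> nonzero_pairs"
  shows "norm (half_term \<alpha> \<beta> p \<tau>) \<le> 2 * norm (of_real \<alpha> + of_real \<beta> * \<tau>) * (2 * skew \<tau>) ^ 3 * lattice_weight p"
proof -
  obtain i j where p: "p = (i, j)" by force
  define A B where "A = of_real (\<alpha> - of_int i) + of_real (\<beta> - of_int j) * \<tau>"
    and "B = of_real (0 - of_int i) + of_real (0 - of_int j) * \<tau>"
  have "norm (1 / A\<^sup>2 - 1 / B\<^sup>2) \<le> 2 * norm (A - B) * (2 * skew \<tau>) ^ 3 * (1 / real_of_int (max \<bar>i\<bar> \<bar>j\<bar>) ^ 3)"
    unfolding A_def B_def using assms skew_pos[of \<tau>]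
    by (intro inverse_square_diff_bound half_lower_bound max_pos) (auto simp: p)
  moreover have "A - B = of_real \<alpha> + of_real \<beta> * \<tau>" by (simp add: A_def B_def algebra_simps)
  moreover have "B\<^sup>2 = (of_int i + of_int j * \<tau>)\<^sup>2"
    by (simp add: B_def power2_eq_square algebra_simps)
  then have "half_term \<alpha> \<beta> p \<tau> = 1 / A\<^sup>2 - 1 / B\<^sup>2"
    by (simp add: p half_term_def A_def)
  moreover have "lattice_weight p = 1 / real_of_int (max \<bar>i\<bar> \<bar>j\<bar>) ^ 3"
    by (simp add: p lattice_weight_def)
  ultimately show ?thesis by (simp only:)
qed

lemma combination_nonzero:
  assumes "Im \<tau> \<noteq> 0" "x \<noteq> 0 \<or> y \<noteq> 0"
  shows "complex_of_real x + of_real y * \<tau> \<noteq> 0"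
  using max_le_norm_combination[OF assms(1), of x y] assms(2) by auto

lemma half_term_summable:
  assumes "Im \<tau> \<noteq> 0" "\<alpha> \<in> {0, 1 / 2}" "\<beta> \<in> {0, 1 / 2}"
  shows "(\<lambda>p. half_term \<alpha> \<beta> p \<tau>) summable_on nonzero_pairs"
proof (rule Infinite_Sum.abs_summable_summable, rule Infinite_Sum.abs_summable_on_comparison_test')
  show "norm (half_term \<alpha> \<beta> p \<tau>) \<le> 2 * norm (of_real \<alpha> + of_real \<beta> * \<tau>) * (2 * skew \<tau>) ^ 3 * lattice_weight p"
    if "p \<in> nonzero_pairs" for p by (rule half_term_bound[OF assms that])
  show "(\<lambda>p. 2 * norm (of_real \<alpha> + of_real \<beta> * \<tau>) * (2 * skew \<tau>) ^ 3 * lattice_weight p) summable_on nonzero_pairs"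
    by (intro summable_on_cmult_right summable_on_subset_banach[OF lattice_weight_summable]) simp
qed

lemma half_value_holomorphic:
  assumes "\<alpha> \<in> {0, 1 / 2}" "\<beta> \<in> {0, 1 / 2}" "\<alpha> \<noteq> 0 \<or> \<beta> \<noteq> 0"
  shows "half_value \<alpha> \<beta> holomorphic_on {\<tau>. Im \<tau> > 0}"
proof -
  have op: "open {\<tau>. Im \<tau> > 0}" by (rule open_halfspace_Im_gt)
  have "(\<lambda>\<tau>. \<Sum>\<^sub>\<infinity>p\<in>nonzero_pairs. half_term \<alpha> \<beta> p \<tau>) holomorphic_on {\<tau>. Im \<tau> > 0}"
  proof (rule infsum_holomorphic(1)[OF op])
    fix p assume p: "p \<in> nonzero_pairs"
    obtain i j where ij: "p = (i, j)" by force
    have "\<alpha> - of_int i \<noteq> 0 \<or> \<beta> - of_int j \<noteq> 0"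
      using max_half_shift[OF assms(1,2), of i j] max_pos p ij by fastforce
    moreover have "real_of_int i \<noteq> 0 \<or> real_of_int j \<noteq> 0"
      using p by (auto simp: ij nonzero_pairs_def)
    ultimately have "of_real (\<alpha> - of_int i) + of_real (\<beta> - of_int j) * \<tau> \<noteq> 0"
      "of_int i + of_int j * \<tau> \<noteq> 0" if "Im \<tau> > 0" for \<tau>
      using combination_nonzero[of \<tau> "\<alpha> - of_int i" "\<beta> - of_int j"] combination_nonzero[of \<tau> "of_int i" "of_int j"] that
      by auto
    then show "half_term \<alpha> \<beta> p holomorphic_on {\<tau>. Im \<tau> > 0}"
      unfolding ij half_term_def prod.case by (intro holomorphic_intros) auto
  next
    fix t :: complex assume "t \<in> {\<tau>. Im \<tau> > 0}"
    then have t: "Im t > 0" by simp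
    define r where "r = Im t / 2"
    define R where "R = norm t + r"
    define K where "K = 1 + (R + 1) / r"
    have r: "r > 0" "R > 0" using t by (auto simp: r_def R_def intro: add_nonneg_pos)
    have b: "norm \<tau> \<le> R" "Im \<tau> \<ge> r" if "\<tau> \<in> cball t r" for \<tau>
    proof -
      show "norm \<tau> \<le> R"
        using that norm_triangle_ineq4[of t "t - \<tau>"] by (simp add: R_def dist_norm)
      have "\<bar>Im t - Im \<tau>\<bar> \<le> r"
        using that abs_Im_le_cmod[of "t - \<tau>"] by (simp add: dist_norm)
      then show "Im \<tau> \<ge> r" unfolding r_def by linarith
    qed
    have "norm (half_term \<alpha> \<beta> p \<tau>) \<le> 2 * (1 + R) * (2 * K) ^ 3 * lattice_weight p"
      if p: "p \<in> nonzero_pairs" and \<tau>: "\<tau> \<in> cball t r" for p \<tau>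
    proof -
      have "norm (half_term \<alpha> \<beta> p \<tau>) \<le> 2 * norm (of_real \<alpha> + of_real \<beta> * \<tau>) * (2 * skew \<tau>) ^ 3 * lattice_weight p"
        by (rule half_term_bound) (use assms p b[OF \<tau>] r in auto)
      also have "\<dots> \<le> 2 * (1 + R) * (2 * K) ^ 3 * lattice_weight p"
      proof (intro mult_right_mono mult_mono power_mono)
        have "norm (of_real \<alpha> + of_real \<beta> * \<tau>) \<le> \<bar>\<alpha>\<bar> + \<bar>\<beta>\<bar> * norm \<tau>"
          by (rule norm_triangle_le) (simp add: norm_mult)
        also have "\<dots> \<le> 1 + 1 * R"
          using assms(1,2) b(1)[OF \<tau>] by (intro add_mono mult_mono) auto
        finally show "norm (of_real \<alpha> + of_real \<beta> * \<tau>) \<le> 1 + R" by simp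
        have "(norm \<tau> + 1) / \<bar>Im \<tau>\<bar> \<le> (R + 1) / r"
          using b[OF \<tau>] r by (intro frac_le) auto
        then show "skew \<tau> \<le> K" by (simp add: skew_def K_def)
        show "0 \<le> lattice_weight p" by (cases p) (simp add: lattice_weight_def)
      qed (use r skew_pos[of \<tau>] in auto)
      finally show ?thesis .
    qed
    moreover have "(\<lambda>p. 2 * (1 + R) * (2 * K) ^ 3 * lattice_weight p) summable_on nonzero_pairs"
      by (intro summable_on_cmult_right summable_on_subset_banach[OF lattice_weight_summable]) simp
    moreover have "cball t r \<subseteq> {\<tau>. Im \<tau> > 0}" using b(2) r by force
    ultimately show "\<exists>r>0. \<exists>M. M summable_on nonzero_pairs \<and> cball t r \<subseteq> {\<tau>. Im \<tau> > 0} \<and>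
        (\<forall>p\<in>nonzero_pairs. \<forall>\<tau>\<in>cball t r. norm (half_term \<alpha> \<beta> p \<tau>) \<le> M p)"
      using r(1) by blast
  qed
  moreover have "of_real \<alpha> + of_real \<beta> * \<tau> \<noteq> 0" if "Im \<tau> > 0" for \<tau>
    using combination_nonzero[of \<tau> \<alpha> \<beta>] that assms(3) by simp
  ultimately show ?thesis
    unfolding half_value_def[abs_def] by (intro holomorphic_intros) auto
qed

section \<open>The end of the reduced region\<close>

text \<open>
  Ratios of lattice bases \<open>(v\<^sub>1, v\<^sub>3)\<close> with \<open>v\<^sub>1\<close> a shortest vector and \<open>v\<^sub>3\<close> reduced modulo \<open>v\<^sub>1\<close>.
\<close>

definition reduced_region :: "complex set" where
  "reduced_region = {\<tau>. Im \<tau> > 0 \<and> \<bar>Re \<tau>\<bar> \<le> 1 / 2 \<and> norm \<tau> \<ge> 1}"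

definition cusp :: "complex filter" where
  "cusp = inf at_infinity (principal reduced_region)"

lemma eventually_cusp: "(\<And>\<tau>. \<tau> \<in> reduced_region \<Longrightarrow> P \<tau>) \<Longrightarrow> eventually P cusp"
  unfolding cusp_def eventually_inf_principal by simp

text \<open>
  In the reduced region \<open>Im \<tau>\<close> is at least \<open>sqrt 3 / 2\<close> times \<open>norm \<tau>\<close>, hence \<open>norm \<tau> + 1 \<le> 3 * Im \<tau>\<close>.
\<close>

lemma reduced_skew:
  assumes "\<tau> \<in> reduced_region"
  shows "skew \<tau> \<le> 4"
proof -
  have \<tau>: "Im \<tau> > 0" "\<bar>Re \<tau>\<bar> \<le> 1 / 2" "norm \<tau> \<ge> 1"
    using assms by (auto simp: reduced_region_def)
  have "(Re \<tau>)\<^sup>2 \<le> (1 / 2)\<^sup>2" using \<tau>(2) by (intro power2_le_iff_abs_le[THEN iffD2]) auto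
  moreover have "(norm \<tau>)\<^sup>2 \<ge> 1" using \<tau>(3) by simp
  moreover have "(norm \<tau>)\<^sup>2 = (Re \<tau>)\<^sup>2 + (Im \<tau>)\<^sup>2" by (rule cmod_power2)
  moreover have "(1 / 2 :: real)\<^sup>2 = 1 / 4" by (simp add: power2_eq_square)
  ultimately have "9 * (Im \<tau>)\<^sup>2 \<ge> 4 * (norm \<tau>)\<^sup>2" by linarith
  then have "(2 * norm \<tau>)\<^sup>2 \<le> (3 * Im \<tau>)\<^sup>2" by (simp add: power_mult_distrib)
  then have "2 * norm \<tau> \<le> 3 * Im \<tau>"
    by (rule power2_le_imp_le) (use \<tau>(1) in simp)
  then have "norm \<tau> + 1 \<le> 3 * \<bar>Im \<tau>\<bar>" using \<tau> by linarith
  then have "(norm \<tau> + 1) / \<bar>Im \<tau>\<bar> \<le> 3" using \<tau>(1) by (subst pos_divide_le_eq) auto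
  then show ?thesis unfolding skew_def by linarith
qed

lemma inverse_square_tendsto_cusp:
  assumes "y \<noteq> 0"
  shows "((\<lambda>\<tau>. 1 / (of_real x + of_real y * \<tau>)\<^sup>2) \<longlongrightarrow> 0) cusp"
proof -
  have "filterlim (\<lambda>\<tau>::complex. \<tau>) at_infinity cusp"
    unfolding cusp_def filterlim_def by simp
  then have "filterlim (\<lambda>\<tau>. of_real y * \<tau>) at_infinity cusp"
    using tendsto_mult_filterlim_at_infinity[OF tendsto_const[of "complex_of_real y"]] assms by simp
  then have "filterlim (\<lambda>\<tau>. of_real x + of_real y * \<tau>) at_infinity cusp"
    by (rule tendsto_add_filterlim_at_infinity[OF tendsto_const])
  then have "((\<lambda>\<tau>. inverse (of_real x + of_real y * \<tau>)) \<longlongrightarrow> 0) cusp"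
    by (rule filterlim_compose[OF tendsto_inverse_0])
  then have "((\<lambda>\<tau>. (inverse (of_real x + of_real y * \<tau>))\<^sup>2) \<longlongrightarrow> 0\<^sup>2) cusp"
    by (rule tendsto_power)
  then show ?thesis by (simp add: inverse_eq_divide power_one_over)
qed

text \<open>
  \<open>e\<^sub>2 - e\<^sub>3\<close> is a sum of differences of two inverse squares of numbers \<open>x + (1/2 - j) \<tau>\<close>.
  The coefficient \<open>1/2 - j\<close> of \<open>\<tau>\<close> is never \<open>0\<close>, so each term tends to \<open>0\<close>.
\<close>

lemma half_value_difference_tendsto:
  "((\<lambda>\<tau>. half_value (1 / 2) (1 / 2) \<tau> - half_value 0 (1 / 2) \<tau>) \<longlongrightarrow> 0) cusp"
proof -
  define f where "f = (\<lambda>p \<tau>. half_term (1 / 2) (1 / 2) p \<tau> - half_term 0 (1 / 2) p \<tau>)"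
  have f: "f (i, j) \<tau> = 1 / (of_real (1 / 2 - of_int i) + of_real (1 / 2 - of_int j) * \<tau>)\<^sup>2
      - 1 / (of_real (0 - of_int i) + of_real (1 / 2 - of_int j) * \<tau>)\<^sup>2" for i j \<tau>
    by (simp add: f_def half_term_def)
  have "((\<lambda>\<tau>. \<Sum>\<^sub>\<infinity>p\<in>nonzero_pairs. f p \<tau>) \<longlongrightarrow> (\<Sum>\<^sub>\<infinity>p\<in>nonzero_pairs. 0)) cusp"
  proof (rule infsum_tendsto_dominated)
    fix p :: "int \<times> int"
    obtain i j where p: "p = (i, j)" by force
    have "1 / 2 - real_of_int j \<noteq> 0"
    proof
      assume "1 / 2 - real_of_int j = 0"
      then have "real_of_int (2 * j) = 1" by simp
      then have "2 * j = 1" by linarith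
      then show False by presburger
    qed
    from tendsto_diff[OF inverse_square_tendsto_cusp[OF this, of "1 / 2 - of_int i"]
        inverse_square_tendsto_cusp[OF this, of "0 - of_int i"]]
    have "((\<lambda>\<tau>. f (i, j) \<tau>) \<longlongrightarrow> 0 - 0) cusp" unfolding f .
    then show "(f p \<longlongrightarrow> 0) cusp" unfolding p by simp
  next
    show "\<forall>\<^sub>F \<tau> in cusp. \<forall>p\<in>nonzero_pairs. norm (f p \<tau>) \<le> 2 * (1 / 2) * (2 * 4) ^ 3 * lattice_weight p"
    proof (rule eventually_cusp, intro ballI)
      fix \<tau> p assume \<tau>: "\<tau> \<in> reduced_region" and p: "p \<in> nonzero_pairs"
      obtain i j where ij: "p = (i, j)" by force
      have im: "Im \<tau> \<noteq> 0" using \<tau> by (auto simp: reduced_region_def)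
      define A B where "A = of_real (1 / 2 - of_int i) + of_real (1 / 2 - of_int j) * \<tau>"
        and "B = of_real (0 - of_int i) + of_real (1 / 2 - of_int j) * \<tau>"
      have "real_of_int (max \<bar>i\<bar> \<bar>j\<bar>) \<le> (2 * 4) * norm X" if "X \<in> {A, B}" for X
      proof -
        have "real_of_int (max \<bar>i\<bar> \<bar>j\<bar>) \<le> (2 * skew \<tau>) * norm X"
          using that half_lower_bound[OF im, of "1 / 2" "1 / 2" i j] half_lower_bound[OF im, of 0 "1 / 2" i j]
          by (auto simp: A_def B_def)
        also have "\<dots> \<le> (2 * 4) * norm X"
          by (intro mult_right_mono) (use reduced_skew[OF \<tau>] in auto)
        finally show ?thesis .
      qed
      then have "norm (1 / A\<^sup>2 - 1 / B\<^sup>2) \<le> 2 * norm (A - B) * (2 * 4) ^ 3 * (1 / real_of_int (max \<bar>i\<bar> \<bar>j\<bar>) ^ 3)"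
        using p by (intro inverse_square_diff_bound max_pos) (auto simp: ij)
      moreover have "A - B = of_real (1 / 2)" by (simp add: A_def B_def)
      then have "norm (A - B) = 1 / 2" by (simp only: norm_of_real)
      ultimately show "norm (f p \<tau>) \<le> 2 * (1 / 2) * (2 * 4) ^ 3 * lattice_weight p"
        by (simp only: ij f A_def[symmetric] B_def[symmetric] lattice_weight_def prod.case)
    qed
    show "(\<lambda>p. 2 * (1 / 2) * (2 * 4) ^ 3 * lattice_weight p) summable_on nonzero_pairs"
      by (intro summable_on_cmult_right summable_on_subset_banach[OF lattice_weight_summable]) simp
  qed
  then have s: "((\<lambda>\<tau>. \<Sum>\<^sub>\<infinity>p\<in>nonzero_pairs. f p \<tau>) \<longlongrightarrow> 0) cusp"
    by (simp add: infsum_0)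
  have h: "((\<lambda>\<tau>. 1 / (of_real (1 / 2) + of_real (1 / 2) * \<tau>)\<^sup>2 - 1 / (of_real 0 + of_real (1 / 2) * \<tau>)\<^sup>2) \<longlongrightarrow> 0 - 0) cusp"
    by (intro tendsto_diff inverse_square_tendsto_cusp) auto
  have eq: "(1 / (of_real (1 / 2) + of_real (1 / 2) * \<tau>)\<^sup>2 - 1 / (of_real 0 + of_real (1 / 2) * \<tau>)\<^sup>2)
     + (\<Sum>\<^sub>\<infinity>p\<in>nonzero_pairs. f p \<tau>) = half_value (1 / 2) (1 / 2) \<tau> - half_value 0 (1 / 2) \<tau>"
    if "\<tau> \<in> reduced_region" for \<tau>
  proof -
    have im: "Im \<tau> \<noteq> 0" using that by (auto simp: reduced_region_def)
    have "(\<Sum>\<^sub>\<infinity>p\<in>nonzero_pairs. f p \<tau>) = (\<Sum>\<^sub>\<infinity>p\<in>nonzero_pairs. half_term (1 / 2) (1 / 2) p \<tau>)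
        - (\<Sum>\<^sub>\<infinity>p\<in>nonzero_pairs. half_term 0 (1 / 2) p \<tau>)"
    proof -
      have s: "(\<lambda>p. half_term (1 / 2) (1 / 2) p \<tau>) summable_on nonzero_pairs"
        "(\<lambda>p. half_term 0 (1 / 2) p \<tau>) summable_on nonzero_pairs"
        using im by (auto intro!: half_term_summable)
      then have "((\<lambda>p. - half_term 0 (1 / 2) p \<tau>) has_sum - (\<Sum>\<^sub>\<infinity>p\<in>nonzero_pairs. half_term 0 (1 / 2) p \<tau>)) nonzero_pairs"
        by (simp add: has_sum_uminus)
      from infsumI[OF has_sum_add[OF has_sum_infsum[OF s(1)] this]] show ?thesis
        by (simp add: f_def)
    qed
    then show ?thesis unfolding half_value_def by simp
  qed
  show ?thesis
    by (rule Lim_transform_eventually[OF tendsto_add[OF h s, simplified] eventually_cusp])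
       (use eq in simp)
qed

text \<open>
  In the limit only the row \<open>j = 0\<close> survives, and \<open>e\<^sub>1\<close> tends to \<open>4 + \<Sum>i. (1 / (1/2 - i)\<^sup>2 - 1 / i\<^sup>2)\<close>, the sum
  being over the nonzero integers. The terms for \<open>i\<close> and \<open>- i\<close> together are positive by convexity, so
  the limit is at least \<open>4\<close>.
\<close>

lemma half_value_tendsto_nonzero:
  "\<exists>c. c \<noteq> 0 \<and> (half_value (1 / 2) 0 \<longlongrightarrow> c) cusp"
proof -
  define T where "T = (\<lambda>(i :: int, j :: int). if j = 0 then 1 / (1 / 2 - real_of_int i)\<^sup>2 - 1 / (real_of_int i)\<^sup>2 else 0)"
  have "((\<lambda>\<tau>. \<Sum>\<^sub>\<infinity>p\<in>nonzero_pairs. half_term (1 / 2) 0 p \<tau>) \<longlongrightarrow> (\<Sum>\<^sub>\<infinity>p\<in>nonzero_pairs. of_real (T p))) cusp"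
  proof (rule infsum_tendsto_dominated)
    fix p :: "int \<times> int"
    obtain i j where p: "p = (i, j)" by force
    show "(half_term (1 / 2) 0 p \<longlongrightarrow> of_real (T p)) cusp"
    proof (cases "j = 0")
      case True
      have "half_term (1 / 2) 0 p = (\<lambda>\<tau>. of_real (T p))"
        by (simp add: fun_eq_iff p True half_term_def T_def)
      then show ?thesis by simp
    next
      case False
      then have "0 - real_of_int j \<noteq> 0" "real_of_int j \<noteq> 0" by auto
      from tendsto_diff[OF inverse_square_tendsto_cusp[OF this(1), of "1 / 2 - of_int i"]
          inverse_square_tendsto_cusp[OF this(2), of "of_int i"]]
      have "(half_term (1 / 2) 0 p \<longlongrightarrow> 0 - 0) cusp"
        unfolding p half_term_def prod.case by simp
      then show ?thesis using False by (simp add: p T_def)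
    qed
  next
    show "\<forall>\<^sub>F \<tau> in cusp. \<forall>p\<in>nonzero_pairs. norm (half_term (1 / 2) 0 p \<tau>) \<le> 2 * (1 / 2) * (2 * 4) ^ 3 * lattice_weight p"
    proof (rule eventually_cusp, intro ballI)
      fix \<tau> p assume \<tau>: "\<tau> \<in> reduced_region" and p: "p \<in> nonzero_pairs"
      have im: "Im \<tau> \<noteq> 0" using \<tau> by (auto simp: reduced_region_def)
      have "norm (half_term (1 / 2) 0 p \<tau>) \<le> 2 * norm (of_real (1 / 2) + of_real 0 * \<tau>) * (2 * skew \<tau>) ^ 3 * lattice_weight p"
        by (rule half_term_bound[OF im _ _ p]) auto
      also have "\<dots> = 2 * (1 / 2) * (2 * skew \<tau>) ^ 3 * lattice_weight p"
        by simp
      also have "\<dots> \<le> 2 * (1 / 2) * (2 * 4) ^ 3 * lattice_weight p"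
        using reduced_skew[OF \<tau>] skew_pos[of \<tau>]
        by (intro mult_right_mono mult_left_mono power_mono) (auto simp: lattice_weight_def case_prod_unfold)
      finally show "norm (half_term (1 / 2) 0 p \<tau>) \<le> 2 * (1 / 2) * (2 * 4) ^ 3 * lattice_weight p" .
    qed
    show "(\<lambda>p. 2 * (1 / 2) * (2 * 4) ^ 3 * lattice_weight p) summable_on nonzero_pairs"
      by (intro summable_on_cmult_right summable_on_subset_banach[OF lattice_weight_summable]) simp
  qed
  moreover have "(\<Sum>\<^sub>\<infinity>p\<in>nonzero_pairs. complex_of_real (T p)) = of_real (infsum T nonzero_pairs)"
  proof (cases "T summable_on nonzero_pairs")
    case True
    show ?thesis by (rule infsumI[OF has_sum_of_real[OF has_sum_infsum[OF True]]])
  next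
    case False
    have "\<not> (\<lambda>p. complex_of_real (T p)) summable_on nonzero_pairs"
      using summable_on_Re[of "\<lambda>p. complex_of_real (T p)" nonzero_pairs] False by auto
    with False show ?thesis by (simp add: infsum_not_exists)
  qed
  ultimately have lim: "(half_value (1 / 2) 0 \<longlongrightarrow> 4 + of_real (infsum T nonzero_pairs)) cusp"
    unfolding half_value_def[abs_def] by (auto intro!: tendsto_eq_intros simp: power2_eq_square)
  have "infsum T nonzero_pairs \<ge> 0"
  proof -
    have sym: "infsum T nonzero_pairs = infsum (\<lambda>(i, j). T (- i, - j)) nonzero_pairs"
      by (rule infsum_reindex_bij_witness[where i = "\<lambda>(i, j). (- i, - j)" and j = "\<lambda>(i, j). (- i, - j)"])
         (auto simp: nonzero_pairs_def)
    show ?thesis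
    proof (cases "T summable_on nonzero_pairs")
      case False
      then show ?thesis by (simp add: infsum_not_exists)
    next
      case True
      have "(\<lambda>(i, j). T (- i, - j)) summable_on nonzero_pairs \<longleftrightarrow> T summable_on nonzero_pairs"
        by (rule summable_on_reindex_bij_witness[where i = "\<lambda>(i, j). (- i, - j)" and j = "\<lambda>(i, j). (- i, - j)"])
           (auto simp: nonzero_pairs_def)
      with True have "infsum T nonzero_pairs + infsum (\<lambda>(i, j). T (- i, - j)) nonzero_pairs
          = infsum (\<lambda>p. T p + (\<lambda>(i, j). T (- i, - j)) p) nonzero_pairs"
        by (intro infsum_add[symmetric]) auto
      also have "\<dots> \<ge> 0"
      proof (rule infsum_nonneg)
        fix p :: "int \<times> int" assume "p \<in> nonzero_pairs"
        obtain i j where p: "p = (i, j)" by force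
        show "0 \<le> T p + (\<lambda>(i, j). T (- i, - j)) p"
        proof (cases "j = 0 \<and> i \<noteq> 0")
          case True
          define x where "x = (real_of_int i)\<^sup>2"
          have "\<bar>real_of_int i\<bar> \<ge> 1" using True by linarith
          then have x: "x \<ge> 1" unfolding x_def by (metis abs_le_square_iff abs_one one_power2)
          have nz: "1 / 2 - real_of_int i \<noteq> 0" "1 / 2 + real_of_int i \<noteq> 0"
          proof -
            have "2 * i \<noteq> 1" "2 * i \<noteq> - 1" by presburger+
            then have "2 * real_of_int i \<noteq> 1" "2 * real_of_int i \<noteq> - 1" by linarith+
            then show "1 / 2 - real_of_int i \<noteq> 0" "1 / 2 + real_of_int i \<noteq> 0" by linarith+
          qed
          have "1 / (1 / 2 - real_of_int i)\<^sup>2 + 1 / (1 / 2 + real_of_int i)\<^sup>2 = (2 * x + 1 / 2) / (x - 1 / 4)\<^sup>2"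
          proof -
            have "(1 / 2 - real_of_int i)\<^sup>2 + (1 / 2 + real_of_int i)\<^sup>2 = 2 * x + 1 / 2"
              by (simp add: x_def power2_eq_square algebra_simps)
            moreover have "(1 / 2 - real_of_int i)\<^sup>2 * (1 / 2 + real_of_int i)\<^sup>2 = (x - 1 / 4)\<^sup>2"
              by (simp add: x_def power2_eq_square algebra_simps)
            moreover have "1 / u + 1 / v = (u + v) / (u * v)" if "u \<noteq> 0" "v \<noteq> 0" for u v :: real
              using that by (simp add: field_simps)
            ultimately show ?thesis using nz by simp
          qed
          moreover have "(2 * x + 1 / 2) / (x - 1 / 4)\<^sup>2 \<ge> 2 / x"
          proof -
            have "2 * (x - 1 / 4)\<^sup>2 \<le> (2 * x + 1 / 2) * x"
              using x by (simp add: power2_eq_square algebra_simps)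
            moreover have "(x - 1 / 4)\<^sup>2 > 0" using x by simp
            ultimately show ?thesis using x by (simp add: field_simps)
          qed
          ultimately show ?thesis
            using True by (simp add: p T_def x_def)
        qed (auto simp: p T_def)
      qed
      finally show ?thesis using sym by simp
    qed
  qed
  then have "4 + complex_of_real (infsum T nonzero_pairs) \<noteq> 0"
    by (metis Re_complex_of_real add_pos_nonneg complex_Re_numeral less_irrefl plus_complex.simps(1) zero_complex.simps(1) zero_less_numeral)
  with lim show ?thesis by blast
qed

section \<open>Change of basis and the j-function\<close>

lemma period_lattice_swap: "period_lattice b a = period_lattice a b"
  unfolding period_lattice_def by (force simp: add.commute)

lemma period_lattice_shift: "period_lattice a (b + of_int k * a) = period_lattice a b"
proof -
  have "2 * of_int i * a + 2 * of_int j * (b + of_int k * a) = 2 * of_int (i + j * k) * a + 2 * of_int j * b" for i j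
    by (simp add: algebra_simps)
  moreover have "2 * of_int i * a + 2 * of_int j * b = 2 * of_int (i - j * k) * a + 2 * of_int j * (b + of_int k * a)" for i j
    by (simp add: algebra_simps)
  ultimately show ?thesis
    unfolding period_lattice_def by blast
qed

lemma period_lattice_uminus: "period_lattice a (- b) = period_lattice a b"
proof -
  have "2 * of_int i * a + 2 * of_int j * (- b) = 2 * of_int i * a + 2 * of_int (- j) * b" for i j
    by simp
  moreover have "2 * of_int i * a + 2 * of_int j * b = 2 * of_int i * a + 2 * of_int (- j) * (- b)" for i j
    by simp
  ultimately show ?thesis
    unfolding period_lattice_def by blast
qed

lemma wp_cong: "period_lattice v1 v3 = period_lattice w1 w3 \<Longrightarrow> wp v1 v3 = wp w1 w3"
  by (simp add: fun_eq_iff wp_def)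

text \<open>
  The modular lambda function of the ordered basis.
\<close>

definition modular_lambda :: "complex \<Rightarrow> complex \<Rightarrow> complex" where
  "modular_lambda w1 w3 = (e3 w1 w3 - e1 w1 w3) / (e2 w1 w3 - e1 w1 w3)"

text \<open>
  Klein's invariant up to a constant factor. It is invariant under the six substitutions of
  \<open>modular_lambda\<close> that permutations of the half-period values induce.
\<close>

definition j_of_lambda :: "complex \<Rightarrow> complex" where
  "j_of_lambda l = (l\<^sup>2 - l + 1) ^ 3 / (l\<^sup>2 * (l - 1)\<^sup>2)"

lemma (in wp_lattice) modulus_eq_modular_lambda: "modulus = modular_lambda w1 w3"
  by (simp add: modulus_def \<kappa>_def modular_lambda_def)

lemma (in wp_lattice) modular_lambda_neq: "modular_lambda w1 w3 \<noteq> 0" "modular_lambda w1 w3 \<noteq> 1"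
  using E_distinct by (auto simp: modular_lambda_def divide_eq_1_iff)

text \<open>
  Express \<open>e\<^sub>1, e\<^sub>2, e\<^sub>3\<close> with sum \<open>0\<close> through \<open>\<kappa>\<close> and the modular lambda function.
  The invariants \<open>g2\<close> and \<open>g3\<close> depend on the lattice only, and so does the right-hand side.
\<close>

lemma (in wp_lattice) j_of_modular_lambda:
  "j_of_lambda (modular_lambda w1 w3) = 27 / 4 * g2 ^ 3 / (g2 ^ 3 - 27 * g3\<^sup>2)"
proof -
  define l where "l = modular_lambda w1 w3"
  \<comment> \<open>As the half-period values have sum \<open>0\<close>, they are \<open>\<kappa> e\<close>, \<open>\<kappa> (e + 1)\<close> and \<open>\<kappa> (e + l)\<close>.\<close>
  define e where "e = - (1 + l) / 3"
  have l: "l = - 3 * e - 1" by (simp add: e_def field_simps)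
  have E: "E2 = E1 + \<kappa>" "E3 = E1 + \<kappa> * l"
    using E_eq by (simp_all add: l_def modulus_eq_modular_lambda)
  have "3 * E1 = - \<kappa> * (1 + l)"
    using E_relations(1) unfolding E by (simp add: algebra_simps eq_neg_iff_add_eq_0)
  then have E1: "E1 = \<kappa> * e" by (simp add: e_def field_simps)
  have g: "g2 = - 4 * \<kappa>\<^sup>2 * (e * (e + 1) + e * (e + l) + (e + 1) * (e + l))"
    "g3 = 4 * \<kappa> ^ 3 * (e * (e + 1) * (e + l))"
    unfolding E_relations(2,3) E E1 by (simp_all add: power2_eq_square power3_eq_cube algebra_simps)
  have g2: "3 * g2 = 4 * \<kappa>\<^sup>2 * (l\<^sup>2 - l + 1)"
    unfolding g l by (simp add: power2_eq_square algebra_simps)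
  have d: "g2 ^ 3 - 27 * g3\<^sup>2 = 16 * \<kappa> ^ 6 * (l\<^sup>2 * (l - 1)\<^sup>2)"
    unfolding g l by (simp add: eval_nat_numeral algebra_simps)
  have "27 * g2 ^ 3 = (3 * g2) ^ 3" by (simp add: power_mult_distrib)
  also have "\<dots> = 64 * \<kappa> ^ 6 * (l\<^sup>2 - l + 1) ^ 3"
    unfolding g2 by (simp add: power_mult_distrib flip: power_mult)
  finally have "27 / 4 * g2 ^ 3 = 16 * \<kappa> ^ 6 * (l\<^sup>2 - l + 1) ^ 3" by simp
  then have "27 / 4 * g2 ^ 3 / (g2 ^ 3 - 27 * g3\<^sup>2) = (16 * \<kappa> ^ 6 * (l\<^sup>2 - l + 1) ^ 3) / (16 * \<kappa> ^ 6 * (l\<^sup>2 * (l - 1)\<^sup>2))"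
    unfolding d by simp
  also have "\<dots> = j_of_lambda l"
    using \<kappa>_nz unfolding j_of_lambda_def by (subst mult_divide_mult_cancel_left) auto
  finally show ?thesis by (simp add: l_def)
qed

lemma j_of_modular_lambda_cong:
  assumes "wp_lattice v1 v3" "wp_lattice w1 w3" "period_lattice v1 v3 = period_lattice w1 w3"
  shows "j_of_lambda (modular_lambda v1 v3) = j_of_lambda (modular_lambda w1 w3)"
proof -
  note c = wp_cong[OF assms(3)]
  have "wp_lattice.g2 v1 v3 = wp_lattice.g2 w1 w3"
    unfolding wp_lattice.g2_def[OF assms(1)] wp_lattice.g2_def[OF assms(2)] c assms(3) ..
  moreover from this have "wp_lattice.g3 v1 v3 = wp_lattice.g3 w1 w3"
    unfolding wp_lattice.g3_def[OF assms(1)] wp_lattice.g3_def[OF assms(2)] c assms(3) by simp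
  ultimately show ?thesis
    unfolding wp_lattice.j_of_modular_lambda[OF assms(1)] wp_lattice.j_of_modular_lambda[OF assms(2)] by simp
qed

lemma wp_scale:
  assumes "c \<noteq> 0"
  shows "wp (c * w1) (c * w3) (c * x) = wp w1 w3 x / c\<^sup>2"
proof -
  have L: "period_lattice (c * w1) (c * w3) = (\<lambda>w. c * w) ` period_lattice w1 w3"
  proof -
    have "2 * of_int i * (c * w1) + 2 * of_int j * (c * w3) = c * (2 * of_int i * w1 + 2 * of_int j * w3)" for i j
      by (simp add: algebra_simps)
    then show ?thesis unfolding period_lattice_def by (auto simp: image_iff)
  qed
  have L0: "period_lattice (c * w1) (c * w3) - {0} = (\<lambda>w. c * w) ` (period_lattice w1 w3 - {0})"
    unfolding L using assms by auto
  have inj: "inj_on (\<lambda>w. c * w) (period_lattice w1 w3 - {0})"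
    using assms by (auto simp: inj_on_def)
  have "(\<Sum>\<^sub>\<infinity>w\<in>period_lattice (c * w1) (c * w3) - {0}. 1 / (c * x - w)\<^sup>2 - 1 / w\<^sup>2)
      = (\<Sum>\<^sub>\<infinity>w\<in>period_lattice w1 w3 - {0}. 1 / (c * x - c * w)\<^sup>2 - 1 / (c * w)\<^sup>2)"
    unfolding L0 by (subst infsum_reindex[OF inj]) (simp add: o_def)
  also have "\<dots> = (\<Sum>\<^sub>\<infinity>w\<in>period_lattice w1 w3 - {0}. 1 / c\<^sup>2 * (1 / (x - w)\<^sup>2 - 1 / w\<^sup>2))"
  proof (rule infsum_cong)
    fix w
    have "c * x - c * w = c * (x - w)" by (simp add: algebra_simps)
    moreover have "1 / (k * u) - 1 / (k * v) = 1 / k * (1 / u - 1 / v)" for k u v :: complex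
      by (simp add: right_diff_distrib)
    ultimately show "1 / (c * x - c * w)\<^sup>2 - 1 / (c * w)\<^sup>2 = 1 / c\<^sup>2 * (1 / (x - w)\<^sup>2 - 1 / w\<^sup>2)"
      by (simp only: power_mult_distrib)
  qed
  also have "\<dots> = 1 / c\<^sup>2 * (\<Sum>\<^sub>\<infinity>w\<in>period_lattice w1 w3 - {0}. 1 / (x - w)\<^sup>2 - 1 / w\<^sup>2)"
    by (rule infsum_cmult_right')
  finally show ?thesis
    unfolding wp_def by (simp add: power_mult_distrib add_divide_distrib)
qed

lemma modular_lambda_scale:
  assumes "c \<noteq> 0"
  shows "modular_lambda (c * w1) (c * w3) = modular_lambda w1 w3"
proof -
  have "e1 (c * w1) (c * w3) = e1 w1 w3 / c\<^sup>2" "e2 (c * w1) (c * w3) = e2 w1 w3 / c\<^sup>2"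
    "e3 (c * w1) (c * w3) = e3 w1 w3 / c\<^sup>2"
    using wp_scale[OF assms, of w1 w3 w1] wp_scale[OF assms, of w1 w3 w3] wp_scale[OF assms, of w1 w3 "w1 + w3"]
    by (simp_all add: e1_def e2_def e3_def algebra_simps)
  then show ?thesis using assms unfolding modular_lambda_def by (simp flip: diff_divide_distrib)
qed

definition j_tau :: "complex \<Rightarrow> complex" where
  "j_tau \<tau> = j_of_lambda (modular_lambda (1 / 2) (\<tau> / 2))"

lemma Im_divide_swap: "Im (x / y) \<noteq> 0 \<Longrightarrow> Im (y / x) \<noteq> 0"
proof
  assume "Im (x / y) \<noteq> 0" "Im (y / x) = 0"
  then have "y / x \<in> \<real>" by (simp add: complex_is_Real_iff)
  then have "inverse (y / x) \<in> \<real>" by (rule Reals_inverse)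
  then have "x / y \<in> \<real>" by (simp only: inverse_divide)
  with \<open>Im (x / y) \<noteq> 0\<close> show False by (simp add: complex_is_Real_iff)
qed

text \<open>
  Choose \<open>v\<^sub>1\<close> of least length among all first members of bases, and subtract from \<open>v\<^sub>3\<close> the nearest multiple
  of \<open>v\<^sub>1\<close>. The reduced \<open>v\<^sub>3\<close> is itself the first member of a basis, so it is not shorter than \<open>v\<^sub>1\<close>.
\<close>

lemma reduced_basis:
  assumes "wp_lattice w1 w3"
  shows "\<exists>\<tau>\<in>reduced_region. j_of_lambda (modular_lambda w1 w3) = j_tau \<tau>"
proof -
  interpret wp_lattice w1 w3 by fact
  define B where "B = {v1. \<exists>v3. Im (v3 / v1) \<noteq> 0 \<and> period_lattice v1 v3 = \<Lambda>}"
  have w1B: "w1 \<in> B" using nondegenerate by (auto simp: B_def)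
  have "(\<lambda>v. 2 * v) ` B \<subseteq> \<Lambda>"
  proof
    fix x assume "x \<in> (\<lambda>v. 2 * v) ` B"
    then obtain v1 v3 where v: "x = 2 * v1" "period_lattice v1 v3 = \<Lambda>" by (auto simp: B_def)
    have "2 * of_int 1 * v1 + 2 * of_int 0 * v3 \<in> period_lattice v1 v3"
      unfolding period_lattice_def by blast
    then show "x \<in> \<Lambda>" using v by simp
  qed
  then have "closed ((\<lambda>v. 2 * v) ` B)" by (rule closed_sub_lattice)
  then obtain x where "x \<in> (\<lambda>v. 2 * v) ` B" "\<And>y. y \<in> (\<lambda>v. 2 * v) ` B \<Longrightarrow> dist 0 x \<le> dist 0 y"
    using distance_attains_inf[of "(\<lambda>v. 2 * v) ` B" 0] w1B by blast
  then obtain v1 where v: "v1 \<in> B" "\<And>y. y \<in> (\<lambda>v. 2 * v) ` B \<Longrightarrow> dist 0 (2 * v1) \<le> dist 0 y"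
    by blast
  have v1: "v1 \<in> B" "norm v1 \<le> norm y" if "y \<in> B" for y
    using v(1) v(2)[of "2 * y"] that by (simp_all add: norm_mult)
  then obtain v3 where v3: "Im (v3 / v1) \<noteq> 0" "period_lattice v1 v3 = \<Lambda>"
    using v(1) by (auto simp: B_def)
  have v1nz: "v1 \<noteq> 0" using v3(1) by auto
  \<comment> \<open>Reduction of \<open>v3\<close> modulo \<open>v1\<close>; it changes neither the lattice nor the imaginary part of the ratio.\<close>
  define u where "u = v3 + of_int (- round (Re (v3 / v1))) * v1"
  have uL: "period_lattice v1 u = \<Lambda>" unfolding u_def period_lattice_shift by (rule v3(2))
  have uq: "u / v1 = v3 / v1 - of_int (round (Re (v3 / v1)))"
    using v1nz by (simp add: u_def field_simps)
  have uIm: "Im (u / v1) \<noteq> 0" using v3(1) unfolding uq by simp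
  have uRe: "\<bar>Re (u / v1)\<bar> \<le> 1 / 2"
    unfolding uq using of_int_round_abs_le[of "Re (v3 / v1)"] by (simp add: abs_minus_commute)
  have "u \<in> B"
    unfolding B_def using Im_divide_swap[OF uIm] uL period_lattice_swap[of u v1] by auto
  then have "norm v1 \<le> norm u" by (rule v1(2))
  then have un: "norm (u / v1) \<ge> 1" using v1nz by (simp add: norm_divide)
  define t where "t = (if Im (u / v1) > 0 then u else - u)"
  have tL: "period_lattice v1 t = \<Lambda>" using uL by (simp add: t_def period_lattice_uminus)
  have t: "t / v1 \<in> reduced_region"
    using uIm uRe un by (auto simp: t_def reduced_region_def)
  then have lat: "wp_lattice v1 t" by (simp add: wp_lattice_def reduced_region_def)
  have "j_of_lambda (modular_lambda w1 w3) = j_of_lambda (modular_lambda v1 t)"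
    using j_of_modular_lambda_cong[OF lat assms tL] by simp
  also have "modular_lambda v1 t = modular_lambda (1 / 2) (t / v1 / 2)"
    using modular_lambda_scale[of "1 / (2 * v1)" v1 t] v1nz by (simp add: field_simps)
  finally have "j_of_lambda (modular_lambda w1 w3) = j_tau (t / v1)" by (simp only: j_tau_def)
  with t show ?thesis by blast
qed

section \<open>The j-function takes every value\<close>

lemma half_values_relations:
  assumes "Im \<tau> > 0"
  shows "half_value (1 / 2) (1 / 2) \<tau> \<noteq> half_value (1 / 2) 0 \<tau>"
    "modular_lambda (1 / 2) (\<tau> / 2) \<noteq> 0" "modular_lambda (1 / 2) (\<tau> / 2) \<noteq> 1"
    "half_value (1 / 2) 0 \<tau> + half_value (1 / 2) (1 / 2) \<tau> + half_value 0 (1 / 2) \<tau> = 0"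
    "modular_lambda (1 / 2) (\<tau> / 2) = (half_value 0 (1 / 2) \<tau> - half_value (1 / 2) 0 \<tau>)
       / (half_value (1 / 2) (1 / 2) \<tau> - half_value (1 / 2) 0 \<tau>)"
proof -
  have im: "Im \<tau> \<noteq> 0" using assms by simp
  interpret wp_lattice "1 / 2" "\<tau> / 2" by (rule wp_lattice_normalized[OF im])
  note h = wp_normalized_half_periods[OF im]
  show "half_value (1 / 2) (1 / 2) \<tau> \<noteq> half_value (1 / 2) 0 \<tau>"
    using E_distinct(1) unfolding h by simp
  show "modular_lambda (1 / 2) (\<tau> / 2) \<noteq> 0" "modular_lambda (1 / 2) (\<tau> / 2) \<noteq> 1" by (rule modular_lambda_neq)+
  show "half_value (1 / 2) 0 \<tau> + half_value (1 / 2) (1 / 2) \<tau> + half_value 0 (1 / 2) \<tau> = 0"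
    using E_relations(1) unfolding h .
  show "modular_lambda (1 / 2) (\<tau> / 2) = (half_value 0 (1 / 2) \<tau> - half_value (1 / 2) 0 \<tau>)
       / (half_value (1 / 2) (1 / 2) \<tau> - half_value (1 / 2) 0 \<tau>)"
    unfolding modular_lambda_def h ..
qed

lemma j_tau_holomorphic: "j_tau holomorphic_on {\<tau>. Im \<tau> > 0}"
proof -
  have "(\<lambda>\<tau>. (half_value 0 (1 / 2) \<tau> - half_value (1 / 2) 0 \<tau>)
       / (half_value (1 / 2) (1 / 2) \<tau> - half_value (1 / 2) 0 \<tau>)) holomorphic_on {\<tau>. Im \<tau> > 0}"
    by (intro holomorphic_intros half_value_holomorphic) (use half_values_relations(1) in auto)
  then have l: "(\<lambda>\<tau>. modular_lambda (1 / 2) (\<tau> / 2)) holomorphic_on {\<tau>. Im \<tau> > 0}"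
    by (rule holomorphic_transform) (simp add: half_values_relations(5))
  show ?thesis
    unfolding j_tau_def[abs_def] j_of_lambda_def
    by (intro holomorphic_intros l) (use half_values_relations in auto)
qed

text \<open>
  As \<open>e\<^sub>1 + e\<^sub>2 + e\<^sub>3 = 0\<close>, the limits \<open>e\<^sub>1 \<longlongrightarrow> c \<noteq> 0\<close> and \<open>e\<^sub>2 - e\<^sub>3 \<longlongrightarrow> 0\<close> force \<open>e\<^sub>2 - e\<^sub>1 \<longlongrightarrow> - 3 c / 2\<close>. Hence lambda
  tends to \<open>1\<close>, where \<open>j_of_lambda\<close> has a pole.
\<close>

lemma j_tau_cusp: "filterlim j_tau at_infinity cusp"
proof -
  define X Y W where "X = half_value (1 / 2) 0" and "Y = half_value (1 / 2) (1 / 2)" and "W = half_value 0 (1 / 2)"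
  obtain c where c: "c \<noteq> 0" "(X \<longlongrightarrow> c) cusp" using half_value_tendsto_nonzero unfolding X_def by blast
  have D: "((\<lambda>\<tau>. Y \<tau> - W \<tau>) \<longlongrightarrow> 0) cusp" unfolding Y_def W_def by (rule half_value_difference_tendsto)
  have "((\<lambda>\<tau>. 1 - 2 * (Y \<tau> - W \<tau>) / ((Y \<tau> - W \<tau>) - 3 * X \<tau>)) \<longlongrightarrow> 1 - 2 * 0 / (0 - 3 * c)) cusp"
    by (intro tendsto_intros D c(2)) (use c(1) in simp)
  then have lim: "((\<lambda>\<tau>. modular_lambda (1 / 2) (\<tau> / 2)) \<longlongrightarrow> 1) cusp"
  proof (rule Lim_transform_eventually[THEN tendsto_eq_rhs, OF _ eventually_cusp])
    fix \<tau> assume "\<tau> \<in> reduced_region"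
    then have im: "Im \<tau> > 0" by (simp add: reduced_region_def)
    note h = half_values_relations[OF im, folded X_def Y_def W_def]
    have X: "X \<tau> = - Y \<tau> - W \<tau>" using h(4) by (simp add: eq_neg_iff_add_eq_0 algebra_simps)
    have ne: "Y \<tau> - X \<tau> \<noteq> 0" using h(1) by simp
    have e: "(Y \<tau> - W \<tau>) - 3 * X \<tau> = 2 * (Y \<tau> - X \<tau>)" unfolding X by (simp add: algebra_simps)
    show "1 - 2 * (Y \<tau> - W \<tau>) / ((Y \<tau> - W \<tau>) - 3 * X \<tau>) = modular_lambda (1 / 2) (\<tau> / 2)"
      unfolding e h(5) using ne by (simp add: field_simps)
  qed simp
  define l where "l = (\<lambda>\<tau>. modular_lambda (1 / 2) (\<tau> / 2))"
  have lim: "(l \<longlongrightarrow> 1) cusp" using lim by (simp add: l_def)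
  have N: "((\<lambda>\<tau>. ((l \<tau>)\<^sup>2 - l \<tau> + 1) ^ 3) \<longlongrightarrow> (1\<^sup>2 - 1 + 1) ^ 3) cusp"
    by (intro tendsto_intros lim)
  have Dn: "((\<lambda>\<tau>. (l \<tau>)\<^sup>2 * (l \<tau> - 1)\<^sup>2) \<longlongrightarrow> 1\<^sup>2 * (1 - 1)\<^sup>2) cusp"
    by (intro tendsto_intros lim)
  have "filterlim (\<lambda>\<tau>. (l \<tau>)\<^sup>2 * (l \<tau> - 1)\<^sup>2) (at 0) cusp"
  proof (rule filterlim_atI)
    show "((\<lambda>\<tau>. (l \<tau>)\<^sup>2 * (l \<tau> - 1)\<^sup>2) \<longlongrightarrow> 0) cusp" using Dn by simp
    show "\<forall>\<^sub>F \<tau> in cusp. (l \<tau>)\<^sup>2 * (l \<tau> - 1)\<^sup>2 \<noteq> 0"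
    proof (rule eventually_cusp)
      fix \<tau> assume "\<tau> \<in> reduced_region"
      then have im: "Im \<tau> > 0" by (simp add: reduced_region_def)
      show "(l \<tau>)\<^sup>2 * (l \<tau> - 1)\<^sup>2 \<noteq> 0"
        using half_values_relations(2,3)[OF im] by (simp add: l_def)
    qed
  qed
  from filterlim_divide_at_infinity[OF N this]
  show ?thesis by (simp add: j_tau_def[abs_def] j_of_lambda_def l_def)
qed

lemma j_tau_large:
  obtains B where "\<And>\<tau>. \<tau> \<in> reduced_region \<Longrightarrow> norm \<tau> \<ge> B \<Longrightarrow> norm (j_tau \<tau>) \<ge> R"
proof -
  have "eventually (\<lambda>\<tau>. norm (j_tau \<tau>) \<ge> R) cusp"
  proof (cases "R > 0")
    case True
    then show ?thesis using j_tau_cusp filterlim_at_infinity[of 0 j_tau cusp] by auto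
  next
    case False
    then show ?thesis by (intro always_eventually allI order_trans[OF _ norm_ge_zero]) simp
  qed
  then show ?thesis
    unfolding cusp_def eventually_inf_principal eventually_at_infinity using that by blast
qed

text \<open>
  The image is open by the open mapping theorem. It is closed: near a limit point \<open>y\<close> only ratios from a
  bounded part of the reduced region matter, since \<open>j_tau\<close> is large far out, and that part lies in a
  compact subset of the upper half-plane.
\<close>

lemma j_tau_surjective: "\<exists>\<tau>. Im \<tau> > 0 \<and> j_tau \<tau> = c"
proof -
  define H where "H = {\<tau>::complex. Im \<tau> > 0}"
  have H: "open H" "connected H"
    unfolding H_def by (rule open_halfspace_Im_gt) (intro convex_connected convex_halfspace_Im_gt)
  have red: "j_tau ` H = j_tau ` reduced_region"
  proof
    show "j_tau ` reduced_region \<subseteq> j_tau ` H" by (auto simp: H_def reduced_region_def)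
    show "j_tau ` H \<subseteq> j_tau ` reduced_region"
    proof
      fix y assume "y \<in> j_tau ` H"
      then obtain \<tau> where "Im \<tau> > 0" "y = j_tau \<tau>" by (auto simp: H_def)
      then show "y \<in> j_tau ` reduced_region"
        using reduced_basis[OF wp_lattice_normalized[of \<tau>]] by (auto simp: j_tau_def)
    qed
  qed
  have "\<not> j_tau constant_on H"
  proof
    assume "j_tau constant_on H"
    then obtain k where k: "\<And>\<tau>. \<tau> \<in> H \<Longrightarrow> j_tau \<tau> = k" unfolding constant_on_def by blast
    obtain B where B: "\<And>\<tau>. \<tau> \<in> reduced_region \<Longrightarrow> norm \<tau> \<ge> B \<Longrightarrow> norm (j_tau \<tau>) \<ge> norm k + 1"
      using j_tau_large by blast
    \<comment> \<open>A point of the imaginary axis far out in the reduced region.\<close>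
    define \<tau> where "\<tau> = \<i> * of_real (max 1 B)"
    have "\<tau> \<in> reduced_region" "norm \<tau> \<ge> B" "\<tau> \<in> H"
      by (auto simp: \<tau>_def reduced_region_def H_def norm_mult)
    with B[of \<tau>] k[of \<tau>] show False by simp
  qed
  then have op: "open (j_tau ` H)"
    using j_tau_holomorphic H unfolding H_def[symmetric] by (intro open_mapping_thm[of j_tau H H]) auto
  have "closed (j_tau ` H)"
  proof -
      have "y \<in> j_tau ` H" if y: "y \<in> closure (j_tau ` H)" for y
      proof -
        obtain B where B: "\<And>\<tau>. \<tau> \<in> reduced_region \<Longrightarrow> norm \<tau> \<ge> B \<Longrightarrow> norm (j_tau \<tau>) \<ge> norm y + 1"
          using j_tau_large by blast
        define C where "C = {\<tau>. Im \<tau> \<ge> 1 / 2 \<and> \<bar>Re \<tau>\<bar> \<le> 1 / 2 \<and> norm \<tau> \<ge> 1} \<inter> cball 0 B"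
        have "compact C"
          unfolding C_def
          by (intro closed_Int_compact compact_cball closed_Collect_conj closed_Collect_le continuous_intros)
        have CH: "C \<subseteq> H" by (auto simp: C_def H_def)
        have "continuous_on C j_tau"
          using holomorphic_on_imp_continuous_on[OF j_tau_holomorphic] CH
          unfolding H_def by (rule continuous_on_subset)
        then have cl: "closed (j_tau ` C)"
          using \<open>compact C\<close> by (intro compact_imp_closed compact_continuous_image)
        have "y \<in> closure (j_tau ` C)"
        proof (subst closure_approachable, intro allI impI)
          fix e :: real assume "e > 0"
          then obtain z where z: "z \<in> j_tau ` reduced_region" "dist z y < min e 1"
            using y unfolding red closure_approachable by (metis min_less_iff_conj zero_less_one)
          then obtain \<tau> where \<tau>: "\<tau> \<in> reduced_region" "z = j_tau \<tau>" by blast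
          have "norm (j_tau \<tau>) < norm y + 1"
            using z(2) norm_triangle_ineq2[of z y] by (simp add: \<tau>(2) dist_norm)
          then have "norm \<tau> < B" using B[OF \<tau>(1)] by force
          moreover have "Im \<tau> \<ge> 1 / 2"
          proof -
            have t: "Im \<tau> > 0" "\<bar>Re \<tau>\<bar> \<le> 1 / 2" "norm \<tau> \<ge> 1" using \<tau>(1) by (auto simp: reduced_region_def)
            have "(Re \<tau>)\<^sup>2 \<le> (1 / 2)\<^sup>2" using t(2) by (intro power2_le_iff_abs_le[THEN iffD2]) auto
            moreover have "(norm \<tau>)\<^sup>2 \<ge> 1" using t(3) by simp
            moreover have "(norm \<tau>)\<^sup>2 = (Re \<tau>)\<^sup>2 + (Im \<tau>)\<^sup>2" by (rule cmod_power2)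
            moreover have "(1 / 2 :: real)\<^sup>2 = 1 / 4" by (simp add: power2_eq_square)
            ultimately have "(1 / 2)\<^sup>2 \<le> (Im \<tau>)\<^sup>2" by linarith
            then show ?thesis by (rule power2_le_imp_le) (use t(1) in simp)
          qed
          ultimately have "\<tau> \<in> C" using \<tau>(1) by (auto simp: C_def reduced_region_def)
          then show "\<exists>w\<in>j_tau ` C. dist w y < e" using z(2) \<tau>(2) by auto
        qed
        then show ?thesis using cl CH by (auto simp: closure_closed)
      qed
      then show ?thesis by (metis closure_subset closed_closure subsetI subset_antisym)
  qed
  moreover have "j_tau \<i> \<in> j_tau ` H"
    by (rule imageI) (simp add: H_def)
  ultimately have "j_tau ` H = UNIV" using op clopen[of "j_tau ` H"] by auto
  then have "c \<in> j_tau ` H" by simp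
  then show ?thesis by (auto simp: H_def)
qed

section \<open>Every modulus occurs\<close>

text \<open>
  In terms of \<open>s = a\<^sup>2 - a\<close> and \<open>t = l\<^sup>2 - l\<close> the equation is \<open>(s + 1)\<^sup>3 t\<^sup>2 = (t + 1)\<^sup>3 s\<^sup>2\<close>. The factor \<open>s - t\<close> accounts for
  \<open>l\<close> and \<open>1 - l\<close>, the cofactor for the other four values.
\<close>

lemma j_of_lambda_eq_cases:
  assumes l: "l \<noteq> 0" "l \<noteq> 1" and a: "a \<noteq> 0" "a \<noteq> 1" and eq: "j_of_lambda a = j_of_lambda l"
  shows "a = l \<or> a = 1 - l \<or> a = 1 / l \<or> a = 1 / (1 - l) \<or> a = (l - 1) / l \<or> a = l / (l - 1)"
proof -
  have "(a\<^sup>2 - a + 1) ^ 3 * (l\<^sup>2 * (l - 1)\<^sup>2) = (l\<^sup>2 - l + 1) ^ 3 * (a\<^sup>2 * (a - 1)\<^sup>2)"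
    using eq l a unfolding j_of_lambda_def by (subst (asm) frac_eq_eq) auto
  moreover have "(a - l) * (a - 1 + l) * (a * l - 1) * (a * (1 - l) - 1) * (a * l - l + 1) * (a * (l - 1) - l)
     = - ((a\<^sup>2 - a + 1) ^ 3 * (l\<^sup>2 * (l - 1)\<^sup>2) - (l\<^sup>2 - l + 1) ^ 3 * (a\<^sup>2 * (a - 1)\<^sup>2))"
  proof -
    define s t where "s = a\<^sup>2 - a" and "t = l\<^sup>2 - l"
    have 1: "(a - l) * (a - 1 + l) = s - t"
      by (simp add: s_def t_def power2_eq_square algebra_simps)
    have 2: "(a * l - 1) * (a * (1 - l) - 1) * (a * l - l + 1) * (a * (l - 1) - l)
        = s + t + 3 * s * t - s\<^sup>2 * t\<^sup>2"
      by (simp add: s_def t_def power2_eq_square algebra_simps)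
    have 3: "l\<^sup>2 * (l - 1)\<^sup>2 = t\<^sup>2" "a\<^sup>2 * (a - 1)\<^sup>2 = s\<^sup>2"
      by (simp_all add: s_def t_def power2_eq_square algebra_simps)
    have "(s - t) * (s + t + 3 * s * t - s\<^sup>2 * t\<^sup>2) = - ((s + 1) ^ 3 * t\<^sup>2 - (t + 1) ^ 3 * s\<^sup>2)"
      by (simp add: power2_eq_square power3_eq_cube algebra_simps)
    then show ?thesis
      unfolding 3 s_def[symmetric] t_def[symmetric] 1[symmetric] 2[symmetric] by (simp only: mult.assoc)
  qed
  ultimately have "(a - l) * (a - 1 + l) * (a * l - 1) * (a * (1 - l) - 1) * (a * l - l + 1) * (a * (l - 1) - l) = 0"
    by simp
  then consider "a - l = 0" | "a - 1 + l = 0" | "a * l - 1 = 0" | "a * (1 - l) - 1 = 0" | "a * l - l + 1 = 0"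
    | "a * (l - 1) - l = 0" by auto
  then show ?thesis
  proof cases
    case 1 then show ?thesis by simp
  next
    case 2 then have "a = 1 - l" by (simp add: eq_diff_eq algebra_simps)
    then show ?thesis by simp
  next
    case 3 then have "a = 1 / l" using l by (simp add: field_simps)
    then show ?thesis by simp
  next
    case 4 then have "a = 1 / (1 - l)" using l by (simp add: eq_divide_eq)
    then show ?thesis by simp
  next
    case 5 then have "a * l = l - 1" by (simp add: algebra_simps)
    then have "a = (l - 1) / l" using l by (simp add: eq_divide_eq)
    then show ?thesis by simp
  next
    case 6 then have "a = l / (l - 1)" using l by (simp add: eq_divide_eq)
    then show ?thesis by simp
  qed
qed

definition is_modulus :: "complex \<Rightarrow> bool" where
  "is_modulus a \<longleftrightarrow> (\<exists>w1 w3. wp_lattice w1 w3 \<and> modular_lambda w1 w3 = a)"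

lemma is_modulus_swap: "is_modulus l \<Longrightarrow> is_modulus (l / (l - 1))"
proof -
  assume "is_modulus l"
  then obtain w1 w3 where w: "wp_lattice w1 w3" "modular_lambda w1 w3 = l" unfolding is_modulus_def by blast
  interpret wp_lattice w1 w3 by fact
  have lat: "wp_lattice w3 w1" using Im_divide_swap[OF nondegenerate] by (simp add: wp_lattice_def)
  have c: "wp w3 w1 = wp w1 w3" by (rule wp_cong[OF period_lattice_swap])
  have e: "e1 w3 w1 = E3" "e2 w3 w1 = E2" "e3 w3 w1 = E1"
    by (simp_all add: e1_def e2_def e3_def c add.commute)
  have "modular_lambda w3 w1 = (E1 - E3) / (E2 - E3)" by (simp add: modular_lambda_def e)
  also have "\<dots> = (E3 - E1) / (E3 - E2)"
    by (metis minus_diff_eq minus_divide_divide)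
  also have "\<dots> = l / (l - 1)"
  proof -
    have "l - 1 = (E3 - E2) / (E2 - E1)"
      using E_distinct unfolding w(2)[symmetric] modular_lambda_def by (simp add: field_simps)
    then show ?thesis
      using E_distinct unfolding w(2)[symmetric] modular_lambda_def by simp
  qed
  finally show ?thesis using lat unfolding is_modulus_def by blast
qed

lemma is_modulus_inverse: "is_modulus l \<Longrightarrow> is_modulus (1 / l)"
proof -
  assume "is_modulus l"
  then obtain w1 w3 where w: "wp_lattice w1 w3" "modular_lambda w1 w3 = l" unfolding is_modulus_def by blast
  interpret wp_lattice w1 w3 by fact
  have "(w3 + w1) / w1 = w3 / w1 + 1" using w1_nz by (simp add: field_simps)
  then have lat: "wp_lattice w1 (w3 + w1)" using nondegenerate by (simp add: wp_lattice_def)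
  have c: "wp w1 (w3 + w1) = wp w1 w3"
    using wp_cong[OF period_lattice_shift[of w1 w3 1]] by simp
  have "wp w1 w3 (w3 + 2 * w1) = wp w1 w3 w3" by (rule wp_periodic) (use half_periods in auto)
  then have e: "e1 w1 (w3 + w1) = E1" "e2 w1 (w3 + w1) = E3" "e3 w1 (w3 + w1) = E2"
  proof -
    have "w1 + (w3 + w1) = w3 + 2 * w1" by simp
    then show "e2 w1 (w3 + w1) = E3"
      using \<open>\<P> (w3 + 2 * w1) = \<P> w3\<close> by (simp only: e2_def e3_def c)
    show "e1 w1 (w3 + w1) = E1" unfolding e1_def c ..
    show "e3 w1 (w3 + w1) = E2" unfolding e2_def e3_def c by (simp add: add.commute)
  qed
  have "modular_lambda w1 (w3 + w1) = 1 / l" unfolding w(2)[symmetric] modular_lambda_def e by simp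
  then show ?thesis using lat unfolding is_modulus_def by blast
qed

text \<open>
  Exchanging \<open>w1\<close> and \<open>w3\<close> exchanges \<open>e\<^sub>1\<close> and \<open>e\<^sub>3\<close>; replacing \<open>w3\<close> by \<open>w1 + w3\<close> exchanges \<open>e\<^sub>2\<close> and \<open>e\<^sub>3\<close>. The
  two resulting substitutions \<open>l / (l - 1)\<close> and \<open>1 / l\<close> generate all six.
\<close>

theorem every_modulus_occurs:
  assumes a: "a \<noteq> 0" "a \<noteq> 1"
  shows "\<exists>w1 w3. wp_lattice w1 w3 \<and> (e3 w1 w3 - e1 w1 w3) / (e2 w1 w3 - e1 w1 w3) = a"
proof -
  obtain \<tau> where \<tau>: "Im \<tau> > 0" "j_tau \<tau> = j_of_lambda a" using j_tau_surjective by blast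
  define l where "l = modular_lambda (1 / 2) (\<tau> / 2)"
  have l: "l \<noteq> 0" "l \<noteq> 1" using half_values_relations[OF \<tau>(1)] by (auto simp: l_def)
  have 0: "is_modulus l"
    unfolding is_modulus_def l_def using wp_lattice_normalized[of \<tau>] \<tau>(1) by auto
  have 1: "is_modulus (l / (l - 1))" by (rule is_modulus_swap[OF 0])
  have 2: "is_modulus (1 / l)" by (rule is_modulus_inverse[OF 0])
  have 3: "is_modulus ((l - 1) / l)" using is_modulus_inverse[OF 1] by simp
  have "1 / l / (1 / l - 1) = 1 / (1 - l)" using l by (simp add: field_simps)
  then have 4: "is_modulus (1 / (1 - l))" using is_modulus_swap[OF 2] by simp
  have 5: "is_modulus (1 - l)" using is_modulus_inverse[OF 4] by simp
  have "j_of_lambda a = j_of_lambda l" using \<tau>(2) by (simp add: j_tau_def l_def)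
  from j_of_lambda_eq_cases[OF l a this] have "is_modulus a" using 0 1 2 3 4 5 by auto
  then show ?thesis unfolding is_modulus_def modular_lambda_def .
qed

section \<open>The equivalence\<close>

theorem corollary1:
  fixes a :: complex and M :: nat and m n :: "nat \<Rightarrow> nat" and b :: "nat \<Rightarrow> complex"
  assumes "a \<noteq> 0" and "a \<noteq> 1"
    and "inj_on b {1..M}"
    and "\<forall>k\<in>{1..M}. b k \<notin> {0, 1, a}"
  shows "fuchsian_finite_gap a m M n b \<longleftrightarrow>
    (\<exists>g. novikov_equation a (fuchs_I0 a m M n b) (fuchs_domain a M b) g)"
proof
  assume "fuchsian_finite_gap a m M n b"
  then obtain w1 w3 \<delta> where L: "Im (w3 / w1) \<noteq> 0"
    and a: "(e3 w1 w3 - e1 w1 w3) / (e2 w1 w3 - e1 w1 w3) = a"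
    and \<delta>: "\<And>k. k \<in> {1..M} \<Longrightarrow> wp w1 w3 (\<delta> k) = e1 w1 w3 + (e2 w1 w3 - e1 w1 w3) * b k"
      "\<And>k. k \<in> {1..M} \<Longrightarrow> \<delta> k \<notin> period_lattice w1 w3"
    and fg: "finite_gap (potential w1 w3 m M n \<delta>) (potential_domain w1 w3 M \<delta>)"
    unfolding fuchsian_finite_gap_def by blast
  interpret wp_lattice w1 w3 by (rule wp_lattice.intro[OF L])
  have mod: "modulus = a" using a by (simp add: modulus_def \<kappa>_def)
  have Z\<delta>: "Z (\<delta> k) = b k" if "k \<in> {1..M}" for k
    using \<delta>(1)[OF that] \<kappa>_nz by (simp add: zcoord_def \<kappa>_def)
  show "\<exists>g. novikov_equation a (fuchs_I0 a m M n b) (fuchs_domain a M b) g"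
    using finite_gap_potential_iff_novikov[of M \<delta> b m n] \<delta>(2) Z\<delta> fg unfolding mod by blast
next
  assume nov: "\<exists>g. novikov_equation a (fuchs_I0 a m M n b) (fuchs_domain a M b) g"
  obtain w1 w3 where L: "wp_lattice w1 w3"
    and a: "(e3 w1 w3 - e1 w1 w3) / (e2 w1 w3 - e1 w1 w3) = a"
    using every_modulus_occurs[OF assms(1,2)] by blast
  interpret wp_lattice w1 w3 by (rule L)
  have mod: "modulus = a" using a by (simp add: modulus_def \<kappa>_def)
  have "\<forall>k. \<exists>d. d \<notin> \<Lambda> \<and> \<P> d = E1 + (E2 - E1) * b k"
    using wp_surjective by blast
  then obtain \<delta> where \<delta>: "\<And>k. \<delta> k \<notin> \<Lambda>" "\<And>k. \<P> (\<delta> k) = E1 + (E2 - E1) * b k"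
    by metis
  have Z\<delta>: "Z (\<delta> k) = b k" for k
    using \<delta>(2)[of k] \<kappa>_nz by (simp add: zcoord_def \<kappa>_def)
  have "schroedinger_transforms_to_fuchsian w1 w3 \<delta> modulus m M n b"
    by (rule schroedinger_to_fuchsian) (use assms mod \<delta>(1) Z\<delta> in auto)
  moreover have "finite_gap (potential w1 w3 m M n \<delta>) (potential_domain w1 w3 M \<delta>)"
    using finite_gap_potential_iff_novikov[of M \<delta> b m n] \<delta>(1) Z\<delta> nov unfolding mod by blast
  ultimately show "fuchsian_finite_gap a m M n b"
    unfolding fuchsian_finite_gap_def mod using nondegenerate a \<delta> by blast
qed

end
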